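(* Let $F$ be an almost h-conformal semi-invariant submersion, with dilation $\lambda$, from a hyperkähler manifold $(M,I,J,K,g_M)$ onto a Riemannian manifold $(N,g_N)$ such that $(I,J,K)$ is an almost h-conformal semi-invariant basis. For $R\in\{I,J,K\}$ let $(P_R)$ be the following condition: for all $X,Y\in\Gamma((\ker F_* )^{\perp})$ and $V\in\Gamma(\mathcal{D}_2^R)$, $$\mathcal{A}_Y\omega_R B_R X-\mathcal{A}_X\omega_R B_R Y+\phi_R(\mathcal{A}_Y C_R X-\mathcal{A}_X C_R Y)\in\Gamma(\mathcal{D}_2^R)$$ and $$\frac{1}{\lambda^2}g_N(\nabla^F_Y F_*C_R X-\nabla^F_X F_*C_R Y,\,F_*RV)=g_M\big(\mathcal{A}_X B_R Y-\mathcal{A}_Y B_R X-(C_R Y)(\ln\lambda)\,X+(C_R X)(\ln\lambda)\,Y+2g_M(X,C_R Y)\nabla(\ln\lambda),\,RV\big).$$ Then the following conditions are equivalent: (a) the distribution $(\ker F_* )^{\perp}$ is integrable; (b) $(P_I)$ holds; (c) $(P_J)$ holds; (d) $(P_K)$ holds.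
   Context: All manifolds and maps are $C^\infty$; $\Gamma(\cdot)$ denotes smooth sections. A hyperkähler manifold $(M,I,J,K,g_M)$ is a Riemannian manifold with global sections $I,J,K$ of $\mathrm{End}(TM)$ satisfying $I^2=J^2=K^2=-\mathrm{id}$, $IJ=-JI=K$, $JK=-KJ=I$, $KI=-IK=J$, $g_M(RX,RY)=g_M(X,Y)$ and $\nabla R=0$ for $R\in\{I,J,K\}$, where $\nabla$ is the Levi-Civita connection of $g_M$. A horizontally conformal submersion $F:(M,g_M)\to(N,g_N)$ with dilation $\lambda:M\to(0,\infty)$ is a surjective submersion with $g_N(F_*X,F_*Y)=\lambda^2g_M(X,Y)$ for all $X,Y\in(\ker F_* )^{\perp}$. It is an almost h-conformal semi-invariant submersion with almost h-conformal semi-invariant basis $(I,J,K)$ if for each $R\in\{I,J,K\}$ there is a distribution $\mathcal{D}_1^R\subset\ker F_*$ such that $\ker F_*=\mathcal{D}_1^R\oplus\mathcal{D}_2^R$, $R(\mathcal{D}_1^R)=\mathcal{D}_1^R$, $R(\mathcal{D}_2^R)\subset(\ker F_* )^{\perp}$, where $\mathcal{D}_2^R$ is the orthogonal complement of $\mathcal{D}_1^R$ in $\ker F_*$. Let $\mu^R$ be the orthogonal complement of $R\mathcal{D}_2^R$ in $(\ker F_* )^{\perp}$ (it is $R$-invariant). For $X\in\Gamma(\ker F_* )$ write $RX=\phi_RX+\omega_RX$ with $\phi_RX\in\Gamma(\mathcal{D}_1^R)$, $\omega_RX\in\Gamma(R\mathcal{D}_2^R)$; for $Z\in\Gamma((\ker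 F_* )^{\perp})$ write $RZ=B_RZ+C_RZ$ with $B_RZ\in\Gamma(\mathcal{D}_2^R)$, $C_RZ\in\Gamma(\mu^R)$. $\mathcal{V},\mathcal{H}$ denote the orthogonal projections of $TM$ onto $\ker F_*$ and $(\ker F_* )^{\perp}$. The O'Neill tensor is $\mathcal{A}_EG=\mathcal{H}\nabla_{\mathcal{H}E}\mathcal{V}G+\mathcal{V}\nabla_{\mathcal{H}E}\mathcal{H}G$. $\nabla^F$ is the pullback connection on $F^{*}TN$, $\nabla(\ln\lambda)$ is the gradient of $\ln\lambda$ with respect to $g_M$, and $Z(\ln\lambda)$ is the derivative of $\ln\lambda$ along $Z$. *)

theory Defs
  imports "HOL-Analysis.Analysis"
begin

section \<open>Smooth manifolds\<close>

text \<open>Used for open \<open>S\<close> and finite-dimensional domain only, where it is the usual notion of a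
  \<open>C\<^sup>k\<close> map.\<close>

fun Ck_on :: "nat \<Rightarrow> ('a::real_normed_vector \<Rightarrow> 'b::real_normed_vector) \<Rightarrow> 'a set \<Rightarrow> bool" where
  "Ck_on 0 f S \<longleftrightarrow> continuous_on S f"
| "Ck_on (Suc k) f S \<longleftrightarrow>
     (\<forall>x\<in>S. f differentiable (at x)) \<and>
     (\<forall>v. Ck_on k (\<lambda>x. frechet_derivative f (at x) v) S)"

definition smooth_on :: "('a::real_normed_vector \<Rightarrow> 'b::real_normed_vector) \<Rightarrow> 'a set \<Rightarrow> bool" where
  "smooth_on f S \<longleftrightarrow> (\<forall>k. Ck_on k f S)"

text \<open>A chart is a pair of a domain and a coordinate map; the values of the coordinate map outside
  the domain are irrelevant.\<close>

type_synonym ('m, 'e) chart = "'m set \<times> ('m \<Rightarrow> 'e)"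
type_synonym ('m, 'e) atlas = "('m, 'e) chart set"

definition inv_chart :: "('m, 'e) chart \<Rightarrow> 'e \<Rightarrow> 'm" where
  "inv_chart c = inv_into (fst c) (snd c)"

text \<open>The manifold is the whole type \<open>'m\<close>; Hausdorff and second countable by its sort. The atlas
  need not be maximal.\<close>

definition smooth_manifold ::
  "('m::{t2_space, second_countable_topology}, 'e::euclidean_space) atlas \<Rightarrow> bool" where
  "smooth_manifold A \<longleftrightarrow>
     (\<Union>c\<in>A. fst c) = UNIV \<and>
     (\<forall>c\<in>A. open (fst c) \<and> open (snd c ` fst c) \<and>
             homeomorphism (fst c) (snd c ` fst c) (snd c) (inv_chart c)) \<and>
     (\<forall>c\<in>A. \<forall>d\<in>A. smooth_on (\<lambda>x. snd d (inv_chart c x)) (snd c ` (fst c \<inter> fst d)))"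

text \<open>The tangent space at \<open>p\<close> is the model space \<open>'e\<close>, identified with the space of tangent
  vectors through one chart around \<open>p\<close>, chosen once and for all. Hence vector fields are functions
  \<open>'m \<Rightarrow> 'e\<close>, distributions are functions \<open>'m \<Rightarrow> 'e set\<close>, and so on; smoothness is always tested in
  all charts of the atlas, using the differentials of the charts.\<close>

definition chart_at :: "('m, 'e) atlas \<Rightarrow> 'm \<Rightarrow> ('m, 'e) chart" where
  "chart_at A p = (SOME c. c \<in> A \<and> p \<in> fst c)"

text \<open>\<open>dfun A f p v\<close> is the derivative at \<open>p\<close> of a vector-valued function \<open>f\<close> in the direction of
  the tangent vector \<open>v\<close>. In particular \<open>dfun A (snd c) p\<close> maps a tangent vector at \<open>p\<close> to its
  components in the chart \<open>c\<close>; \<open>coord_vec A c p\<close> is its inverse.\<close>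

definition dfun ::
  "('m, 'e::real_normed_vector) atlas \<Rightarrow> ('m \<Rightarrow> 'b::real_normed_vector) \<Rightarrow> 'm \<Rightarrow> 'e \<Rightarrow> 'b" where
  "dfun A f p v =
     frechet_derivative (\<lambda>x. f (inv_chart (chart_at A p) x)) (at (snd (chart_at A p) p)) v"

definition coord_vec ::
  "('m, 'e::real_normed_vector) atlas \<Rightarrow> ('m, 'e) chart \<Rightarrow> 'm \<Rightarrow> 'e \<Rightarrow> 'e" where
  "coord_vec A c p v =
     frechet_derivative (\<lambda>x. snd (chart_at A p) (inv_chart c x)) (at (snd c p)) v"

definition tangent_map ::
  "('m, 'e::real_normed_vector) atlas \<Rightarrow> ('n, 'f::real_normed_vector) atlas \<Rightarrow>
   ('m \<Rightarrow> 'n) \<Rightarrow> 'm \<Rightarrow> 'e \<Rightarrow> 'f" where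
  "tangent_map A B F p = dfun A (\<lambda>q. snd (chart_at B (F p)) (F q)) p"

definition smooth_fun ::
  "('m, 'e::real_normed_vector) atlas \<Rightarrow> ('m \<Rightarrow> 'b::real_normed_vector) \<Rightarrow> bool" where
  "smooth_fun A f \<longleftrightarrow> (\<forall>c\<in>A. smooth_on (\<lambda>x. f (inv_chart c x)) (snd c ` fst c))"

definition smooth_map ::
  "('m::topological_space, 'e::real_normed_vector) atlas \<Rightarrow>
   ('n::topological_space, 'f::real_normed_vector) atlas \<Rightarrow> ('m \<Rightarrow> 'n) \<Rightarrow> bool" where
  "smooth_map A B F \<longleftrightarrow>
     continuous_on UNIV F \<and>
     (\<forall>c\<in>A. \<forall>d\<in>B. smooth_on (\<lambda>x. snd d (F (inv_chart c x))) (snd c ` (fst c \<inter> F -` fst d)))"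

definition smooth_field_on ::
  "('m, 'e::real_normed_vector) atlas \<Rightarrow> 'm set \<Rightarrow> ('m \<Rightarrow> 'e) \<Rightarrow> bool" where
  "smooth_field_on A W X \<longleftrightarrow>
     (\<forall>c\<in>A. smooth_on (\<lambda>x. dfun A (snd c) (inv_chart c x) (X (inv_chart c x)))
               (snd c ` (fst c \<inter> W)))"

abbreviation smooth_field :: "('m, 'e::real_normed_vector) atlas \<Rightarrow> ('m \<Rightarrow> 'e) \<Rightarrow> bool" where
  "smooth_field A X \<equiv> smooth_field_on A UNIV X"

text \<open>Smooth sections of the pullback bundle \<open>F\<^sup>*TN\<close>, i.e. smooth vector fields along \<open>F\<close>.\<close>

definition smooth_along ::
  "('m, 'e::real_normed_vector) atlas \<Rightarrow> ('n, 'f::real_normed_vector) atlas \<Rightarrow>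
   ('m \<Rightarrow> 'n) \<Rightarrow> ('m \<Rightarrow> 'f) \<Rightarrow> bool" where
  "smooth_along A B F \<sigma> \<longleftrightarrow>
     (\<forall>c\<in>A. \<forall>d\<in>B.
        smooth_on (\<lambda>x. dfun B (snd d) (F (inv_chart c x)) (\<sigma> (inv_chart c x)))
          (snd c ` (fst c \<inter> F -` fst d)))"

text \<open>Smooth sections of \<open>End(TM)\<close>.\<close>

definition smooth_endo ::
  "('m, 'e::real_normed_vector) atlas \<Rightarrow> ('m \<Rightarrow> 'e \<Rightarrow> 'e) \<Rightarrow> bool" where
  "smooth_endo A R \<longleftrightarrow>
     (\<forall>p. linear (R p)) \<and>
     (\<forall>c\<in>A. \<forall>v.
        smooth_on
          (\<lambda>x. let p = inv_chart c x in dfun A (snd c) p (R p (coord_vec A c p v)))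
          (snd c ` fst c))"


section \<open>Distributions\<close>

definition smooth_distribution ::
  "('m::topological_space, 'e::euclidean_space) atlas \<Rightarrow> ('m \<Rightarrow> 'e set) \<Rightarrow> bool" where
  "smooth_distribution A D \<longleftrightarrow>
     (\<forall>p. subspace (D p)) \<and>
     (\<exists>k. \<forall>p. dim (D p) = k) \<and>
     (\<forall>p. \<exists>W \<X>. open W \<and> p \<in> W \<and> finite \<X> \<and> (\<forall>X\<in>\<X>. smooth_field_on A W X) \<and>
           (\<forall>q\<in>W. D q = span ((\<lambda>X. X q) ` \<X>)))"

definition sections :: "('m, 'e::real_normed_vector) atlas \<Rightarrow> ('m \<Rightarrow> 'e set) \<Rightarrow> ('m \<Rightarrow> 'e) set" where
  "sections A D = {X. smooth_field A X \<and> (\<forall>p. X p \<in> D p)}"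

text \<open>Through every point there is an integral manifold of \<open>D\<close>: an injectively immersed piece
  \<open>f ` U\<close> (with \<open>U\<close> open in \<open>'k\<close>) whose tangent space at each of its points is the value of \<open>D\<close>
  there. The type \<open>'k\<close> has to be instantiated so that \<open>DIM('k)\<close> is the rank of \<open>D\<close>.\<close>

definition integral_patch ::
  "('m::topological_space, 'e::real_normed_vector) atlas \<Rightarrow> ('m \<Rightarrow> 'e set) \<Rightarrow>
   'k::euclidean_space set \<Rightarrow> ('k \<Rightarrow> 'm) \<Rightarrow> bool" where
  "integral_patch A D U f \<longleftrightarrow>
     open U \<and> inj_on f U \<and> continuous_on U f \<and>
     (\<forall>c\<in>A. smooth_on (\<lambda>u. snd c (f u)) (U \<inter> f -` fst c)) \<and>
     (\<forall>u\<in>U. let df = frechet_derivative (\<lambda>w. snd (chart_at A (f u)) (f w)) (at u)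
            in inj df \<and> range df = D (f u))"

definition integrable_distribution ::
  "'k::euclidean_space itself \<Rightarrow> ('m::topological_space, 'e::real_normed_vector) atlas \<Rightarrow>
   ('m \<Rightarrow> 'e set) \<Rightarrow> bool" where
  "integrable_distribution _ A D \<longleftrightarrow>
     (\<forall>p. \<exists>(U::'k set) f. integral_patch A D U f \<and> p \<in> f ` U)"


section \<open>Riemannian metrics and connections\<close>

definition riemannian_manifold ::
  "('m::{t2_space, second_countable_topology}, 'e::euclidean_space) atlas \<Rightarrow>
   ('m \<Rightarrow> 'e \<Rightarrow> 'e \<Rightarrow> real) \<Rightarrow> bool" where
  "riemannian_manifold A g \<longleftrightarrow>
     smooth_manifold A \<and>
     (\<forall>p. bilinear (g p) \<and> (\<forall>u v. g p u v = g p v u) \<and> (\<forall>v. v \<noteq> 0 \<longrightarrow> g p v v > 0)) \<and>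
     (\<forall>c\<in>A. \<forall>u v.
        smooth_on
          (\<lambda>x. let p = inv_chart c x in g p (coord_vec A c p u) (coord_vec A c p v))
          (snd c ` fst c))"

text \<open>At \<open>p\<close>, the classical coordinate formula in the chart \<open>chart_at A p\<close>.\<close>

definition lie_bracket ::
  "('m, 'e::real_normed_vector) atlas \<Rightarrow> ('m \<Rightarrow> 'e) \<Rightarrow> ('m \<Rightarrow> 'e) \<Rightarrow> 'm \<Rightarrow> 'e" where
  "lie_bracket A X Y p =
     (let c = chart_at A p;
          X' = (\<lambda>q. dfun A (snd c) q (X q));
          Y' = (\<lambda>q. dfun A (snd c) q (Y q))
      in dfun A Y' p (X p) - dfun A X' p (Y p))"

definition affine_connection ::
  "('m, 'e::real_normed_vector) atlas \<Rightarrow> (('m \<Rightarrow> 'e) \<Rightarrow> ('m \<Rightarrow> 'e) \<Rightarrow> 'm \<Rightarrow> 'e) \<Rightarrow> bool" where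
  "affine_connection A nabla \<longleftrightarrow>
     (\<forall>X Y. smooth_field A X \<longrightarrow> smooth_field A Y \<longrightarrow> smooth_field A (nabla X Y)) \<and>
     (\<forall>X X' Y. smooth_field A X \<longrightarrow> smooth_field A X' \<longrightarrow> smooth_field A Y \<longrightarrow>
        nabla (\<lambda>p. X p + X' p) Y = (\<lambda>p. nabla X Y p + nabla X' Y p)) \<and>
     (\<forall>h X Y. smooth_fun A h \<longrightarrow> smooth_field A X \<longrightarrow> smooth_field A Y \<longrightarrow>
        nabla (\<lambda>p. h p *\<^sub>R X p) Y = (\<lambda>p. h p *\<^sub>R nabla X Y p)) \<and>
     (\<forall>X Y Y'. smooth_field A X \<longrightarrow> smooth_field A Y \<longrightarrow> smooth_field A Y' \<longrightarrow>
        nabla X (\<lambda>p. Y p + Y' p) = (\<lambda>p. nabla X Y p + nabla X Y' p)) \<and>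
     (\<forall>h X Y. smooth_fun A (h :: 'm \<Rightarrow> real) \<longrightarrow> smooth_field A X \<longrightarrow> smooth_field A Y \<longrightarrow>
        nabla X (\<lambda>p. h p *\<^sub>R Y p) = (\<lambda>p. dfun A h p (X p) *\<^sub>R Y p + h p *\<^sub>R nabla X Y p))"

definition levi_civita ::
  "('m, 'e::real_normed_vector) atlas \<Rightarrow> ('m \<Rightarrow> 'e \<Rightarrow> 'e \<Rightarrow> real) \<Rightarrow>
   (('m \<Rightarrow> 'e) \<Rightarrow> ('m \<Rightarrow> 'e) \<Rightarrow> 'm \<Rightarrow> 'e) \<Rightarrow> bool" where
  "levi_civita A g nabla \<longleftrightarrow>
     affine_connection A nabla \<and>
     (\<forall>X Y p. smooth_field A X \<longrightarrow> smooth_field A Y \<longrightarrow>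
        nabla X Y p - nabla Y X p = lie_bracket A X Y p) \<and>
     (\<forall>X Y Z p. smooth_field A X \<longrightarrow> smooth_field A Y \<longrightarrow> smooth_field A Z \<longrightarrow>
        dfun A (\<lambda>q. g q (Y q) (Z q)) p (X p) = g p (nabla X Y p) (Z p) + g p (Y p) (nabla X Z p))"

text \<open>The last clause, together with the connection axioms, determines \<open>nablaF\<close> uniquely:
  \<open>\<nabla>\<^sup>F\<^sub>X (W \<circ> F) = \<nabla>\<^sup>N\<^bsub>F\<^sub>* X\<^esub> W\<close>. Since \<open>nablaN\<close> takes vector fields as arguments, \<open>F\<^sub>* (X p)\<close> is
  extended to a vector field \<open>Y\<close> on \<open>N\<close>.\<close>

definition pullback_connection ::
  "('m, 'e::real_normed_vector) atlas \<Rightarrow> ('n, 'f::real_normed_vector) atlas \<Rightarrow> ('m \<Rightarrow> 'n) \<Rightarrow>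
   (('n \<Rightarrow> 'f) \<Rightarrow> ('n \<Rightarrow> 'f) \<Rightarrow> 'n \<Rightarrow> 'f) \<Rightarrow> (('m \<Rightarrow> 'e) \<Rightarrow> ('m \<Rightarrow> 'f) \<Rightarrow> 'm \<Rightarrow> 'f) \<Rightarrow> bool" where
  "pullback_connection A B F nablaN nablaF \<longleftrightarrow>
     (\<forall>X \<sigma>. smooth_field A X \<longrightarrow> smooth_along A B F \<sigma> \<longrightarrow> smooth_along A B F (nablaF X \<sigma>)) \<and>
     (\<forall>X X' \<sigma>. smooth_field A X \<longrightarrow> smooth_field A X' \<longrightarrow> smooth_along A B F \<sigma> \<longrightarrow>
        nablaF (\<lambda>p. X p + X' p) \<sigma> = (\<lambda>p. nablaF X \<sigma> p + nablaF X' \<sigma> p)) \<and>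
     (\<forall>h X \<sigma>. smooth_fun A h \<longrightarrow> smooth_field A X \<longrightarrow> smooth_along A B F \<sigma> \<longrightarrow>
        nablaF (\<lambda>p. h p *\<^sub>R X p) \<sigma> = (\<lambda>p. h p *\<^sub>R nablaF X \<sigma> p)) \<and>
     (\<forall>X \<sigma> \<tau>. smooth_field A X \<longrightarrow> smooth_along A B F \<sigma> \<longrightarrow> smooth_along A B F \<tau> \<longrightarrow>
        nablaF X (\<lambda>p. \<sigma> p + \<tau> p) = (\<lambda>p. nablaF X \<sigma> p + nablaF X \<tau> p)) \<and>
     (\<forall>h X \<sigma>. smooth_fun A (h :: 'm \<Rightarrow> real) \<longrightarrow> smooth_field A X \<longrightarrow> smooth_along A B F \<sigma> \<longrightarrow>
        nablaF X (\<lambda>p. h p *\<^sub>R \<sigma> p) = (\<lambda>p. dfun A h p (X p) *\<^sub>R \<sigma> p + h p *\<^sub>R nablaF X \<sigma> p)) \<and>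
     (\<forall>X Y W p. smooth_field A X \<longrightarrow> smooth_field B Y \<longrightarrow> smooth_field B W \<longrightarrow>
        Y (F p) = tangent_map A B F p (X p) \<longrightarrow>
        nablaF X (\<lambda>q. W (F q)) p = nablaN Y W (F p))"

definition gradient ::
  "('m, 'e::real_normed_vector) atlas \<Rightarrow> ('m \<Rightarrow> 'e \<Rightarrow> 'e \<Rightarrow> real) \<Rightarrow> ('m \<Rightarrow> real) \<Rightarrow> 'm \<Rightarrow> 'e" where
  "gradient A g h p = (THE v. \<forall>w. g p v w = dfun A h p w)"

definition hyperkaehler_manifold ::
  "('m::{t2_space, second_countable_topology}, 'e::euclidean_space) atlas \<Rightarrow>
   ('m \<Rightarrow> 'e \<Rightarrow> 'e \<Rightarrow> real) \<Rightarrow> (('m \<Rightarrow> 'e) \<Rightarrow> ('m \<Rightarrow> 'e) \<Rightarrow> 'm \<Rightarrow> 'e) \<Rightarrow>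
   ('m \<Rightarrow> 'e \<Rightarrow> 'e) \<Rightarrow> ('m \<Rightarrow> 'e \<Rightarrow> 'e) \<Rightarrow> ('m \<Rightarrow> 'e \<Rightarrow> 'e) \<Rightarrow> bool" where
  "hyperkaehler_manifold A g nabla I J K \<longleftrightarrow>
     riemannian_manifold A g \<and> levi_civita A g nabla \<and>
     (\<forall>p v. I p (I p v) = - v \<and> J p (J p v) = - v \<and> K p (K p v) = - v \<and>
            I p (J p v) = K p v \<and> J p (I p v) = - K p v \<and>
            J p (K p v) = I p v \<and> K p (J p v) = - I p v \<and>
            K p (I p v) = J p v \<and> I p (K p v) = - J p v) \<and>
     (\<forall>R\<in>{I, J, K}.
        smooth_endo A R \<and>
        (\<forall>p u v. g p (R p u) (R p v) = g p u v) \<and>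
        (\<forall>X Y. smooth_field A X \<longrightarrow> smooth_field A Y \<longrightarrow>
           nabla X (\<lambda>p. R p (Y p)) = (\<lambda>p. R p (nabla X Y p))))"


section \<open>Almost h-conformal semi-invariant submersions\<close>

definition orth_in :: "('e \<Rightarrow> 'e \<Rightarrow> real) \<Rightarrow> 'e set \<Rightarrow> 'e set \<Rightarrow> 'e set" where
  "orth_in G E D = {v \<in> E. \<forall>w\<in>D. G v w = 0}"

text \<open>The \<open>D\<close>-component of \<open>v\<close> for a direct sum decomposition \<open>D \<oplus> E\<close> of a space containing \<open>v\<close>.\<close>

definition component :: "'e::real_vector set \<Rightarrow> 'e set \<Rightarrow> 'e \<Rightarrow> 'e" where
  "component D E v = (THE d. d \<in> D \<and> v - d \<in> E)"

text \<open>In this locale, \<open>R\<close> is one of \<open>I\<close>, \<open>J\<close>, \<open>K\<close> and \<open>D1\<close> stands for \<open>\<D>\<^sub>1\<^sup>R\<close>.\<close>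

locale submersion_data =
  fixes A :: "('m::{t2_space, second_countable_topology}, 'e::euclidean_space) atlas"
    and gM :: "'m \<Rightarrow> 'e \<Rightarrow> 'e \<Rightarrow> real"
    and nablaM :: "('m \<Rightarrow> 'e) \<Rightarrow> ('m \<Rightarrow> 'e) \<Rightarrow> 'm \<Rightarrow> 'e"
    and B :: "('n::{t2_space, second_countable_topology}, 'f::euclidean_space) atlas"
    and gN :: "'n \<Rightarrow> 'f \<Rightarrow> 'f \<Rightarrow> real"
    and nablaF :: "('m \<Rightarrow> 'e) \<Rightarrow> ('m \<Rightarrow> 'f) \<Rightarrow> 'm \<Rightarrow> 'f"
    and F :: "'m \<Rightarrow> 'n"
    and lam :: "'m \<Rightarrow> real"
begin

abbreviation dF :: "'m \<Rightarrow> 'e \<Rightarrow> 'f" where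
  "dF \<equiv> tangent_map A B F"

definition vertical :: "'m \<Rightarrow> 'e set" where
  "vertical p = {v. dF p v = 0}"

definition horizontal :: "'m \<Rightarrow> 'e set" where
  "horizontal p = orth_in (gM p) UNIV (vertical p)"

definition vert :: "'m \<Rightarrow> 'e \<Rightarrow> 'e" where
  "vert p = component (vertical p) (horizontal p)"

definition hor :: "'m \<Rightarrow> 'e \<Rightarrow> 'e" where
  "hor p = component (horizontal p) (vertical p)"

definition oneill_A :: "('m \<Rightarrow> 'e) \<Rightarrow> ('m \<Rightarrow> 'e) \<Rightarrow> 'm \<Rightarrow> 'e" where
  "oneill_A E G p =
     hor p (nablaM (\<lambda>q. hor q (E q)) (\<lambda>q. vert q (G q)) p) +
     vert p (nablaM (\<lambda>q. hor q (E q)) (\<lambda>q. hor q (G q)) p)"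

definition horizontally_conformal_submersion :: bool where
  "horizontally_conformal_submersion \<longleftrightarrow>
     smooth_map A B F \<and> surj F \<and> (\<forall>p. surj (dF p)) \<and>
     smooth_fun A lam \<and> (\<forall>p. lam p > 0) \<and>
     (\<forall>p. \<forall>u\<in>horizontal p. \<forall>v\<in>horizontal p.
        gN (F p) (dF p u) (dF p v) = (lam p)\<^sup>2 * gM p u v)"

definition D2 :: "('m \<Rightarrow> 'e set) \<Rightarrow> 'm \<Rightarrow> 'e set" where
  "D2 D1 p = orth_in (gM p) (vertical p) (D1 p)"

definition semi_invariant :: "('m \<Rightarrow> 'e \<Rightarrow> 'e) \<Rightarrow> ('m \<Rightarrow> 'e set) \<Rightarrow> bool" where
  "semi_invariant R D1 \<longleftrightarrow>
     smooth_distribution A D1 \<and>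
     (\<forall>p. D1 p \<subseteq> vertical p \<and> R p ` D1 p = D1 p \<and> R p ` D2 D1 p \<subseteq> horizontal p)"

definition mu :: "('m \<Rightarrow> 'e \<Rightarrow> 'e) \<Rightarrow> ('m \<Rightarrow> 'e set) \<Rightarrow> 'm \<Rightarrow> 'e set" where
  "mu R D1 p = orth_in (gM p) (horizontal p) (R p ` D2 D1 p)"

definition phi :: "('m \<Rightarrow> 'e \<Rightarrow> 'e) \<Rightarrow> ('m \<Rightarrow> 'e set) \<Rightarrow> 'm \<Rightarrow> 'e \<Rightarrow> 'e" where
  "phi R D1 p v = component (D1 p) (R p ` D2 D1 p) (R p v)"

definition omega :: "('m \<Rightarrow> 'e \<Rightarrow> 'e) \<Rightarrow> ('m \<Rightarrow> 'e set) \<Rightarrow> 'm \<Rightarrow> 'e \<Rightarrow> 'e" where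
  "omega R D1 p v = component (R p ` D2 D1 p) (D1 p) (R p v)"

definition BB :: "('m \<Rightarrow> 'e \<Rightarrow> 'e) \<Rightarrow> ('m \<Rightarrow> 'e set) \<Rightarrow> 'm \<Rightarrow> 'e \<Rightarrow> 'e" where
  "BB R D1 p v = component (D2 D1 p) (mu R D1 p) (R p v)"

definition CC :: "('m \<Rightarrow> 'e \<Rightarrow> 'e) \<Rightarrow> ('m \<Rightarrow> 'e set) \<Rightarrow> 'm \<Rightarrow> 'e \<Rightarrow> 'e" where
  "CC R D1 p v = component (mu R D1 p) (D2 D1 p) (R p v)"

definition condition_P :: "('m \<Rightarrow> 'e \<Rightarrow> 'e) \<Rightarrow> ('m \<Rightarrow> 'e set) \<Rightarrow> bool" where
  "condition_P R D1 \<longleftrightarrow>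
     (\<forall>X\<in>sections A horizontal. \<forall>Y\<in>sections A horizontal. \<forall>V\<in>sections A (D2 D1).
        let \<phi> = phi R D1;
            BX = (\<lambda>p. BB R D1 p (X p)); BY = (\<lambda>p. BB R D1 p (Y p));
            CX = (\<lambda>p. CC R D1 p (X p)); CY = (\<lambda>p. CC R D1 p (Y p));
            \<omega>BX = (\<lambda>p. omega R D1 p (BX p)); \<omega>BY = (\<lambda>p. omega R D1 p (BY p));
            lnlam = (\<lambda>p. ln (lam p))
        in
          (\<lambda>p. oneill_A Y \<omega>BX p - oneill_A X \<omega>BY p + \<phi> p (oneill_A Y CX p - oneill_A X CY p))
            \<in> sections A (D2 D1) \<and>
          (\<forall>p.
             1 / (lam p)\<^sup>2 *
               gN (F p) (nablaF Y (\<lambda>q. dF q (CX q)) p - nablaF X (\<lambda>q. dF q (CY q)) p)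
                 (dF p (R p (V p))) =
             gM p
               (oneill_A X BY p - oneill_A Y BX p
                 - dfun A lnlam p (CY p) *\<^sub>R X p + dfun A lnlam p (CX p) *\<^sub>R Y p
                 + (2 * gM p (X p) (CY p)) *\<^sub>R gradient A gM lnlam p)
               (R p (V p))))"

end

end

theory Submission
  imports Defs
begin

text \<open>
  Each of the four conditions says that the bracket \<open>[X,Y]\<close> of two horizontal fields is
  horizontal (\<open>involutive\<close> below).

  For integrability this is Frobenius' theorem. Along an integral manifold, given in coordinates
  by \<open>\<eta>\<close>, the vertical projection \<open>P\<close> satisfies \<open>P(\<eta>) D\<eta> = 0\<close>; differentiating this and using the
  symmetry of second derivatives shows that \<open>P\<close> annihilates brackets
  (\<open>integrable_imp_involutive\<close>). Conversely, let \<open>L(y)\<close> be the linear map that sends a coordinate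
  vector of \<open>N\<close> to its horizontal lift at \<open>y\<close>. Two lifts of coordinate fields have a bracket that
  is horizontal, by involutivity, and vertical, because it projects to a bracket of coordinate
  fields; so it is zero. This is the compatibility condition for the total differential equation
  \<open>D\<eta> = L(\<eta>)\<close>, and its solutions parametrize integral manifolds (\<open>total_differential_equation\<close>,
  \<open>involutive_imp_integrable\<close>).

  For \<open>(P\<^sub>R)\<close>, the structure \<open>R\<close> is a parallel isometry, so the product of \<open>[X,Y]\<close> with a vector
  \<open>U\<close> is that of \<open>\<nabla>\<^sub>X(BY + CY) - \<nabla>\<^sub>Y(BX + CX)\<close> with \<open>RU\<close>. If \<open>U\<close> lies in \<open>D\<^sub>1\<close>, then \<open>RU\<close> is
  vertical and the result is the product of \<open>U\<close> with the field in the first half of \<open>(P\<^sub>R)\<close>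
  (\<open>D1_expression_inner\<close>). If \<open>U\<close> lies in \<open>D\<^sub>2\<close>, then \<open>RU\<close> is horizontal; the horizontal part of
  \<open>\<nabla>\<^sub>X CY\<close> is known from the pullback connection up to the second fundamental form of \<open>F\<close>, whose
  terms are the derivatives of \<open>ln \<lambda>\<close>, and the result is the difference of the two sides in the
  second half of \<open>(P\<^sub>R)\<close> (\<open>D2_expression\<close>). As \<open>ker F\<^sub>* = D\<^sub>1 \<oplus> D\<^sub>2\<close>, both halves together say
  that \<open>[X,Y]\<close> has no vertical part (\<open>condition_P_iff_involutive\<close>).

  The second fundamental form comes from Koszul's formula, written once on \<open>M\<close> and once for the
  fields \<open>F\<^sub>* X\<close> along \<open>F\<close> (\<open>second_fundamental_form\<close>). This needs that the pullback connection
  is metric and has no torsion on such fields, which follows from its axioms by expanding in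
  coordinate frames of \<open>N\<close> (\<open>metric_F\<close>, \<open>torsion_F\<close>).

  Connections are defined on global smooth fields only. Therefore the projections to the
  distributions have to preserve smoothness (Gram-Schmidt frames for \<open>D\<^sub>1\<close>, the adjoint of the
  tangent map for the horizontal distribution), and local fields are extended by bump functions.
\<close>

section \<open>Smooth maps between Euclidean spaces\<close>

abbreviation fderiv :: "('a::real_normed_vector \<Rightarrow> 'b::real_normed_vector) \<Rightarrow> 'a \<Rightarrow> 'a \<Rightarrow> 'b" where
  "fderiv f x \<equiv> frechet_derivative f (at x)"

lemma has_derivative_eventually_cong:
  assumes "eventually (\<lambda>y. f y = g y) (nhds x)"
  shows "(f has_derivative D) (at x) \<longleftrightarrow> (g has_derivative D) (at x)"
proof -
  have *: "(g has_derivative D) (at x)" if ev: "eventually (\<lambda>y. f y = g y) (nhds x)"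
    and f: "(f has_derivative D) (at x)" for f g
  proof -
    from ev obtain S where S: "open S" "x \<in> S" "\<And>y. y \<in> S \<Longrightarrow> f y = g y"
      by (auto simp: eventually_nhds)
    show ?thesis
      by (rule has_derivative_transform_within_open[OF f S(1,2)]) (use S(3) in auto)
  qed
  have "eventually (\<lambda>y. g y = f y) (nhds x)" using assms by (rule eventually_mono) auto
  with assms * show ?thesis by blast
qed

lemma frechet_derivative_eventually_cong:
  assumes "eventually (\<lambda>y. f y = g y) (nhds x)"
  shows "fderiv f x = fderiv g x"
  unfolding frechet_derivative_def has_derivative_eventually_cong[OF assms] ..

lemma differentiable_eventually_cong:
  assumes "eventually (\<lambda>y. f y = g y) (nhds x)"
  shows "f differentiable (at x) \<longleftrightarrow> g differentiable (at x)"
  unfolding differentiable_def has_derivative_eventually_cong[OF assms] ..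

lemma differentiable_has_fderiv:
  "f differentiable net \<Longrightarrow> (f has_derivative frechet_derivative f net) net"
  using frechet_derivative_works by blast

lemma frechet_derivative_eqI: "(f has_derivative D) (at x) \<Longrightarrow> fderiv f x = D"
  using frechet_derivative_at by metis

lemma Ck_on_subset: "Ck_on k f S \<Longrightarrow> T \<subseteq> S \<Longrightarrow> Ck_on k f T"
  by (induction k arbitrary: f) (auto intro: continuous_on_subset)

lemma Ck_on_cong:
  assumes "open S" "\<And>x. x \<in> S \<Longrightarrow> f x = g x"
  shows "Ck_on k f S \<longleftrightarrow> Ck_on k g S"
  using assms(2)
proof (induction k arbitrary: f g)
  case 0
  then show ?case by (auto intro: continuous_on_cong)
next
  case (Suc k)
  have ev: "eventually (\<lambda>y. f y = g y) (nhds x)" if "x \<in> S" for x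
    using assms(1) that Suc.prems by (auto simp: eventually_nhds)
  have "Ck_on k (\<lambda>x. fderiv f x v) S \<longleftrightarrow> Ck_on k (\<lambda>x. fderiv g x v) S" for v
    by (rule Suc.IH) (simp add: frechet_derivative_eventually_cong[OF ev])
  then show ?case
    by (simp add: differentiable_eventually_cong[OF ev])
qed

lemma Ck_on_SucD: "Ck_on (Suc k) f S \<Longrightarrow> Ck_on k f S"
proof (induction k arbitrary: f)
  case 0
  then show ?case
    by (auto intro!: continuous_at_imp_continuous_on differentiable_imp_continuous_within)
next
  case (Suc k)
  from Suc.prems have "Ck_on k (\<lambda>x. fderiv f x v) S" for v
    by (intro Suc.IH) auto
  with Suc.prems show ?case by auto
qed

lemma Ck_on_le: "Ck_on k f S \<Longrightarrow> j \<le> k \<Longrightarrow> Ck_on j f S"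
proof (induction k)
  case (Suc k)
  then show ?case by (metis Ck_on_SucD le_Suc_eq)
qed auto

lemma Ck_on_continuous: "Ck_on k f S \<Longrightarrow> continuous_on S f"
  using Ck_on_le[of k f S 0] by simp

lemma Ck_on_local:
  assumes "\<And>x. x \<in> S \<Longrightarrow> \<exists>T. open T \<and> x \<in> T \<and> Ck_on k f T"
  shows "Ck_on k f S"
  using assms
proof (induction k arbitrary: f)
  case 0
  show ?case unfolding Ck_on.simps continuous_on_eq_continuous_within
  proof
    fix x assume "x \<in> S"
    then obtain T where "open T" "x \<in> T" "continuous_on T f" using 0 by auto
    then show "continuous (at x within S) f"
      using continuous_on_eq_continuous_at continuous_at_imp_continuous_at_within by blast
  qed
next
  case (Suc k)
  have "f differentiable at x" if "x \<in> S" for x using Suc.prems[OF that] by auto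
  moreover have "Ck_on k (\<lambda>x. fderiv f x v) S" for v
    by (rule Suc.IH) (use Suc.prems in fastforce)
  ultimately show ?case by simp
qed

lemma Ck_on_const: "Ck_on k (\<lambda>x. c) S"
  by (induction k arbitrary: c) auto

lemma Ck_on_bounded_linear:
  assumes "bounded_linear f" shows "Ck_on k f S"
proof -
  have "(f has_derivative f) (at x)" for x using assms by (rule bounded_linear_imp_has_derivative)
  moreover from this have "fderiv f x = f" for x by (rule frechet_derivative_eqI)
  ultimately show ?thesis
    by (cases k) (auto simp: Ck_on_const differentiable_def linear_continuous_on assms)
qed

lemma Ck_on_add:
  assumes "open S" "Ck_on k f S" "Ck_on k g S"
  shows "Ck_on k (\<lambda>x. f x + g x) S"
  using assms(2,3)
proof (induction k arbitrary: f g)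
  case 0
  then show ?case by (auto intro: continuous_intros)
next
  case (Suc k)
  have d: "((\<lambda>x. f x + g x) has_derivative (\<lambda>v. fderiv f x v + fderiv g x v)) (at x)"
    if "x \<in> S" for x
    using Suc.prems that by (intro has_derivative_add differentiable_has_fderiv) auto
  have "Ck_on k (\<lambda>x. fderiv f x v + fderiv g x v) S" for v
    using Suc.prems by (intro Suc.IH) auto
  then have "Ck_on k (\<lambda>x. fderiv (\<lambda>x. f x + g x) x v) S" for v
    by (subst Ck_on_cong[OF assms(1)]) (auto simp: frechet_derivative_eqI[OF d])
  with d show ?case by (auto simp: differentiable_def)
qed

lemma Ck_on_bilinear:
  assumes "bounded_bilinear pr" "open S" "Ck_on k f S" "Ck_on k g S"
  shows "Ck_on k (\<lambda>x. pr (f x) (g x)) S"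
  using assms(3,4)
proof (induction k arbitrary: f g)
  case 0
  then show ?case by (auto intro: bounded_bilinear.continuous_on[OF assms(1)])
next
  case (Suc k)
  have d: "((\<lambda>x. pr (f x) (g x)) has_derivative
      (\<lambda>v. pr (f x) (fderiv g x v) + pr (fderiv f x v) (g x))) (at x)"
    if "x \<in> S" for x
    using Suc.prems that by (intro bounded_bilinear.FDERIV[OF assms(1)] differentiable_has_fderiv)
      auto
  have "Ck_on k (\<lambda>x. pr (f x) (fderiv g x v) + pr (fderiv f x v) (g x)) S" for v
    using Suc.prems Ck_on_SucD[OF Suc.prems(1)] Ck_on_SucD[OF Suc.prems(2)]
    by (intro Ck_on_add assms(2) Suc.IH) auto
  then have "Ck_on k (\<lambda>x. fderiv (\<lambda>x. pr (f x) (g x)) x v) S" for v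
    by (subst Ck_on_cong[OF assms(2)]) (auto simp: frechet_derivative_eqI[OF d])
  with d show ?case by (auto simp: differentiable_def)
qed

lemma Ck_on_sum:
  assumes "open S" "\<And>i. i \<in> I \<Longrightarrow> Ck_on k (f i) S"
  shows "Ck_on k (\<lambda>x. \<Sum>i\<in>I. f i x) S"
  using assms(2)
  by (induction I rule: infinite_finite_induct) (auto intro: Ck_on_const Ck_on_add assms(1))

lemma linear_euclidean_sum:
  fixes L :: "'a::euclidean_space \<Rightarrow> 'b::real_vector"
  assumes "linear L"
  shows "L v = (\<Sum>b\<in>Basis. (v \<bullet> b) *\<^sub>R L b)"
proof -
  have "L v = L (\<Sum>b\<in>Basis. (v \<bullet> b) *\<^sub>R b)" by (simp add: euclidean_representation)
  also have "\<dots> = (\<Sum>b\<in>Basis. (v \<bullet> b) *\<^sub>R L b)"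
    by (simp add: linear_sum[OF assms] linear_cmul[OF assms])
  finally show ?thesis .
qed

lemma Ck_on_apply_linear:
  fixes X :: "'a::real_normed_vector \<Rightarrow> 'b::euclidean_space"
  assumes "open S" "\<And>x. x \<in> S \<Longrightarrow> linear (L x)" "\<And>b. Ck_on k (\<lambda>x. L x b) S" "Ck_on k X S"
  shows "Ck_on k (\<lambda>x. L x (X x)) S"
proof -
  have "Ck_on k (\<lambda>x. \<Sum>b\<in>Basis. (X x \<bullet> b) *\<^sub>R L x b) S"
    by (intro Ck_on_sum assms(1) Ck_on_bilinear[OF bounded_bilinear_scaleR]
        Ck_on_bilinear[OF bounded_bilinear_inner] assms(3,4) Ck_on_const)
  also have "?this \<longleftrightarrow> ?thesis"
    by (rule Ck_on_cong[OF assms(1)]) (metis linear_euclidean_sum[OF assms(2)])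
  finally show ?thesis .
qed

text \<open>The derivative of \<open>g \<circ> f\<close> is the derivative of \<open>g\<close> at \<open>f x\<close> applied to that of \<open>f\<close>. It is
  linear in the latter, so a basis expansion turns it into a sum of products to which the
  induction hypothesis applies.\<close>

lemma Ck_on_compose:
  fixes f :: "'a::real_normed_vector \<Rightarrow> 'b::euclidean_space"
  assumes "open S" "f ` S \<subseteq> T" "Ck_on k g T" "Ck_on k f S"
  shows "Ck_on k (\<lambda>x. g (f x)) S"
  using assms(3,4)
proof (induction k arbitrary: g)
  case 0
  then show ?case using assms(2) by (auto intro: continuous_on_compose2)
next
  case (Suc k)
  have d: "((\<lambda>x. g (f x)) has_derivative
      (\<lambda>v. fderiv g (f x) (fderiv f x v))) (at x)" if "x \<in> S" for x
    using Suc.prems that assms(2)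
    by (intro has_derivative_compose[of f _ x UNIV g] differentiable_has_fderiv) auto
  have "Ck_on k (\<lambda>x. fderiv g (f x) (fderiv f x v)) S" for v
  proof (rule Ck_on_apply_linear[OF assms(1)])
    show "linear (fderiv g (f x))" if "x \<in> S" for x
      using that assms(2) Suc.prems(1) by (intro linear_frechet_derivative) auto
    show "Ck_on k (\<lambda>x. fderiv g (f x) b) S" for b
      using Suc.prems Ck_on_SucD[OF Suc.prems(2)] by (intro Suc.IH) auto
    show "Ck_on k (\<lambda>x. fderiv f x v) S" using Suc.prems by auto
  qed
  then have "Ck_on k (\<lambda>x. fderiv (\<lambda>x. g (f x)) x v) S" for v
    by (subst Ck_on_cong[OF assms(1)]) (auto simp: frechet_derivative_eqI[OF d])
  with d show ?case by (auto simp: differentiable_def)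
qed

subsection \<open>Germs of smooth maps\<close>

text \<open>Germs avoid the bookkeeping of domains in sums, products and compositions.\<close>

definition smooth_at :: "('a::real_normed_vector \<Rightarrow> 'b::real_normed_vector) \<Rightarrow> 'a \<Rightarrow> bool" where
  "smooth_at f x \<longleftrightarrow> (\<exists>S. open S \<and> x \<in> S \<and> smooth_on f S)"

lemma smooth_on_iff_smooth_at:
  assumes "open S" shows "smooth_on f S \<longleftrightarrow> (\<forall>x\<in>S. smooth_at f x)"
proof
  show "\<forall>x\<in>S. smooth_at f x" if "smooth_on f S" using that assms by (auto simp: smooth_at_def)
  show "smooth_on f S" if "\<forall>x\<in>S. smooth_at f x"
    unfolding smooth_on_def using that
      by (auto simp: smooth_at_def smooth_on_def intro!: Ck_on_local)
qed

lemma smooth_on_imp_smooth_at: "smooth_on f S \<Longrightarrow> open S \<Longrightarrow> x \<in> S \<Longrightarrow> smooth_at f x"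
  by (auto simp: smooth_at_def)

lemma smooth_at_eventually: "smooth_at f x \<Longrightarrow> eventually (smooth_at f) (nhds x)"
  unfolding eventually_nhds by (auto simp: smooth_at_def)

lemma smooth_at_cong:
  assumes "eventually (\<lambda>y. f y = g y) (nhds x)" shows "smooth_at f x \<longleftrightarrow> smooth_at g x"
proof -
  have *: "smooth_at g x" if ev: "eventually (\<lambda>y. f y = g y) (nhds x)" and sm: "smooth_at f x" for f
    g
  proof -
    obtain S where S: "open S" "x \<in> S" "\<And>y. y \<in> S \<Longrightarrow> f y = g y"
      using ev unfolding eventually_nhds by blast
    obtain T where T: "open T" "x \<in> T" "smooth_on f T"
      using sm unfolding smooth_at_def by blast
    have "Ck_on k g (S \<inter> T)" for k
    proof -
      have "Ck_on k f (S \<inter> T)" using T(3) Ck_on_subset unfolding smooth_on_def by blast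
      then show ?thesis using Ck_on_cong[of "S \<inter> T" f g k] S T by auto
    qed
    then show ?thesis using S T unfolding smooth_at_def smooth_on_def
      by (intro exI[of _ "S \<inter> T"]) auto
  qed
  have "eventually (\<lambda>y. g y = f y) (nhds x)" using assms by (rule eventually_mono) auto
  with assms * show ?thesis by blast
qed

lemma smooth_at_transform:
  "smooth_at f x \<Longrightarrow> eventually (\<lambda>y. g y = f y) (nhds x) \<Longrightarrow> smooth_at g x"
  using smooth_at_cong by blast

lemma smooth_at_differentiable: "smooth_at f x \<Longrightarrow> f differentiable (at x)"
  by (auto simp: smooth_at_def smooth_on_def dest: spec[of _ "Suc 0"])

lemma smooth_at_has_derivative:
  "smooth_at f x \<Longrightarrow> (f has_derivative fderiv f x) (at x)"
  by (intro differentiable_has_fderiv smooth_at_differentiable)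

lemma smooth_at_isCont: "smooth_at f x \<Longrightarrow> isCont f x"
  by (intro differentiable_imp_continuous_within smooth_at_differentiable)

lemma smooth_at_linear: "smooth_at f x \<Longrightarrow> linear (fderiv f x)"
  by (intro linear_frechet_derivative smooth_at_differentiable)

lemma smooth_at_derivative:
  "smooth_at f x \<Longrightarrow> smooth_at (\<lambda>y. fderiv f y v) x"
  unfolding smooth_at_def smooth_on_def by (metis Ck_on.simps(2))

text \<open>Bootstrapping: a differentiable function whose derivative is always as regular as the
  function itself gains one order of differentiability in each step.\<close>

lemma smooth_atI_derivative:
  assumes "open S" "x \<in> S" "\<And>y. y \<in> S \<Longrightarrow> f differentiable (at y)"
    and "\<And>v k. Ck_on k f S \<Longrightarrow> Ck_on k (\<lambda>y. fderiv f y v) S"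
  shows "smooth_at f x"
proof -
  have "Ck_on k f S" for k
  proof (induction k)
    case 0
    show ?case using assms(3)
      by (auto intro!: continuous_at_imp_continuous_on differentiable_imp_continuous_within)
  next
    case (Suc k) then show ?case using assms(3,4) by auto
  qed
  then show ?thesis using assms(1,2) by (auto simp: smooth_at_def smooth_on_def)
qed

lemma smooth_at_const [intro, simp]: "smooth_at (\<lambda>x. c) x"
  unfolding smooth_at_def smooth_on_def using Ck_on_const by blast

lemma smooth_at_bounded_linear: "bounded_linear f \<Longrightarrow> smooth_at f x"
  unfolding smooth_at_def smooth_on_def using Ck_on_bounded_linear by blast

lemma smooth_at_ident [intro, simp]: "smooth_at (\<lambda>x. x) x"
  by (intro smooth_at_bounded_linear bounded_linear_ident)

lemma smooth_at2E:
  assumes "smooth_at f x" "smooth_at g x"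
  obtains S where "open S" "x \<in> S" "\<And>k. Ck_on k f S" "\<And>k. Ck_on k g S"
proof -
  obtain S where S: "open S" "x \<in> S" "smooth_on f S" using assms(1) unfolding smooth_at_def by blast
  obtain T where T: "open T" "x \<in> T" "smooth_on g T" using assms(2) unfolding smooth_at_def by blast
  show thesis
    by (rule that[of "S \<inter> T"])
       (use S T in \<open>auto simp: smooth_on_def intro: Ck_on_subset[of _ f S] Ck_on_subset[of _ g T]\<close>)
qed

lemma smooth_at_bilinear:
  assumes "bounded_bilinear pr" "smooth_at f x" "smooth_at g x"
  shows "smooth_at (\<lambda>x. pr (f x) (g x)) x"
proof -
  obtain S where S: "open S" "x \<in> S" "\<And>k. Ck_on k f S" "\<And>k. Ck_on k g S"
    using smooth_at2E[OF assms(2,3)] by metis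
  then show ?thesis unfolding smooth_at_def smooth_on_def
    by (intro exI[of _ S]) (auto intro: Ck_on_bilinear[OF assms(1)])
qed

lemma smooth_at_add:
  assumes "smooth_at f x" "smooth_at g x"
  shows "smooth_at (\<lambda>x. f x + g x) x"
proof -
  obtain S where S: "open S" "x \<in> S" "\<And>k. Ck_on k f S" "\<And>k. Ck_on k g S"
    using smooth_at2E[OF assms] by metis
  then show ?thesis unfolding smooth_at_def smooth_on_def
    by (intro exI[of _ S]) (auto intro: Ck_on_add)
qed

lemmas smooth_at_scaleR = smooth_at_bilinear[OF bounded_bilinear_scaleR]
lemmas smooth_at_mult = smooth_at_bilinear[OF bounded_bilinear_mult]
lemmas smooth_at_inner = smooth_at_bilinear[OF bounded_bilinear_inner]

lemma smooth_at_minus: "smooth_at f x \<Longrightarrow> smooth_at (\<lambda>x. - f x) x"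
  using smooth_at_scaleR[OF smooth_at_const[of "-1::real"], of f x] by simp

lemma smooth_at_diff: "smooth_at f x \<Longrightarrow> smooth_at g x \<Longrightarrow> smooth_at (\<lambda>x. f x - g x) x"
  using smooth_at_add[of f x "\<lambda>x. - g x"] smooth_at_minus[of g x] by simp

lemma smooth_at_sum:
  assumes "\<And>i. i \<in> I \<Longrightarrow> smooth_at (f i) x" shows "smooth_at (\<lambda>x. \<Sum>i\<in>I. f i x) x"
  using assms by (induction I rule: infinite_finite_induct) (auto intro: smooth_at_add)

lemma smooth_at_compose:
  fixes f :: "'a::real_normed_vector \<Rightarrow> 'b::euclidean_space"
  assumes "smooth_at g (f x)" "smooth_at f x"
  shows "smooth_at (\<lambda>x. g (f x)) x"
proof -
  obtain S where S: "open S" "x \<in> S" "\<And>k. Ck_on k f S"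
    using assms(2) unfolding smooth_at_def smooth_on_def by blast
  obtain T where T: "open T" "f x \<in> T" "\<And>k. Ck_on k g T"
    using assms(1) unfolding smooth_at_def smooth_on_def by blast
  have "continuous_on S f" using S(3) Ck_on_continuous by blast
  then have o: "open (S \<inter> f -` T)" using S T continuous_open_preimage by blast
  have "Ck_on k f (S \<inter> f -` T)" for k using S(3) by (rule Ck_on_subset) auto
  then have "Ck_on k (\<lambda>x. g (f x)) (S \<inter> f -` T)" for k
    by (intro Ck_on_compose[OF o _ T(3)]) auto
  with S(2) T(2) o show ?thesis unfolding smooth_at_def smooth_on_def
    by (intro exI[of _ "S \<inter> f -` T"]) auto
qed

lemma smooth_at_apply_linear:
  fixes X :: "'a::real_normed_vector \<Rightarrow> 'b::euclidean_space"
  assumes "eventually (\<lambda>x. linear (L x)) (nhds x)" "\<And>b. b \<in> Basis \<Longrightarrow> smooth_at (\<lambda>x. L x b) x"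
    "smooth_at X x"
  shows "smooth_at (\<lambda>x. L x (X x)) x"
proof (rule smooth_at_transform)
  show "smooth_at (\<lambda>x. \<Sum>b\<in>Basis. (X x \<bullet> b) *\<^sub>R L x b) x"
    by (intro smooth_at_sum smooth_at_scaleR smooth_at_inner assms smooth_at_const)
  show "eventually (\<lambda>x. L x (X x) = (\<Sum>b\<in>Basis. (X x \<bullet> b) *\<^sub>R L x b)) (nhds x)"
    using assms(1) by (rule eventually_mono) (rule linear_euclidean_sum)
qed

lemma smooth_at_real:
  fixes f :: "real \<Rightarrow> real"
  assumes "open S" "x \<in> S" "\<And>y. y \<in> S \<Longrightarrow> (f has_real_derivative g y) (at y)"
    "\<And>k. Ck_on k f S \<Longrightarrow> Ck_on k g S"
  shows "smooth_at f x"
proof (rule smooth_atI_derivative[OF assms(1,2)])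
  have d: "(f has_derivative (*) (g y)) (at y)" if "y \<in> S" for y
    using assms(3)[OF that] by (simp add: has_field_derivative_def)
  then show "f differentiable (at y)" if "y \<in> S" for y using that by (auto simp: differentiable_def)
  fix v k assume "Ck_on k f S"
  then have "Ck_on k (\<lambda>y. g y * v) S"
    by (intro Ck_on_bilinear[OF bounded_bilinear_mult] assms(1,4) Ck_on_const)
  then show "Ck_on k (\<lambda>y. fderiv f y v) S"
    by (subst Ck_on_cong[OF assms(1)]) (auto simp: frechet_derivative_eqI[OF d])
qed

lemma smooth_at_inverse_real: "(x::real) \<noteq> 0 \<Longrightarrow> smooth_at inverse x"
proof (rule smooth_at_real[where S = "- {0}" and g = "\<lambda>y. - (inverse y * inverse y)"])
  fix k assume k: "Ck_on k (inverse :: real \<Rightarrow> real) (- {0})"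
  have "Ck_on k (\<lambda>y. (-1::real) * (inverse y * inverse y)) (- {0})"
    by (intro Ck_on_bilinear[OF bounded_bilinear_mult] k Ck_on_const) auto
  then show "Ck_on k (\<lambda>y. - (inverse y * inverse y)) (- {0::real})" by simp
qed (auto intro!: derivative_eq_intros)

lemma smooth_at_inverse:
  fixes f :: "'a::real_normed_vector \<Rightarrow> real"
  shows "smooth_at f x \<Longrightarrow> f x \<noteq> 0 \<Longrightarrow> smooth_at (\<lambda>x. inverse (f x)) x"
  by (rule smooth_at_compose[OF smooth_at_inverse_real])

lemma smooth_at_ln_real: "(x::real) > 0 \<Longrightarrow> smooth_at ln x"
proof (rule smooth_at_real[where S = "{0<..}" and g = inverse])
  fix k
  have "smooth_on (inverse :: real \<Rightarrow> real) {0<..}"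
    by (subst smooth_on_iff_smooth_at) (auto intro: smooth_at_inverse_real)
  then show "Ck_on k (inverse :: real \<Rightarrow> real) {0<..}" by (simp add: smooth_on_def)
qed (auto intro!: derivative_eq_intros simp: field_simps)

subsection \<open>Symmetry of second derivatives\<close>

lemma smooth_at_line_derivative:
  fixes f :: "'a::real_normed_vector \<Rightarrow> real"
  assumes "smooth_at f (a + s *\<^sub>R u)"
  shows "((\<lambda>s. f (a + s *\<^sub>R u)) has_real_derivative fderiv f (a + s *\<^sub>R u) u) (at s)"
proof -
  have l: "((\<lambda>s. a + s *\<^sub>R u) has_derivative (\<lambda>t. t *\<^sub>R u)) (at s)"
    by (auto intro!: derivative_eq_intros)
  have "((\<lambda>s. f (a + s *\<^sub>R u)) has_derivative (\<lambda>t. fderiv f (a + s *\<^sub>R u) (t *\<^sub>R u))) (at s)"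
    by (rule has_derivative_compose[OF l smooth_at_has_derivative[OF assms]])
  moreover have "(\<lambda>t. fderiv f (a + s *\<^sub>R u) (t *\<^sub>R u)) = (*) (fderiv f (a + s *\<^sub>R u) u)"
    by (auto simp: linear_cmul[OF smooth_at_linear[OF assms]])
  ultimately show ?thesis by (simp add: has_field_derivative_def)
qed

text \<open>The mean value theorem, applied first in the direction \<open>u\<close> and then in the direction \<open>v\<close>.\<close>

lemma second_difference:
  fixes f :: "'a::real_normed_vector \<Rightarrow> real"
  assumes sm: "\<And>y. y \<in> ball x d \<Longrightarrow> smooth_at f y" and h: "h > 0" "h * (norm u + norm v) < d"
  obtains y where "y \<in> ball x d"
    "f (x + h *\<^sub>R u + h *\<^sub>R v) - f (x + h *\<^sub>R u) - f (x + h *\<^sub>R v) + f x =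
      h * h * fderiv (\<lambda>y. fderiv f y u) y v"
proof -
  have inb: "x + s *\<^sub>R u + t *\<^sub>R v \<in> ball x d" if "0 \<le> s" "s \<le> h" "0 \<le> t" "t \<le> h" for s t
  proof -
    have "norm (s *\<^sub>R u + t *\<^sub>R v) \<le> s * norm u + t * norm v"
      using that norm_triangle_ineq[of "s *\<^sub>R u" "t *\<^sub>R v"] by simp
    also have "\<dots> \<le> h * norm u + h * norm v" using that by (intro add_mono mult_right_mono) auto
    finally show ?thesis using h(2)
      by (simp add: dist_norm algebra_simps norm_minus_commute)
  qed
  define g where "g s = f ((x + h *\<^sub>R v) + s *\<^sub>R u) - f (x + s *\<^sub>R u)" for s
  define D where "D = (\<lambda>y. fderiv f y u)"
  have "\<exists>z>0. z < h \<and> g h - g 0 = (h - 0) * (D ((x + h *\<^sub>R v) + z *\<^sub>R u) - D (x + z *\<^sub>R u))"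
  proof (rule MVT2[OF h(1)])
    fix s assume s: "0 \<le> s" "s \<le> h"
    show "(g has_real_derivative D ((x + h *\<^sub>R v) + s *\<^sub>R u) - D (x + s *\<^sub>R u)) (at s)"
      unfolding g_def D_def
      by (intro DERIV_diff smooth_at_line_derivative sm)
        (use inb[OF s, of h] inb[OF s, of 0] h in \<open>simp_all add: algebra_simps\<close>)
  qed
  then obtain z where z: "z > 0" "z < h"
    "g h - g 0 = h * (D ((x + h *\<^sub>R v) + z *\<^sub>R u) - D (x + z *\<^sub>R u))"
    by auto
  have "\<exists>w>0. w < h \<and> D ((x + z *\<^sub>R u) + h *\<^sub>R v) - D ((x + z *\<^sub>R u) + 0 *\<^sub>R v) =
      (h - 0) * fderiv D ((x + z *\<^sub>R u) + w *\<^sub>R v) v"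
  proof (rule MVT2[OF h(1)])
    fix t assume t: "0 \<le> t" "t \<le> h"
    show "((\<lambda>t. D ((x + z *\<^sub>R u) + t *\<^sub>R v)) has_real_derivative fderiv D ((x + z *\<^sub>R u) + t *\<^sub>R v)
        v) (at t)"
      unfolding D_def
      by (intro smooth_at_line_derivative smooth_at_derivative sm)
        (use inb[OF _ _ t, of z] z in auto)
  qed
  then obtain w where w: "w > 0" "w < h"
    "D ((x + z *\<^sub>R u) + h *\<^sub>R v) - D (x + z *\<^sub>R u) = h * fderiv D ((x + z *\<^sub>R u) + w *\<^sub>R v) v"
    by auto
  show ?thesis
  proof (rule that)
    show "(x + z *\<^sub>R u) + w *\<^sub>R v \<in> ball x d" using z w by (intro inb) auto
    have "g h - g 0 = f (x + h *\<^sub>R u + h *\<^sub>R v) - f (x + h *\<^sub>R u) - f (x + h *\<^sub>R v) + f x"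
      by (simp add: g_def algebra_simps)
    moreover have "g h - g 0 = h * (D ((x + z *\<^sub>R u) + h *\<^sub>R v) - D (x + z *\<^sub>R u))"
      using z(3) by (simp add: algebra_simps)
    ultimately show "f (x + h *\<^sub>R u + h *\<^sub>R v) - f (x + h *\<^sub>R u) - f (x + h *\<^sub>R v) + f x =
      h * h * fderiv (\<lambda>y. fderiv f y u) ((x + z *\<^sub>R u) + w *\<^sub>R v) v"
      using w(3) by (simp add: D_def)
  qed
qed

text \<open>The second difference does not depend on the order of the two directions, so the two mixed
  derivatives take a common value at points arbitrarily near \<open>x\<close>; they are continuous.\<close>

lemma second_derivative_symmetric_real:
  fixes f :: "'a::real_normed_vector \<Rightarrow> real"
  assumes sm: "smooth_at f x"
  shows "fderiv (\<lambda>y. fderiv f y u) x v =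
         fderiv (\<lambda>y. fderiv f y v) x u"
proof (rule ccontr)
  define P where "P u v = (\<lambda>y. fderiv (\<lambda>y. fderiv f y u) y v)" for u v
  assume "\<not> ?thesis"
  then have ne: "P u v x \<noteq> P v u x" by (simp add: P_def)
  define e where "e = dist (P u v x) (P v u x) / 2"
  have e: "e > 0" using ne by (simp add: e_def)
  have c: "isCont (P u v) x" for u v
    unfolding P_def by (intro smooth_at_isCont smooth_at_derivative sm)
  have ev: "eventually (\<lambda>y. dist (P u v y) (P u v x) < e) (nhds x)" for u v
    using c[of u v] e unfolding isCont_def tendsto_iff
    by (auto simp: eventually_at_filter elim!: eventually_mono) 
  have "eventually (\<lambda>y. smooth_at f y \<and> dist (P u v y) (P u v x) < e \<and> dist (P v u y) (P v u x) < e)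
      (nhds x)"
    by (intro eventually_conj ev smooth_at_eventually sm)
  then obtain d where d: "d > 0" "\<And>y. y \<in> ball x d \<Longrightarrow> smooth_at f y \<and> dist (P u v y) (P u v x) < e \<and>
      dist (P v u y) (P v u x) < e"
    unfolding eventually_nhds_metric by (auto simp: dist_commute)
  define h where "h = d / (2 * (norm u + norm v + 1))"
  have pos: "norm u + norm v + 1 > 0" by (simp add: add_nonneg_pos)
  have h: "h > 0" using d(1) pos by (simp add: h_def)
  have "h * (norm u + norm v) < h * (2 * (norm u + norm v + 1))"
    using h pos by (intro mult_strict_left_mono) (auto simp: algebra_simps add_nonneg_pos
      intro: add_nonneg_nonneg)
  also have "\<dots> = d" using pos by (simp add: h_def)
  finally have h2: "h * (norm u + norm v) < d" "h * (norm v + norm u) < d"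
    by (auto simp: add.commute)
  obtain y where y: "y \<in> ball x d"
    "f (x + h *\<^sub>R u + h *\<^sub>R v) - f (x + h *\<^sub>R u) - f (x + h *\<^sub>R v) + f x = h * h * P u v y"
    using second_difference[of x d f h u v] d(2) h h2 unfolding P_def by metis
  obtain z where z: "z \<in> ball x d"
    "f (x + h *\<^sub>R v + h *\<^sub>R u) - f (x + h *\<^sub>R v) - f (x + h *\<^sub>R u) + f x = h * h * P v u z"
    using second_difference[of x d f h v u] d(2) h h2 unfolding P_def by metis
  have "h * h * P u v y = h * h * P v u z"
    using y(2) z(2) by (simp add: algebra_simps)
  then have "P u v y = P v u z" using h by simp
  moreover have "dist (P u v y) (P u v x) < e" "dist (P v u z) (P v u x) < e" using d(2) y(1) z(1)
    by auto
  ultimately have "dist (P u v x) (P v u x) < e + e"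
    by (metis dist_commute dist_triangle_less_add)
  then show False by (simp add: e_def)
qed

lemma frechet_derivative_inner:
  assumes "smooth_at f x"
  shows "fderiv (\<lambda>y. f y \<bullet> b) x v = fderiv f x v \<bullet> b"
  by (subst frechet_derivative_eqI[OF
    has_derivative_inner_left[OF smooth_at_has_derivative[OF assms]]]) simp

lemma second_derivative_symmetric:
  fixes f :: "'a::real_normed_vector \<Rightarrow> 'b::euclidean_space"
  assumes sm: "smooth_at f x"
  shows "fderiv (\<lambda>y. fderiv f y u) x v =
         fderiv (\<lambda>y. fderiv f y v) x u"
proof (rule euclidean_eqI)
  fix b :: 'b assume "b \<in> Basis"
  have *: "fderiv (\<lambda>y. fderiv f y u) x v \<bullet> b =
    fderiv (\<lambda>y. fderiv (\<lambda>y. f y \<bullet> b) y u) x v" for u v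
  proof -
    have "fderiv (\<lambda>y. fderiv f y u) x v \<bullet> b =
      fderiv (\<lambda>y. fderiv f y u \<bullet> b) x v"
      by (simp add: frechet_derivative_inner smooth_at_derivative sm)
    also have "\<dots> = fderiv (\<lambda>y. fderiv (\<lambda>y. f y \<bullet> b) y u) x v"
      by (subst frechet_derivative_eventually_cong)
         (use smooth_at_eventually[OF sm]
           in \<open>auto elim!: eventually_mono simp: frechet_derivative_inner\<close>)
    finally show ?thesis .
  qed
  show "fderiv (\<lambda>y. fderiv f y u) x v \<bullet> b =
         fderiv (\<lambda>y. fderiv f y v) x u \<bullet> b"
    unfolding * by (rule second_derivative_symmetric_real)
      (intro smooth_at_inner sm smooth_at_const)
qed

subsection \<open>Bump functions\<close>

text \<open>The function \<open>t\<^sup>-\<^sup>n exp (-1/t)\<close>, extended by zero. The derivative of a member of this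
  family is a combination of two others, so smoothness follows by induction without formulas for
  higher derivatives.\<close>

definition flat :: "nat \<Rightarrow> real \<Rightarrow> real" where
  "flat n t = (if t \<le> 0 then 0 else inverse t ^ n * exp (- inverse t))"

text \<open>Quadratic decay gives the derivative \<open>0\<close> at the origin. It comes from a single term of the
  exponential series at \<open>1/t\<close>.\<close>

lemma flat_bound: "\<bar>flat n t\<bar> \<le> fact (n + 2) * t ^ 2"
proof (cases "t \<le> 0")
  case False
  then have t: "t > 0" by simp
  define s where "s = inverse t"
  have s: "s > 0" using t by (simp add: s_def)
  have "(\<Sum>k\<in>{n+2}. s ^ k /\<^sub>R fact k) \<le> (\<Sum>k. s ^ k /\<^sub>R fact k)"
    using s by (intro sum_le_suminf summable_exp_generic) auto
  then have "s ^ (n+2) \<le> fact (n+2) * exp s"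
    by (simp add: exp_def field_simps del: fact_Suc)
  then have "s ^ n * exp (- s) \<le> fact (n + 2) * inverse s ^ 2"
    using s by (simp add: exp_minus field_simps power_add power2_eq_square del: fact_Suc)
  with t show ?thesis by (simp add: flat_def s_def)
qed (auto simp: flat_def)

lemma flat_derivative:
  "(flat n has_real_derivative (flat (n + 2) t - real n * flat (n + 1) t)) (at t)"
proof -
  consider "t < 0" | "t = 0" | "t > 0" by linarith
  then show ?thesis
  proof cases
    case 1
    have "((\<lambda>t. 0) has_real_derivative 0) (at t)" by simp
    then have "(flat n has_real_derivative 0) (at t)"
      by (rule has_field_derivative_transform_within_open[of _ _ _ "{..<0}"])
        (use 1 in \<open>auto simp: flat_def\<close>)
    with 1 show ?thesis by (simp add: flat_def)
  next
    case 2
    have "((\<lambda>h. flat n h / h) \<longlongrightarrow> 0) (at 0)"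
    proof (rule Lim_null_comparison)
      show "eventually (\<lambda>h. norm (flat n h / h) \<le> fact (n + 2) * \<bar>h\<bar>) (at 0)"
        unfolding eventually_at_filter
      proof (intro always_eventually allI impI)
        fix h :: real assume "h \<noteq> 0"
        then show "norm (flat n h / h) \<le> fact (n + 2) * \<bar>h\<bar>"
          using flat_bound[of n h]
            by (simp add: field_simps power2_eq_square abs_mult del: fact_Suc)
      qed
      show "((\<lambda>h. fact (n + 2) * \<bar>h\<bar>) \<longlongrightarrow> 0) (at (0::real))"
        by (auto intro!: tendsto_eq_intros)
    qed
    then show ?thesis unfolding 2 DERIV_def by (simp add: flat_def)
  next
    case 3
    have "((\<lambda>t. inverse t ^ n * exp (- inverse t)) has_real_derivative
        (flat (n + 2) t - real n * flat (n + 1) t)) (at t)"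
    proof (cases n)
      case 0
      show ?thesis using 3 unfolding 0
        by (auto intro!: derivative_eq_intros simp: flat_def power2_eq_square)
    next
      case (Suc m)
      show ?thesis using 3 unfolding Suc
        by (auto intro!: derivative_eq_intros simp: flat_def field_simps power2_eq_square)
           (metis One_nat_def power_eq_if)
    qed
    then show ?thesis
      by (rule has_field_derivative_transform_within_open[of _ _ _ "{0<..}"])
        (use 3 in \<open>auto simp: flat_def\<close>)
  qed
qed

lemma flat_smooth: "smooth_at (flat n) x"
proof -
  have d: "(flat n has_derivative (*) (flat (n + 2) t - real n * flat (n + 1) t)) (at t)" for n t
    using flat_derivative by (simp add: has_field_derivative_def)
  have "Ck_on k (flat n) UNIV" for k
  proof (induction k arbitrary: n)
    case 0
    show ?case using flat_derivative[THEN DERIV_isCont]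
      by (auto intro!: continuous_at_imp_continuous_on)
  next
    case (Suc k)
    have "Ck_on k (\<lambda>t. fderiv (flat n) t v) UNIV" for v
    proof -
      have "Ck_on k (\<lambda>t. (flat (n + 2) t + (- real n) * flat (n + 1) t) * v) UNIV"
        by (intro Ck_on_bilinear[OF bounded_bilinear_mult] Ck_on_add Ck_on_const Suc) auto
      then show ?thesis by (simp add: frechet_derivative_eqI[OF d])
    qed
    moreover have "flat n differentiable at t" for t using d by (auto simp: differentiable_def)
    ultimately show ?case by simp
  qed
  then show ?thesis unfolding smooth_at_def smooth_on_def by blast
qed

text \<open>The quotient \<open>h (2 - s) / (h (2 - s) + h (s - 1))\<close>, where \<open>h = flat 0\<close> and \<open>s\<close> is the
  squared distance to \<open>a\<close> in units of \<open>r\<close>: it is \<open>1\<close> for \<open>s \<le> 1\<close> and \<open>0\<close> for \<open>s \<ge> 2\<close>.\<close>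

lemma bump_function:
  fixes a :: "'a::euclidean_space"
  assumes r: "r > 0"
  obtains \<beta> :: "'a \<Rightarrow> real" where "\<And>x. smooth_at \<beta> x" "\<And>x. dist a x \<le> r \<Longrightarrow> \<beta> x = 1"
    "\<And>x. dist a x \<ge> 2 * r \<Longrightarrow> \<beta> x = 0"
proof -
  define s where "s x = (inverse r)^2 * ((x - a) \<bullet> (x - a))" for x
  define \<beta> where "\<beta> x = flat 0 (2 - s x) * inverse (flat 0 (2 - s x) + flat 0 (s x - 1))" for x
  have ss: "smooth_at s x" for x unfolding s_def
    by (intro smooth_at_mult smooth_at_const smooth_at_inner smooth_at_diff smooth_at_ident)
  have pos: "flat 0 (2 - t) + flat 0 (t - 1) \<noteq> 0" for t
    by (auto simp: flat_def) (metis exp_gt_zero add_pos_pos less_irrefl)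
  have "smooth_at \<beta> x" for x unfolding \<beta>_def
    by (intro smooth_at_mult smooth_at_inverse smooth_at_add smooth_at_compose[OF flat_smooth]
        smooth_at_diff smooth_at_const ss pos)
  moreover have sd: "s x = (dist a x / r)^2" for x
    by (simp add: s_def dist_norm norm_minus_commute power2_norm_eq_inner[symmetric] field_simps)
  have "\<beta> x = 1" if "dist a x \<le> r" for x
  proof -
    have "s x \<le> 1" unfolding sd using that r by (intro power_le_one) auto
    then show ?thesis by (auto simp: \<beta>_def flat_def)
  qed
  moreover have "\<beta> x = 0" if "dist a x \<ge> 2 * r" for x
  proof -
    have "2 ^ 2 \<le> s x" unfolding sd using that r by (intro power_mono) (auto simp: field_simps)
    then show ?thesis by (auto simp: \<beta>_def flat_def)
  qed
  ultimately show ?thesis using that by blast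
qed

section \<open>Smooth functions and vector fields on a manifold\<close>

lemma tendsto_nhds_of_continuous_on:
  fixes f :: "'a::t2_space \<Rightarrow> 'b::topological_space"
  assumes "continuous_on S f" "open S" "x \<in> S" shows "(f \<longlongrightarrow> f x) (nhds x)"
  using assms continuous_on_eq_continuous_at[of S f] tendsto_at_iff_tendsto_nhds[of f x]
  by (simp add: isCont_def)

text \<open>The product rule for a family of linear maps that is known to be differentiable only
  argument by argument.\<close>

lemma frechet_derivative_apply_linear:
  fixes Y :: "'a::real_normed_vector \<Rightarrow> 'b::euclidean_space"
    and L :: "'a \<Rightarrow> 'b \<Rightarrow> 'c::real_normed_vector"
  assumes lin: "eventually (\<lambda>y. linear (L y)) (nhds x)"
    and sm: "\<And>b. smooth_at (\<lambda>y. L y b) x" and Y: "smooth_at Y x"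
  shows "fderiv (\<lambda>y. L y (Y y)) x u =
    fderiv (\<lambda>y. L y (Y x)) x u + L x (fderiv Y x u)"
proof -
  have Lx: "linear (L x)" using lin by (rule eventually_nhds_x_imp_x)
  have *: "fderiv (\<lambda>y. L y (Z y)) x u =
     (\<Sum>b\<in>Basis. (Z x \<bullet> b) *\<^sub>R fderiv (\<lambda>y. L y b) x u) +
     L x (fderiv Z x u)" if Z: "smooth_at Z x" for Z :: "'a \<Rightarrow> 'b"
  proof -
    have d: "((\<lambda>y. \<Sum>b\<in>Basis. (Z y \<bullet> b) *\<^sub>R L y b) has_derivative
      (\<lambda>u. \<Sum>b\<in>Basis. (Z x \<bullet> b) *\<^sub>R fderiv (\<lambda>y. L y b) x u +
          (fderiv Z x u \<bullet> b) *\<^sub>R L x b)) (at x)"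
      by (intro has_derivative_sum has_derivative_scaleR has_derivative_inner_left
          smooth_at_has_derivative sm Z)
    have "eventually (\<lambda>y. L y (Z y) = (\<Sum>b\<in>Basis. (Z y \<bullet> b) *\<^sub>R L y b)) (nhds x)"
      using lin by (rule eventually_mono) (rule linear_euclidean_sum)
    from frechet_derivative_eventually_cong[OF this] show ?thesis
      unfolding frechet_derivative_eqI[OF d]
      by (simp add: sum.distrib linear_euclidean_sum[OF Lx, symmetric])
  qed
  show ?thesis using *[OF Y] *[of "\<lambda>_. Y x"] linear_0[OF Lx] by simp
qed

lemma frechet_derivative_apply:
  fixes Y :: "'a::euclidean_space \<Rightarrow> 'a" and f :: "'a \<Rightarrow> 'b::real_normed_vector"
  assumes f: "smooth_at f x" and Y: "smooth_at Y x"
  shows "fderiv (\<lambda>y. fderiv f y (Y y)) x u =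
    fderiv (\<lambda>y. fderiv f y (Y x)) x u +
    fderiv f x (fderiv Y x u)"
proof (rule frechet_derivative_apply_linear[OF _ smooth_at_derivative[OF f] Y])
  show "eventually (\<lambda>y. linear (fderiv f y)) (nhds x)"
    using smooth_at_eventually[OF f] by (rule eventually_mono) (rule smooth_at_linear)
qed

text \<open>Stated in the chart that is distinguished at \<open>p\<close>; any other chart around \<open>p\<close> gives the same
  notion (\<open>fun_smooth_at_chart\<close>).\<close>

definition fun_smooth_at ::
  "('m, 'e::real_normed_vector) atlas \<Rightarrow> ('m \<Rightarrow> 'b::real_normed_vector) \<Rightarrow> 'm \<Rightarrow> bool" where
  "fun_smooth_at A f p \<longleftrightarrow>
     smooth_at (\<lambda>x. f (inv_chart (chart_at A p) x)) (snd (chart_at A p) p)"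

definition field_smooth_at :: "('m, 'e::real_normed_vector) atlas \<Rightarrow> ('m \<Rightarrow> 'e) \<Rightarrow> 'm \<Rightarrow> bool" where
  "field_smooth_at A X p \<longleftrightarrow>
     (\<forall>c\<in>A. p \<in> fst c \<longrightarrow> fun_smooth_at A (\<lambda>q. dfun A (snd c) q (X q)) p)"

locale manifold =
  fixes A :: "('m::{t2_space, second_countable_topology}, 'e::euclidean_space) atlas"
  assumes smooth_manifold: "smooth_manifold A"
begin

subsection \<open>Charts\<close>

lemma chart_at: "chart_at A p \<in> A" "p \<in> fst (chart_at A p)"
proof -
  have "p \<in> (\<Union>c\<in>A. fst c)" using smooth_manifold by (auto simp: smooth_manifold_def)
  then have "\<exists>c. c \<in> A \<and> p \<in> fst c" by blast
  then have "chart_at A p \<in> A \<and> p \<in> fst (chart_at A p)" unfolding chart_at_def by (rule someI_ex)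
  then show "chart_at A p \<in> A" "p \<in> fst (chart_at A p)" by auto
qed

lemma open_dom: "c \<in> A \<Longrightarrow> open (fst c)"
  and open_range: "c \<in> A \<Longrightarrow> open (snd c ` fst c)"
  and chart_homeomorphism: "c \<in> A \<Longrightarrow> homeomorphism (fst c) (snd c ` fst c) (snd c) (inv_chart c)"
  using smooth_manifold by (auto simp: smooth_manifold_def)

lemma inv_chart_snd [simp]: "c \<in> A \<Longrightarrow> q \<in> fst c \<Longrightarrow> inv_chart c (snd c q) = q"
  using chart_homeomorphism by (auto simp: homeomorphism_def)

lemma snd_inv_chart [simp]: "c \<in> A \<Longrightarrow> x \<in> snd c ` fst c \<Longrightarrow> snd c (inv_chart c x) = x"
  by auto

lemma inv_chart_dom: "c \<in> A \<Longrightarrow> x \<in> snd c ` fst c \<Longrightarrow> inv_chart c x \<in> fst c"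
  by auto

lemma chart_tendsto: "c \<in> A \<Longrightarrow> p \<in> fst c \<Longrightarrow> (snd c \<longlongrightarrow> snd c p) (nhds p)"
  by (rule tendsto_nhds_of_continuous_on[OF _ open_dom]) (use chart_homeomorphism
    in \<open>auto simp: homeomorphism_def\<close>)

lemma inv_chart_tendsto: "c \<in> A \<Longrightarrow> p \<in> fst c \<Longrightarrow> (inv_chart c \<longlongrightarrow> p) (nhds (snd c p))"
  using tendsto_nhds_of_continuous_on[OF _ open_range, of c "inv_chart c" "snd c p"]
    chart_homeomorphism[of c]
  by (auto simp: homeomorphism_def)

lemma eventually_dom: "c \<in> A \<Longrightarrow> p \<in> fst c \<Longrightarrow> eventually (\<lambda>q. q \<in> fst c) (nhds p)"
  using open_dom eventually_nhds_in_open by blast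

lemma eventually_range: "c \<in> A \<Longrightarrow> p \<in> fst c \<Longrightarrow> eventually (\<lambda>x. x \<in> snd c ` fst c) (nhds (snd c p))"
  using open_range eventually_nhds_in_open by blast

lemma eventually_inv_chart:
  assumes "c \<in> A" "p \<in> fst c"
  shows "eventually (\<lambda>x. P (inv_chart c x)) (nhds (snd c p)) \<longleftrightarrow> eventually P (nhds p)"
proof
  assume "eventually P (nhds p)"
  then show "eventually (\<lambda>x. P (inv_chart c x)) (nhds (snd c p))"
    using inv_chart_tendsto[OF assms] by (rule eventually_compose_filterlim)
next
  assume "eventually (\<lambda>x. P (inv_chart c x)) (nhds (snd c p))"
  then have "eventually (\<lambda>q. P (inv_chart c (snd c q))) (nhds p)"
    using chart_tendsto[OF assms] by (rule eventually_compose_filterlim)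
  with eventually_dom[OF assms] show "eventually P (nhds p)"
    by eventually_elim (use assms in simp)
qed

lemma open_chart_image:
  assumes "c \<in> A" "open W" shows "open (snd c ` (fst c \<inter> W))"
proof -
  have "snd c ` (fst c \<inter> W) = snd c ` fst c \<inter> inv_chart c -` W" using assms(1) by force
  moreover have "open (snd c ` fst c \<inter> inv_chart c -` W)"
    using chart_homeomorphism[OF assms(1)] open_range[OF assms(1)] assms(2)
    by (intro continuous_open_preimage) (auto simp: homeomorphism_def)
  ultimately show ?thesis by simp
qed

lemma transition_smooth_at:
  assumes "c \<in> A" "d \<in> A" "p \<in> fst c" "p \<in> fst d"
  shows "smooth_at (\<lambda>x. snd d (inv_chart c x)) (snd c p)"
proof (rule smooth_on_imp_smooth_at)
  show "smooth_on (\<lambda>x. snd d (inv_chart c x)) (snd c ` (fst c \<inter> fst d))"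
    using smooth_manifold assms by (auto simp: smooth_manifold_def)
  show "open (snd c ` (fst c \<inter> fst d))" using assms by (intro open_chart_image open_dom)
qed (use assms in auto)

subsection \<open>Germs of smooth functions\<close>

lemma fun_smooth_at_chart:
  fixes f :: "'m \<Rightarrow> 'b::real_normed_vector"
  assumes "c \<in> A" "p \<in> fst c"
  shows "fun_smooth_at A f p \<longleftrightarrow> smooth_at (\<lambda>x. f (inv_chart c x)) (snd c p)"
proof -
  have *: "smooth_at (\<lambda>x. f (inv_chart d x)) (snd d p)"
    if "smooth_at (\<lambda>x. f (inv_chart c x)) (snd c p)" "c \<in> A" "d \<in> A" "p \<in> fst c" "p \<in> fst d" for c d
  proof (rule smooth_at_transform)
    show "smooth_at (\<lambda>x. f (inv_chart c (snd c (inv_chart d x)))) (snd d p)"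
      using smooth_at_compose[of "\<lambda>x. f (inv_chart c x)" "\<lambda>x. snd c (inv_chart d x)" "snd d p"]
      that transition_smooth_at[of d c p] by simp
    have "eventually (\<lambda>q. q \<in> fst c) (nhds p)" using that eventually_dom by simp
    then show "eventually (\<lambda>x. f (inv_chart d x) = f (inv_chart c (snd c (inv_chart d x))))
        (nhds (snd d p))"
      unfolding eventually_inv_chart[OF that(3,5), symmetric]
      by eventually_elim (use that in simp)
  qed
  from *[of c "chart_at A p"] *[of "chart_at A p" c] show ?thesis
    unfolding fun_smooth_at_def using assms chart_at by blast
qed

lemma fun_smooth_at_cong:
  assumes "eventually (\<lambda>q. f q = g q) (nhds p)" shows "fun_smooth_at A f p \<longleftrightarrow> fun_smooth_at A g p"
  unfolding fun_smooth_at_def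
  by (rule smooth_at_cong)
     (use assms in \<open>simp add: eventually_inv_chart[OF chart_at, of "\<lambda>q. f q = g q"]\<close>)

lemma fun_smooth_at_transform:
  "fun_smooth_at A f p \<Longrightarrow> eventually (\<lambda>q. g q = f q) (nhds p) \<Longrightarrow> fun_smooth_at A g p"
  by (subst fun_smooth_at_cong)

lemma fun_smooth_at_eventually:
  assumes "fun_smooth_at A f p" shows "eventually (fun_smooth_at A f) (nhds p)"
proof -
  define c where "c = chart_at A p"
  have c: "c \<in> A" "p \<in> fst c" unfolding c_def using chart_at by auto
  have "eventually (smooth_at (\<lambda>x. f (inv_chart c x))) (nhds (snd c p))"
    using assms by (intro smooth_at_eventually) (simp add: fun_smooth_at_def c_def)
  then have "eventually (\<lambda>q. smooth_at (\<lambda>x. f (inv_chart c x)) (snd c q)) (nhds p)"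
    using chart_tendsto[OF c] by (rule eventually_compose_filterlim)
  with eventually_dom[OF c] show ?thesis
    by eventually_elim (use fun_smooth_at_chart[OF c(1)] in blast)
qed

lemma fun_smooth_at_const [simp, intro]: "fun_smooth_at A (\<lambda>q. k) p"
  by (simp add: fun_smooth_at_def)

lemma fun_smooth_at_add: "fun_smooth_at A f p \<Longrightarrow> fun_smooth_at A g p \<Longrightarrow>
    fun_smooth_at A (\<lambda>q. f q + g q) p"
  and fun_smooth_at_scaleR: "fun_smooth_at A r p \<Longrightarrow> fun_smooth_at A g p \<Longrightarrow>
      fun_smooth_at A (\<lambda>q. r q *\<^sub>R g q) p"
  unfolding fun_smooth_at_def by (intro smooth_at_add smooth_at_scaleR; assumption)+

lemma fun_smooth_at_mult:
  fixes f g :: "'m \<Rightarrow> real"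
  shows "fun_smooth_at A f p \<Longrightarrow> fun_smooth_at A g p \<Longrightarrow> fun_smooth_at A (\<lambda>q. f q * g q) p"
  unfolding fun_smooth_at_def by (intro smooth_at_mult)

lemma fun_smooth_at_inner:
  "fun_smooth_at A f p \<Longrightarrow> fun_smooth_at A g p \<Longrightarrow> fun_smooth_at A (\<lambda>q. f q \<bullet> g q) p"
  unfolding fun_smooth_at_def by (intro smooth_at_inner)

lemma fun_smooth_at_compose:
  fixes f :: "'m \<Rightarrow> 'b::euclidean_space"
  assumes "smooth_at g (f p)" "fun_smooth_at A f p" shows "fun_smooth_at A (\<lambda>q. g (f q)) p"
  using assms smooth_at_compose[of g "\<lambda>x. f (inv_chart (chart_at A p) x)"] chart_at
  unfolding fun_smooth_at_def by simp

lemma fun_smooth_at_inverse: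
  fixes f :: "'m \<Rightarrow> real"
  shows "fun_smooth_at A f p \<Longrightarrow> f p \<noteq> 0 \<Longrightarrow> fun_smooth_at A (\<lambda>q. inverse (f q)) p"
  by (rule fun_smooth_at_compose[OF smooth_at_inverse_real])

lemma fun_smooth_at_ln:
  fixes f :: "'m \<Rightarrow> real"
  shows "fun_smooth_at A f p \<Longrightarrow> f p > 0 \<Longrightarrow> fun_smooth_at A (\<lambda>q. ln (f q)) p"
  by (rule fun_smooth_at_compose[OF smooth_at_ln_real])

lemma fun_smooth_at_apply_linear:
  fixes X :: "'m \<Rightarrow> 'b::euclidean_space"
  assumes "eventually (\<lambda>q. linear (L q)) (nhds p)" "\<And>b. b \<in> Basis \<Longrightarrow> fun_smooth_at A (\<lambda>q. L q b) p"
    "fun_smooth_at A X p"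
  shows "fun_smooth_at A (\<lambda>q. L q (X q)) p"
proof -
  have "eventually (\<lambda>x. linear (L (inv_chart (chart_at A p) x))) (nhds (snd (chart_at A p) p))"
    using assms(1) by (simp add: eventually_inv_chart[OF chart_at, of "\<lambda>q. linear (L q)"])
  then show ?thesis
    using assms(2,3) unfolding fun_smooth_at_def by (rule smooth_at_apply_linear)
qed

lemma fun_smooth_at_chart_map: "c \<in> A \<Longrightarrow> p \<in> fst c \<Longrightarrow> fun_smooth_at A (snd c) p"
  unfolding fun_smooth_at_def using transition_smooth_at chart_at by auto

lemma fun_smooth_at_comp_chart:
  assumes "c \<in> A" "p \<in> fst c" "smooth_at g (snd c p)" shows "fun_smooth_at A (\<lambda>q. g (snd c q)) p"
  by (rule fun_smooth_at_compose) (use assms fun_smooth_at_chart_map in auto)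

lemma smooth_fun_iff: "smooth_fun A f \<longleftrightarrow> (\<forall>p. fun_smooth_at A f p)"
proof
  assume f: "smooth_fun A f"
  show "\<forall>p. fun_smooth_at A f p"
  proof
    fix p
    have "smooth_on (\<lambda>x. f (inv_chart (chart_at A p) x)) (snd (chart_at A p) ` fst (chart_at A p))"
      using f chart_at by (auto simp: smooth_fun_def)
    then show "fun_smooth_at A f p" unfolding fun_smooth_at_def
      by (rule smooth_on_imp_smooth_at) (use chart_at open_range in auto)
  qed
next
  assume f: "\<forall>p. fun_smooth_at A f p"
  show "smooth_fun A f" unfolding smooth_fun_def
  proof
    fix c assume c: "c \<in> A"
    have "\<forall>p\<in>fst c. smooth_at (\<lambda>x. f (inv_chart c x)) (snd c p)"
      using f fun_smooth_at_chart[OF c] by blast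
    then show "smooth_on (\<lambda>x. f (inv_chart c x)) (snd c ` fst c)"
      unfolding smooth_on_iff_smooth_at[OF open_range[OF c]] by simp
  qed
qed

subsection \<open>Derivatives of functions\<close>

lemma dfun_has_derivative:
  "fun_smooth_at A f p \<Longrightarrow>
   ((\<lambda>x. f (inv_chart (chart_at A p) x)) has_derivative dfun A f p) (at (snd (chart_at A p) p))"
  unfolding fun_smooth_at_def dfun_def by (drule smooth_at_has_derivative) simp

lemma dfun_eqI:
  "((\<lambda>x. f (inv_chart (chart_at A p) x)) has_derivative D) (at (snd (chart_at A p) p)) \<Longrightarrow>
      dfun A f p = D"
  unfolding dfun_def by (auto dest: frechet_derivative_eqI)

lemma dfun_linear: "fun_smooth_at A f p \<Longrightarrow> linear (dfun A f p)"
  using dfun_has_derivative has_derivative_linear by blast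

lemma dfun_cong: "eventually (\<lambda>q. f q = g q) (nhds p) \<Longrightarrow> dfun A f p = dfun A g p"
  unfolding dfun_def
  by (subst frechet_derivative_eventually_cong)
     (use eventually_inv_chart[OF chart_at, of "\<lambda>q. f q = g q"] in simp_all)

lemma dfun_const [simp]: "dfun A (\<lambda>q. k) p v = 0"
  by (simp add: dfun_def)

lemma dfun_scaleR: "fun_smooth_at A r p \<Longrightarrow> fun_smooth_at A g p \<Longrightarrow>
    dfun A (\<lambda>q. r q *\<^sub>R g q) p v = r p *\<^sub>R dfun A g p v + dfun A r p v *\<^sub>R g p"
  by (subst dfun_eqI[OF has_derivative_scaleR[OF dfun_has_derivative[of r]
    dfun_has_derivative[of g]]])
     (auto simp: chart_at)

lemma dfun_mult:
  fixes f g :: "'m \<Rightarrow> real"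
  shows "fun_smooth_at A f p \<Longrightarrow> fun_smooth_at A g p \<Longrightarrow>
    dfun A (\<lambda>q. f q * g q) p v = f p * dfun A g p v + dfun A f p v * g p"
  using dfun_scaleR[of f p g v] by simp

lemma dfun_sum: "(\<And>i. i \<in> I \<Longrightarrow> fun_smooth_at A (f i) p) \<Longrightarrow>
    dfun A (\<lambda>q. \<Sum>i\<in>I. f i q) p v = (\<Sum>i\<in>I. dfun A (f i) p v)"
  by (subst dfun_eqI[OF has_derivative_sum[OF dfun_has_derivative[of "f i" for i]]]) auto

lemma dfun_compose:
  fixes f :: "'m \<Rightarrow> 'b::real_normed_vector"
  assumes "smooth_at g (f p)" "fun_smooth_at A f p"
  shows "dfun A (\<lambda>q. g (f q)) p v = fderiv g (f p) (dfun A f p v)"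
proof -
  have "((\<lambda>x. g (f (inv_chart (chart_at A p) x))) has_derivative
     (\<lambda>v. fderiv g (f (inv_chart (chart_at A p) (snd (chart_at A p) p))) (dfun A f p v)))
       (at (snd (chart_at A p) p))"
    by (rule has_derivative_compose[OF dfun_has_derivative[OF assms(2)]])
       (use smooth_at_has_derivative[OF assms(1)] chart_at in simp)
  from dfun_eqI[OF this] show ?thesis using chart_at by simp
qed

lemma dfun_inner_left: 
  "fun_smooth_at A f p \<Longrightarrow> dfun A (\<lambda>q. f q \<bullet> b) p v = dfun A f p v \<bullet> b"
  by (subst dfun_eqI[OF has_derivative_inner_left[OF dfun_has_derivative[of f]]]) auto

lemma dfun_chart:
  fixes f :: "'m \<Rightarrow> 'b::real_normed_vector"
  assumes c: "c \<in> A" "p \<in> fst c" and f: "fun_smooth_at A f p"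
  shows "dfun A f p v = fderiv (\<lambda>x. f (inv_chart c x)) (snd c p) (dfun A (snd c) p v)"
proof -
  have "dfun A f p v = dfun A (\<lambda>q. f (inv_chart c (snd c q))) p v"
    by (rule fun_cong[OF dfun_cong]) (use eventually_dom[OF c] c in \<open>auto elim!: eventually_mono\<close>)
  also have "\<dots> = fderiv (\<lambda>x. f (inv_chart c x)) (snd c p) (dfun A (snd c) p v)"
    by (rule dfun_compose[OF _ fun_smooth_at_chart_map[OF c]]) (use f fun_smooth_at_chart[OF c]
      in blast)
  finally show ?thesis .
qed

text \<open>Tangent vectors at \<open>p\<close> are identified with their components in the chart distinguished at
  \<open>p\<close>.\<close>

lemma dfun_chart_at [simp]: "dfun A (snd (chart_at A p)) p v = v"
proof -
  have "eventually (\<lambda>x. snd (chart_at A p) (inv_chart (chart_at A p) x) = x)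
      (nhds (snd (chart_at A p) p))"
    using eventually_range[OF chart_at] by (rule eventually_mono)
      (rule snd_inv_chart[OF chart_at(1)])
  from has_derivative_eventually_cong[OF this]
  have "((\<lambda>x. snd (chart_at A p) (inv_chart (chart_at A p) x)) has_derivative (\<lambda>x. x))
      (at (snd (chart_at A p) p))"
    by simp
  from dfun_eqI[OF this] show ?thesis by simp
qed

lemma coord_vec_linear: "c \<in> A \<Longrightarrow> p \<in> fst c \<Longrightarrow> linear (coord_vec A c p)"
  using smooth_at_linear[OF transition_smooth_at[of c "chart_at A p" p]] chart_at
  by (simp add: coord_vec_def[abs_def])

lemma coord_vec_dfun:
  assumes c: "c \<in> A" "p \<in> fst c" shows "coord_vec A c p (dfun A (snd c) p v) = v"
  using dfun_chart[OF c fun_smooth_at_chart_map[OF chart_at], of v] by (simp add: coord_vec_def)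

lemma dfun_coord_vec:
  assumes c: "c \<in> A" "p \<in> fst c" shows "dfun A (snd c) p (coord_vec A c p v) = v"
proof -
  have l: "linear (dfun A (snd c) p)" "linear (coord_vec A c p)"
    by (intro dfun_linear fun_smooth_at_chart_map coord_vec_linear c)+
  have "inj (dfun A (snd c) p)" using coord_vec_dfun[OF c] by (metis injI)
  then have "surj (dfun A (snd c) p)" using l(1) linear_injective_imp_surjective by auto
  then obtain w where "v = dfun A (snd c) p w" by (metis surjD)
  then show ?thesis using coord_vec_dfun[OF c] by simp
qed

subsection \<open>Germs of smooth vector fields\<close>

text \<open>One chart suffices, since the components in another chart arise by the derivative of the
  transition map.\<close>

lemma field_smooth_atI:
  assumes c: "c \<in> A" "p \<in> fst c" and X: "fun_smooth_at A (\<lambda>q. dfun A (snd c) q (X q)) p"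
  shows "field_smooth_at A X p"
  unfolding field_smooth_at_def
proof (intro ballI impI)
  fix d assume d: "d \<in> A" "p \<in> fst d"
  let ?L = "\<lambda>q. fderiv (\<lambda>x. snd d (inv_chart c x)) (snd c q)"
  have sm: "smooth_at (\<lambda>x. snd d (inv_chart c x)) (snd c p)"
    using c d by (intro transition_smooth_at)
  show "fun_smooth_at A (\<lambda>q. dfun A (snd d) q (X q)) p"
  proof (rule fun_smooth_at_transform)
    show "fun_smooth_at A (\<lambda>q. ?L q (dfun A (snd c) q (X q))) p"
    proof (rule fun_smooth_at_apply_linear[OF _ _ X])
      have "eventually (\<lambda>q. smooth_at (\<lambda>x. snd d (inv_chart c x)) (snd c q)) (nhds p)"
        using smooth_at_eventually[OF sm] chart_tendsto[OF c] by (rule eventually_compose_filterlim)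
      then show "eventually (\<lambda>q. linear (?L q)) (nhds p)"
        by (rule eventually_mono) (rule smooth_at_linear)
      show "fun_smooth_at A (\<lambda>q. ?L q b) p" for b
        by (rule fun_smooth_at_comp_chart[OF c smooth_at_derivative[OF sm]])
    qed
    show "eventually (\<lambda>q. dfun A (snd d) q (X q) = ?L q (dfun A (snd c) q (X q))) (nhds p)"
      using eventually_dom[OF c] eventually_dom[OF d]
      by eventually_elim (intro dfun_chart fun_smooth_at_chart_map c d)
  qed
qed

lemma field_smooth_at_chart:
  "c \<in> A \<Longrightarrow> p \<in> fst c \<Longrightarrow> field_smooth_at A X p \<longleftrightarrow> fun_smooth_at A (\<lambda>q. dfun A (snd c) q (X q)) p"
  by (rule iffI) (simp add: field_smooth_at_def, rule field_smooth_atI)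

lemma smooth_field_on_iff:
  assumes "open W" shows "smooth_field_on A W X \<longleftrightarrow> (\<forall>p\<in>W. field_smooth_at A X p)"
proof -
  have "smooth_field_on A W X \<longleftrightarrow>
     (\<forall>c\<in>A. \<forall>p\<in>fst c \<inter> W. smooth_at (\<lambda>x. dfun A (snd c) (inv_chart c x) (X (inv_chart c x)))
       (snd c p))"
    unfolding smooth_field_on_def using assms
      by (simp add: smooth_on_iff_smooth_at open_chart_image)
  also have "\<dots> \<longleftrightarrow> (\<forall>c\<in>A. \<forall>p\<in>fst c \<inter> W. fun_smooth_at A (\<lambda>q. dfun A (snd c) q (X q)) p)"
    by (auto simp: fun_smooth_at_chart)
  finally show ?thesis by (auto simp: field_smooth_at_def)
qed

lemma smooth_field_iff: "smooth_field A X \<longleftrightarrow> (\<forall>p. field_smooth_at A X p)"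
  using smooth_field_on_iff[of UNIV X] by simp

lemma field_smooth_at_cong:
  assumes "eventually (\<lambda>q. X q = Y q) (nhds p)"
  shows "field_smooth_at A X p \<longleftrightarrow> field_smooth_at A Y p"
proof -
  have "eventually (\<lambda>q. dfun A (snd c) q (X q) = dfun A (snd c) q (Y q)) (nhds p)" for c ::
    "('m, 'e) chart"
    using assms by (rule eventually_mono) simp
  from fun_smooth_at_cong[OF this] show ?thesis by (simp add: field_smooth_at_def)
qed

lemma field_smooth_at_transform:
  "field_smooth_at A X p \<Longrightarrow> eventually (\<lambda>q. Y q = X q) (nhds p) \<Longrightarrow> field_smooth_at A Y p"
  by (subst field_smooth_at_cong)

lemma field_smooth_at_eventually:
  assumes "field_smooth_at A X p" shows "eventually (field_smooth_at A X) (nhds p)"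
proof -
  have "eventually (fun_smooth_at A (\<lambda>q. dfun A (snd (chart_at A p)) q (X q))) (nhds p)"
    using assms field_smooth_at_chart[OF chart_at] by (intro fun_smooth_at_eventually) blast
  with eventually_dom[OF chart_at] show ?thesis
    by eventually_elim (use chart_at in \<open>auto intro: field_smooth_atI\<close>)
qed

lemma field_smooth_at_coord_vec:
  assumes c: "c \<in> A" "p \<in> fst c" and "fun_smooth_at A Y p"
  shows "field_smooth_at A (\<lambda>q. coord_vec A c q (Y q)) p"
proof (rule field_smooth_atI[OF c], rule fun_smooth_at_transform[OF assms(3)])
  show "eventually (\<lambda>q. dfun A (snd c) q (coord_vec A c q (Y q)) = Y q) (nhds p)"
    using eventually_dom[OF c] by (rule eventually_mono) (rule dfun_coord_vec[OF c(1)])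
qed

lemma dfun_chart_map_linear: "c \<in> A \<Longrightarrow> q \<in> fst c \<Longrightarrow> linear (dfun A (snd c) q)"
  by (intro dfun_linear fun_smooth_at_chart_map)

lemma field_smooth_at_0 [simp]: "field_smooth_at A (\<lambda>q. 0) p"
proof (rule field_smooth_atI[OF chart_at],
  rule fun_smooth_at_transform[OF fun_smooth_at_const[of 0]])
  show "eventually (\<lambda>q. dfun A (snd (chart_at A p)) q 0 = 0) (nhds p)"
    using eventually_dom[OF chart_at]
    by (rule eventually_mono) (intro linear_0 dfun_chart_map_linear chart_at)
qed

lemma field_smooth_at_add:
  assumes "field_smooth_at A X p" "field_smooth_at A Y p"
  shows "field_smooth_at A (\<lambda>q. X q + Y q) p"
proof (rule field_smooth_atI[OF chart_at], rule fun_smooth_at_transform)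
  let ?c = "chart_at A p"
  show "fun_smooth_at A (\<lambda>q. dfun A (snd ?c) q (X q) + dfun A (snd ?c) q (Y q)) p"
    using assms by (intro fun_smooth_at_add)
      (simp_all add: field_smooth_at_chart[OF chart_at[of p]])
  show "eventually (\<lambda>q. dfun A (snd ?c) q (X q + Y q) = dfun A (snd ?c) q (X q) +
      dfun A (snd ?c) q (Y q)) (nhds p)"
    using eventually_dom[OF chart_at]
    by (rule eventually_mono) (intro linear_add dfun_chart_map_linear chart_at)
qed

lemma field_smooth_at_scaleR:
  assumes "fun_smooth_at A r p" "field_smooth_at A Y p"
  shows "field_smooth_at A (\<lambda>q. r q *\<^sub>R Y q) p"
proof (rule field_smooth_atI[OF chart_at], rule fun_smooth_at_transform)
  let ?c = "chart_at A p"
  show "fun_smooth_at A (\<lambda>q. r q *\<^sub>R dfun A (snd ?c) q (Y q)) p"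
    using assms by (intro fun_smooth_at_scaleR)
      (simp_all add: field_smooth_at_chart[OF chart_at[of p]])
  show "eventually (\<lambda>q. dfun A (snd ?c) q (r q *\<^sub>R Y q) = r q *\<^sub>R dfun A (snd ?c) q (Y q)) (nhds p)"
    using eventually_dom[OF chart_at]
    by (rule eventually_mono) (intro linear_cmul dfun_chart_map_linear chart_at)
qed

lemma field_smooth_at_minus: "field_smooth_at A X p \<Longrightarrow> field_smooth_at A (\<lambda>q. - X q) p"
  using field_smooth_at_scaleR[of "\<lambda>_. -1" p X] by simp

lemma field_smooth_at_diff:
  "field_smooth_at A X p \<Longrightarrow> field_smooth_at A Y p \<Longrightarrow> field_smooth_at A (\<lambda>q. X q - Y q) p"
  using field_smooth_at_add[of X p "\<lambda>q. - Y q"] field_smooth_at_minus by simp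

lemma field_smooth_at_sum:
  "(\<And>i. i \<in> I \<Longrightarrow> field_smooth_at A (X i) p) \<Longrightarrow> field_smooth_at A (\<lambda>q. \<Sum>i\<in>I. X i q) p"
  by (induction I rule: infinite_finite_induct) (auto intro: field_smooth_at_add)

lemma fun_smooth_at_dfun:
  assumes f: "fun_smooth_at A f p" and X: "field_smooth_at A X p"
  shows "fun_smooth_at A (\<lambda>q. dfun A f q (X q)) p"
proof -
  define c where "c = chart_at A p"
  have c: "c \<in> A" "p \<in> fst c" unfolding c_def using chart_at by auto
  let ?L = "\<lambda>q. fderiv (\<lambda>x. f (inv_chart c x)) (snd c q)"
  have sm: "smooth_at (\<lambda>x. f (inv_chart c x)) (snd c p)" using f
    by (simp add: fun_smooth_at_chart[OF c])
  show ?thesis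
  proof (rule fun_smooth_at_transform)
    show "fun_smooth_at A (\<lambda>q. ?L q (dfun A (snd c) q (X q))) p"
    proof (rule fun_smooth_at_apply_linear)
      have "eventually (\<lambda>q. smooth_at (\<lambda>x. f (inv_chart c x)) (snd c q)) (nhds p)"
        using smooth_at_eventually[OF sm] chart_tendsto[OF c] by (rule eventually_compose_filterlim)
      then show "eventually (\<lambda>q. linear (?L q)) (nhds p)"
        by (rule eventually_mono) (rule smooth_at_linear)
      show "fun_smooth_at A (\<lambda>q. ?L q b) p" for b
        by (rule fun_smooth_at_comp_chart[OF c smooth_at_derivative[OF sm]])
      show "fun_smooth_at A (\<lambda>q. dfun A (snd c) q (X q)) p"
        using X c by (simp add: field_smooth_at_chart)
    qed
    show "eventually (\<lambda>q. dfun A f q (X q) = ?L q (dfun A (snd c) q (X q))) (nhds p)"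
      using eventually_dom[OF c] fun_smooth_at_eventually[OF f]
      by eventually_elim (intro dfun_chart c)
  qed
qed

subsection \<open>The Lie bracket as a commutator\<close>

text \<open>The bracket is defined at each point in the chart distinguished there. This identity frees
  it from that choice: \<open>f\<close> may be the coordinate map of any chart, or the submersion in
  coordinates. In the difference of the two second derivatives of \<open>f\<close> the symmetric Hessian
  cancels.\<close>

lemma dfun_lie_bracket:
  fixes f :: "'m \<Rightarrow> 'b::euclidean_space"
  assumes f: "fun_smooth_at A f p" and X: "field_smooth_at A X p" and Y: "field_smooth_at A Y p"
  shows "dfun A f p (lie_bracket A X Y p) =
    dfun A (\<lambda>q. dfun A f q (Y q)) p (X p) - dfun A (\<lambda>q. dfun A f q (X q)) p (Y p)"
proof -
  define c where "c = chart_at A p"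
  have c: "c \<in> A" "p \<in> fst c" unfolding c_def using chart_at by auto
  define \<phi> where "\<phi> = (\<lambda>x. f (inv_chart c x))"
  define co where "co Z x = dfun A (snd c) (inv_chart c x) (Z (inv_chart c x))" for Z x
  let ?x = "snd c p"
  have smf: "smooth_at \<phi> ?x" using f by (simp add: fun_smooth_at_chart[OF c] \<phi>_def)
  have smZ: "smooth_at (co Z) ?x" if "field_smooth_at A Z p" for Z
    using that by (simp add: field_smooth_at_chart[OF c] fun_smooth_at_chart[OF c] co_def[abs_def])
  have coZ: "co Z ?x = Z p" for Z using c by (simp add: co_def) (simp add: c_def)
  have rep: "eventually (\<lambda>x. dfun A f (inv_chart c x) (Z (inv_chart c x)) = fderiv \<phi> x (co Z x))
      (nhds ?x)" for Z
  proof -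
    have "eventually (\<lambda>q. fun_smooth_at A f q) (nhds p)" by (rule fun_smooth_at_eventually[OF f])
    then have "eventually (\<lambda>x. fun_smooth_at A f (inv_chart c x)) (nhds ?x)"
      by (simp add: eventually_inv_chart[OF c])
    with eventually_range[OF c] show ?thesis
    proof eventually_elim
      case (elim x)
      then have *: "inv_chart c x \<in> fst c" using c by (intro inv_chart_dom)
      from dfun_chart[OF c(1) * elim(2), of "Z (inv_chart c x)"] show ?case
        using snd_inv_chart[OF c(1) elim(1)] by (simp add: \<phi>_def co_def)
    qed
  qed
  have D: "dfun A (\<lambda>q. dfun A f q (Z q)) p u =
     fderiv (\<lambda>y. fderiv \<phi> y (Z p)) ?x u +
     fderiv \<phi> ?x (fderiv (co Z) ?x u)"
    if "field_smooth_at A Z p" for Z u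
  proof -
    have "dfun A (\<lambda>q. dfun A f q (Z q)) p u = fderiv (\<lambda>x. fderiv \<phi> x (co Z x)) ?x u"
      using frechet_derivative_eventually_cong[OF rep[of Z]] by (simp add: dfun_def c_def)
    then show ?thesis using frechet_derivative_apply[OF smf smZ[OF that], of u] coZ by simp
  qed
  have lb: "lie_bracket A X Y p = fderiv (co Y) ?x (X p) - fderiv (co X) ?x (Y p)"
    unfolding lie_bracket_def Let_def dfun_def[of A _ p] co_def[abs_def] c_def by simp
  have "dfun A f p v = fderiv \<phi> ?x v" for v by (simp add: dfun_def \<phi>_def c_def)
  then show ?thesis
    unfolding D[OF X] D[OF Y] lb second_derivative_symmetric[OF smf, of "Y p" "X p"]
    by (simp add: linear_diff[OF smooth_at_linear[OF smf]])
qed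

subsection \<open>Bump functions and extension of local data\<close>

text \<open>A bump function in a chart extends by zero to the whole manifold because the preimage of
  the closed ball outside which it vanishes is compact, hence closed: this is where the Hausdorff
  property enters.\<close>

lemma manifold_bump:
  assumes "open W" "p \<in> W"
  obtains \<beta> :: "'m \<Rightarrow> real" where "\<And>q. fun_smooth_at A \<beta> q" "eventually (\<lambda>q. \<beta> q = 1) (nhds p)"
    "\<And>q. q \<notin> W \<Longrightarrow> eventually (\<lambda>q. \<beta> q = 0) (nhds q)"
proof -
  define c where "c = chart_at A p"
  have c: "c \<in> A" "p \<in> fst c" unfolding c_def using chart_at by auto
  have "open (snd c ` (fst c \<inter> W))" "snd c p \<in> snd c ` (fst c \<inter> W)"
    using c assms open_chart_image by auto
  then obtain e where e: "e > 0" "ball (snd c p) e \<subseteq> snd c ` (fst c \<inter> W)"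
    using open_contains_ball by blast
  define r where "r = e / 3"
  have r: "r > 0" using e by (simp add: r_def)
  obtain b :: "'e \<Rightarrow> real" where b: "\<And>x. smooth_at b x" "\<And>x. dist (snd c p) x \<le> r \<Longrightarrow> b x = 1"
    "\<And>x. dist (snd c p) x \<ge> 2 * r \<Longrightarrow> b x = 0"
    using bump_function[OF r, of "snd c p"] by blast
  define \<beta> where "\<beta> q = (if q \<in> fst c then b (snd c q) else 0)" for q
  \<comment> \<open>The bump function vanishes off this compact set.\<close>
  define K where "K = inv_chart c ` cball (snd c p) (2 * r)"
  have sub: "cball (snd c p) (2 * r) \<subseteq> snd c ` (fst c \<inter> W)"
    using e by (auto simp: r_def)
  then have "compact K" unfolding K_def
    using chart_homeomorphism[OF c(1)]
    by (intro compact_continuous_image) (auto simp: homeomorphism_def intro: continuous_on_subset)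
  then have K: "open (- K)" by (simp add: compact_imp_closed open_Compl)
  have KW: "K \<subseteq> fst c \<inter> W"
  proof
    fix q assume "q \<in> K"
    then obtain x where x: "q = inv_chart c x" "x \<in> cball (snd c p) (2 * r)" by (auto simp: K_def)
    with sub obtain q' where "x = snd c q'" "q' \<in> fst c \<inter> W" by blast
    then show "q \<in> fst c \<inter> W" using x c by auto
  qed
  have zero: "\<beta> q = 0" if "q \<notin> K" for q
  proof (cases "q \<in> fst c")
    case True
    have "snd c q \<notin> cball (snd c p) (2 * r)"
      using that True c unfolding K_def by (metis imageI inv_chart_snd)
    then show ?thesis using True b(3) by (simp add: \<beta>_def)
  qed (simp add: \<beta>_def)
  have ev0: "eventually (\<lambda>q. \<beta> q = 0) (nhds q)" if "q \<notin> K" for q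
    using K that zero unfolding eventually_nhds by (intro exI[of _ "- K"]) auto
  show ?thesis
  proof (rule that)
    fix q
    show "fun_smooth_at A \<beta> q"
    proof (cases "q \<in> K")
      case True
      then have q: "q \<in> fst c" using KW by auto
      show ?thesis
        by (rule fun_smooth_at_transform[OF fun_smooth_at_comp_chart[OF c(1) q b(1)]])
           (use eventually_dom[OF c(1) q] in \<open>auto elim!: eventually_mono simp: \<beta>_def\<close>)
    next
      case False
      from fun_smooth_at_cong[OF ev0[OF this]] show ?thesis by simp
    qed
    show "eventually (\<lambda>q. \<beta> q = 0) (nhds q)" if "q \<notin> W"
      using that KW by (intro ev0) auto
  next
    have "eventually (\<lambda>x. x \<in> ball (snd c p) r) (nhds (snd c p))"
      using r by (intro eventually_nhds_in_open) auto
    then have "eventually (\<lambda>q. snd c q \<in> ball (snd c p) r) (nhds p)"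
      using chart_tendsto[OF c] by (rule eventually_compose_filterlim)
    with eventually_dom[OF c] show "eventually (\<lambda>q. \<beta> q = 1) (nhds p)"
      by eventually_elim (simp add: \<beta>_def b(2))
  qed
qed

lemma bump_field:
  assumes "\<And>q. fun_smooth_at A \<beta> q" "\<And>q. q \<notin> W \<Longrightarrow> eventually (\<lambda>q. \<beta> q = 0) (nhds q)"
    "\<And>q. q \<in> W \<Longrightarrow> field_smooth_at A X q"
  shows "smooth_field A (\<lambda>q. \<beta> q *\<^sub>R X q)"
  unfolding smooth_field_iff
proof
  fix q show "field_smooth_at A (\<lambda>q. \<beta> q *\<^sub>R X q) q"
  proof (cases "q \<in> W")
    case True then show ?thesis using assms by (intro field_smooth_at_scaleR)
  next
    case False
    show ?thesis
      by (rule field_smooth_at_transform[OF field_smooth_at_0])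
         (use assms(2)[OF False] in \<open>auto elim!: eventually_mono\<close>)
  qed
qed

lemma bump_fun:
  assumes "\<And>q. fun_smooth_at A \<beta> q" "\<And>q. q \<notin> W \<Longrightarrow> eventually (\<lambda>q. \<beta> q = 0) (nhds q)"
    "\<And>q. q \<in> W \<Longrightarrow> fun_smooth_at A f q"
  shows "smooth_fun A (\<lambda>q. \<beta> q *\<^sub>R f q)"
  unfolding smooth_fun_iff
proof
  fix q show "fun_smooth_at A (\<lambda>q. \<beta> q *\<^sub>R f q) q"
  proof (cases "q \<in> W")
    case True then show ?thesis using assms by (intro fun_smooth_at_scaleR)
  next
    case False
    show ?thesis
      by (rule fun_smooth_at_transform[OF fun_smooth_at_const[of 0]])
         (use assms(2)[OF False] in \<open>auto elim!: eventually_mono\<close>)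
  qed
qed

text \<open>The extension is a multiple of the given field at each point, so that it remains in every
  distribution that contains the given field.\<close>

lemma extend_field:
  assumes "field_smooth_at A X p"
  obtains \<beta> where "smooth_field A (\<lambda>q. \<beta> q *\<^sub>R X q)" "eventually (\<lambda>q. \<beta> q = 1) (nhds p)"
proof -
  obtain W where W: "open W" "p \<in> W" "\<And>q. q \<in> W \<Longrightarrow> field_smooth_at A X q"
    using field_smooth_at_eventually[OF assms] unfolding eventually_nhds by blast
  obtain \<beta> :: "'m \<Rightarrow> real" where "\<And>q. fun_smooth_at A \<beta> q" "eventually (\<lambda>q. \<beta> q = 1) (nhds p)"
    "\<And>q. q \<notin> W \<Longrightarrow> eventually (\<lambda>q. \<beta> q = 0) (nhds q)"
    using manifold_bump[OF W(1,2)] by blast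
  with bump_field[of \<beta> W X] W show ?thesis using that by blast
qed

end

section \<open>Riemannian metrics\<close>

lemma component_eqI:
  assumes "subspace D" "subspace E" "\<And>x. x \<in> D \<Longrightarrow> x \<in> E \<Longrightarrow> x = 0" "d \<in> D" "v - d \<in> E"
  shows "component D E v = d"
  unfolding component_def
proof (rule the_equality)
  fix d' assume d': "d' \<in> D \<and> v - d' \<in> E"
  have "d' - d \<in> D" using assms d' subspace_diff by blast
  moreover have "(v - d) - (v - d') \<in> E" using assms d' subspace_diff by blast
  ultimately have "d' - d = 0" by (intro assms(3)) simp_all
  then show "d' = d" by simp
qed (use assms in simp)

context manifold
begin

lemma fun_smooth_at_bilinear:
  fixes X :: "'m \<Rightarrow> 'a::euclidean_space" and Y :: "'m \<Rightarrow> 'b::euclidean_space"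
  assumes bil: "eventually (\<lambda>q. bilinear (L q)) (nhds p)"
    and sm: "\<And>a b. fun_smooth_at A (\<lambda>q. L q a b) p"
    and XY: "fun_smooth_at A X p" "fun_smooth_at A Y p"
  shows "fun_smooth_at A (\<lambda>q. L q (X q) (Y q)) p"
proof (rule fun_smooth_at_apply_linear[OF _ _ XY(2)])
  show "eventually (\<lambda>q. linear (L q (X q))) (nhds p)"
    using bil by (rule eventually_mono) (simp add: bilinear_def)
  show "fun_smooth_at A (\<lambda>q. L q (X q) b) p" for b
    by (rule fun_smooth_at_apply_linear[OF _ sm XY(1)])
       (use bil in \<open>auto elim!: eventually_mono simp: bilinear_def\<close>)
qed

lemma fun_smooth_atI_smooth_on:
  assumes "c \<in> A" "p \<in> fst c" "smooth_on (\<lambda>x. f (inv_chart c x)) (snd c ` fst c)"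
  shows "fun_smooth_at A f p"
  unfolding fun_smooth_at_chart[OF assms(1,2)]
  by (rule smooth_on_imp_smooth_at[OF assms(3) open_range]) (use assms in auto)

lemma smooth_distribution_UNIV: "smooth_distribution A (\<lambda>p. UNIV)"
  unfolding smooth_distribution_def
proof (intro conjI allI)
  show "\<exists>k. \<forall>p::'m. dim (UNIV :: 'e set) = k" by simp
next
  fix p
  define c where "c = chart_at A p"
  have c: "c \<in> A" "p \<in> fst c" unfolding c_def using chart_at by auto
  let ?X = "(\<lambda>b q. coord_vec A c q b) ` Basis"
  have "UNIV = span ((\<lambda>X. X q) ` ?X)" if q: "q \<in> fst c" for q
  proof -
    have "surj (coord_vec A c q)" by (metis coord_vec_dfun[OF c(1) q] surjI)
    then have "UNIV = coord_vec A c q ` span Basis" by simp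
    also have "\<dots> = span (coord_vec A c q ` Basis)"
      using linear_span_image[OF coord_vec_linear[OF c(1) q]] by simp
    finally show ?thesis by (simp add: image_image)
  qed
  moreover have "\<forall>X\<in>?X. smooth_field_on A (fst c) X"
    using c open_dom[OF c(1)] by (auto simp: smooth_field_on_iff intro!: field_smooth_at_coord_vec)
  ultimately show "\<exists>W \<X>. open W \<and> p \<in> W \<and> finite \<X> \<and> (\<forall>X\<in>\<X>. smooth_field_on A W X) \<and>
      (\<forall>q\<in>W. UNIV = span ((\<lambda>X. X q) ` \<X>))"
    using c open_dom[OF c(1)] by (intro exI[of _ "fst c"] exI[of _ ?X]) auto
qed auto

end

locale riemannian =
  fixes A :: "('m::{t2_space, second_countable_topology}, 'e::euclidean_space) atlas"
    and g :: "'m \<Rightarrow> 'e \<Rightarrow> 'e \<Rightarrow> real"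
  assumes riemannian: "riemannian_manifold A g"
begin

sublocale manifold A
  by unfold_locales (use riemannian in \<open>simp add: riemannian_manifold_def\<close>)

lemma g_bilinear: "bilinear (g p)"
  and g_sym: "g p u v = g p v u"
  and g_pos: "v \<noteq> 0 \<Longrightarrow> g p v v > 0"
  using riemannian unfolding riemannian_manifold_def by blast+

lemmas g_add_left = bilinear_ladd[OF g_bilinear]
lemmas g_add_right = bilinear_radd[OF g_bilinear]
lemmas g_diff_left = bilinear_lsub[OF g_bilinear]
lemmas g_diff_right = bilinear_rsub[OF g_bilinear]
lemmas g_minus_left = bilinear_lneg[OF g_bilinear]
lemmas g_minus_right = bilinear_rneg[OF g_bilinear]
lemmas g_0_left = bilinear_lzero[OF g_bilinear]
lemmas g_0_right = bilinear_rzero[OF g_bilinear]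

lemma g_scaleR_left: "g p (r *\<^sub>R u) v = r * g p u v"
  using bilinear_lmul[OF g_bilinear] by simp

lemma g_scaleR_right: "g p u (r *\<^sub>R v) = r * g p u v"
  using bilinear_rmul[OF g_bilinear] by simp

lemma g_linear_right: "linear (g p u)"
  using g_bilinear by (simp add: bilinear_def)

lemma g_linear_left: "linear (\<lambda>u. g p u v)"
  using g_bilinear by (simp add: bilinear_def)

lemma g_sum_left: "g p (\<Sum>i\<in>I. f i) v = (\<Sum>i\<in>I. g p (f i) v)"
  by (rule linear_sum[OF g_linear_left])

lemmas g_simps = g_add_left g_add_right g_diff_left g_diff_right g_minus_left g_minus_right
  g_0_left g_0_right g_scaleR_left g_scaleR_right

lemma g_eq_0_iff: "g p v v = 0 \<longleftrightarrow> v = 0"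
  using g_pos[of v p] g_0_left by force

lemma g_nondegenerate: "(\<And>w. g p v w = 0) \<Longrightarrow> v = 0"
  using g_eq_0_iff by blast

lemma subspace_orth_in: "subspace E \<Longrightarrow> subspace (orth_in (g p) E D)"
  unfolding subspace_def orth_in_def by (auto simp: g_simps)

lemma orth_in_disjoint: "x \<in> D \<Longrightarrow> x \<in> orth_in (g p) E D \<Longrightarrow> x = 0"
  using g_eq_0_iff by (auto simp: orth_in_def)

lemma fun_smooth_at_metric:
  assumes "field_smooth_at A X p" "field_smooth_at A Y p"
  shows "fun_smooth_at A (\<lambda>q. g q (X q) (Y q)) p"
proof -
  define c where "c = chart_at A p"
  have c: "c \<in> A" "p \<in> fst c" unfolding c_def using chart_at by auto
  define L where "L q a b = g q (coord_vec A c q a) (coord_vec A c q b)" for q a b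
  have "fun_smooth_at A (\<lambda>q. L q (dfun A (snd c) q (X q)) (dfun A (snd c) q (Y q))) p"
  proof (rule fun_smooth_at_bilinear[where L = L])
    show "eventually (\<lambda>q. bilinear (L q)) (nhds p)"
      using eventually_dom[OF c]
    proof (rule eventually_mono)
      fix q assume "q \<in> fst c"
      note l = coord_vec_linear[OF c(1) this]
      show "bilinear (L q)" unfolding bilinear_def L_def
        by (auto intro!: linearI simp: linear_add[OF l] linear_cmul[OF l] g_simps)
    qed
    show "fun_smooth_at A (\<lambda>q. L q a b) p" for a b
    proof (rule fun_smooth_atI_smooth_on[OF c])
      show "smooth_on (\<lambda>x. L (inv_chart c x) a b) (snd c ` fst c)"
        using riemannian c unfolding riemannian_manifold_def L_def Let_def by blast
    qed
  qed (use assms field_smooth_at_chart[OF c] in auto)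
  then show ?thesis
  proof (rule fun_smooth_at_transform)
    show "eventually (\<lambda>q. g q (X q) (Y q) = L q (dfun A (snd c) q (X q)) (dfun A (snd c) q (Y q)))
        (nhds p)"
      using eventually_dom[OF c] by (rule eventually_mono) (simp add: L_def coord_vec_dfun[OF c(1)])
  qed
qed

subsection \<open>Orthogonal frames\<close>

definition orth_family :: "'m \<Rightarrow> ('m \<Rightarrow> 'e) set \<Rightarrow> bool" where
  "orth_family q U \<longleftrightarrow> finite U \<and> (\<forall>u\<in>U. u q \<noteq> 0) \<and> (\<forall>u\<in>U. \<forall>w\<in>U. u \<noteq> w \<longrightarrow> g q (u q) (w q) = 0)"

text \<open>The vector that represents the linear form \<open>l\<close> on the span of an orthogonal family. The
  choice \<open>l = g v\<close> gives the orthogonal projection of \<open>v\<close>.\<close>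

definition fourier :: "'m \<Rightarrow> ('m \<Rightarrow> 'e) set \<Rightarrow> ('e \<Rightarrow> real) \<Rightarrow> 'e" where
  "fourier q U l = (\<Sum>u\<in>U. (l (u q) * inverse (g q (u q) (u q))) *\<^sub>R u q)"

lemma fourier_in_span: "fourier q U l \<in> span ((\<lambda>u. u q) ` U)"
  unfolding fourier_def by (intro span_sum span_scale span_base) auto

lemma fourier_inner:
  assumes "orth_family q U" "w \<in> U" shows "g q (fourier q U l) (w q) = l (w q)"
proof -
  have "g q (fourier q U l) (w q) = (\<Sum>u\<in>U. if u = w then l (w q) else 0)"
    unfolding fourier_def g_sum_left
    using assms g_pos[of "w q" q] by (intro sum.cong) (auto simp: orth_family_def g_scaleR_left)
  also have "\<dots> = l (w q)" using assms by (simp add: orth_family_def)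
  finally show ?thesis .
qed

lemma fourier_inner_span:
  assumes U: "orth_family q U" and l: "linear l" and w: "w \<in> span ((\<lambda>u. u q) ` U)"
  shows "g q (fourier q U l) w = l w"
proof (rule linear_eq_on_span[OF g_linear_right l _ w])
  show "g q (fourier q U l) x = l x" if "x \<in> (\<lambda>u. u q) ` U" for x
    using that fourier_inner[OF U] by auto
qed

lemma orth_family_card_dim:
  assumes U: "orth_family q U" shows "dim (span ((\<lambda>u. u q) ` U)) = card U"
proof -
  have inj: "inj_on (\<lambda>u. u q) U"
    using U g_eq_0_iff unfolding inj_on_def orth_family_def by metis
  have "independent ((\<lambda>u. u q) ` U)"
  proof (rule independent_if_scalars_zero)
    show "finite ((\<lambda>u. u q) ` U)" using U by (simp add: orth_family_def)
    fix f x assume s: "(\<Sum>x\<in>(\<lambda>u. u q) ` U. f x *\<^sub>R x) = 0" and x: "x \<in> (\<lambda>u. u q) ` U"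
    then obtain w where w: "w \<in> U" "x = w q" by auto
    have "(\<Sum>u\<in>U. f (u q) *\<^sub>R u q) = 0" using s by (simp add: sum.reindex[OF inj])
    then have "0 = g q (\<Sum>u\<in>U. f (u q) *\<^sub>R u q) (w q)" by (simp add: g_0_left)
    also have "\<dots> = (\<Sum>u\<in>U. if u = w then f x * g q x x else 0)"
      unfolding g_sum_left using U w by (intro sum.cong) (auto simp: orth_family_def g_scaleR_left)
    also have "\<dots> = f x * g q x x" using U w by (simp add: orth_family_def)
    finally show "f x = 0" using U w g_eq_0_iff by (auto simp: orth_family_def)
  qed
  then show ?thesis by (simp add: dim_eq_card_independent card_image[OF inj])
qed

lemma field_smooth_at_fourier:
  assumes "finite U" "\<And>u. u \<in> U \<Longrightarrow> field_smooth_at A u p \<and> u p \<noteq> 0"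
    "\<And>u. u \<in> U \<Longrightarrow> fun_smooth_at A (\<lambda>q. l q (u q)) p"
  shows "field_smooth_at A (\<lambda>q. fourier q U (l q)) p"
  unfolding fourier_def
  using assms g_eq_0_iff
  by (intro field_smooth_at_sum field_smooth_at_scaleR fun_smooth_at_mult fun_smooth_at_inverse
      fun_smooth_at_metric) auto

lemma eventually_nonzero:
  assumes "field_smooth_at A X p" "X p \<noteq> 0" shows "eventually (\<lambda>q. X q \<noteq> 0) (nhds p)"
proof -
  define c where "c = chart_at A p"
  have c: "c \<in> A" "p \<in> fst c" unfolding c_def using chart_at by auto
  let ?f = "\<lambda>x. g (inv_chart c x) (X (inv_chart c x)) (X (inv_chart c x))"
  have "smooth_at ?f (snd c p)"
    using fun_smooth_at_metric[OF assms(1,1)] fun_smooth_at_chart[OF c, of "\<lambda>q. g q (X q) (X q)"]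
      by simp
  then have "(?f \<longlongrightarrow> ?f (snd c p)) (nhds (snd c p))"
    using smooth_at_isCont tendsto_at_iff_tendsto_nhds[of ?f "snd c p"] unfolding isCont_def
      by blast
  moreover have "?f (snd c p) \<noteq> 0" using assms(2) g_eq_0_iff c by simp
  ultimately have "eventually (\<lambda>x. ?f x \<noteq> 0) (nhds (snd c p))" by (rule tendsto_imp_eventually_ne)
  then have "eventually (\<lambda>q. g q (X q) (X q) \<noteq> 0) (nhds p)"
    using eventually_inv_chart[OF c, of "\<lambda>q. g q (X q) (X q) \<noteq> 0"] by simp
  then show ?thesis by (rule eventually_mono) (auto simp: g_0_left)
qed

text \<open>A field whose orthogonal remainder vanishes at \<open>p\<close> is dropped, so the given fields may be
  dependent at \<open>p\<close>. Spans can then only be compared at \<open>p\<close> itself; at other points there is one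
  inclusion.\<close>

lemma gram_schmidt:
  assumes "finite \<X>" "\<forall>X\<in>\<X>. field_smooth_at A X p"
  shows "\<exists>U. (\<forall>u\<in>U. field_smooth_at A u p) \<and> eventually (\<lambda>q. orth_family q U) (nhds p) \<and>
    (\<forall>q. \<forall>u\<in>U. u q \<in> span ((\<lambda>X. X q) ` \<X>)) \<and> span ((\<lambda>X. X p) ` \<X>) \<subseteq> span ((\<lambda>u. u p) ` U)"
  using assms
proof (induction \<X> rule: finite_induct)
  case empty
  show ?case by (intro exI[of _ "{}"]) (auto simp: orth_family_def)
next
  case (insert X \<X>)
  have "\<forall>X\<in>\<X>. field_smooth_at A X p" using insert.prems by simp
  from insert.IH[OF this]
  obtain U where U0: "\<forall>u\<in>U. field_smooth_at A u p" "eventually (\<lambda>q. orth_family q U) (nhds p)"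
    "\<forall>q. \<forall>u\<in>U. u q \<in> span ((\<lambda>X. X q) ` \<X>)" "span ((\<lambda>X. X p) ` \<X>) \<subseteq> span ((\<lambda>u. u p) ` U)"
    by (elim exE conjE) (rule that)
  note U = bspec[OF U0(1)] U0(2) bspec[OF spec[OF U0(3)]] U0(4)
  have Up: "orth_family p U" using U(2) by (rule eventually_nhds_x_imp_x)
  define w where "w q = X q - fourier q U (g q (X q))" for q
  have sX: "field_smooth_at A X p" using insert.prems by simp
  have sw: "field_smooth_at A w p" unfolding w_def
    using Up U(1) sX
    by (intro field_smooth_at_diff field_smooth_at_fourier fun_smooth_at_metric)
      (auto simp: orth_family_def)
  have span_U: "span ((\<lambda>u. u q) ` U) \<subseteq> span ((\<lambda>X. X q) ` \<X>)" for q
    using U(3) by (intro span_minimal) auto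
  have mono: "span ((\<lambda>X. X q) ` \<X>) \<subseteq> span ((\<lambda>X. X q) ` insert X \<X>)" for q
    by (intro span_mono) auto
  have w_span: "w q \<in> span ((\<lambda>X. X q) ` insert X \<X>)" for q
  proof -
    have "X q \<in> span ((\<lambda>X. X q) ` insert X \<X>)" by (intro span_base) simp
    moreover have "fourier q U (g q (X q)) \<in> span ((\<lambda>X. X q) ` insert X \<X>)"
      using subsetD[OF mono subsetD[OF span_U fourier_in_span]] .
    ultimately show ?thesis unfolding w_def by (rule span_diff)
  qed
  have orth: "g q (w q) (u q) = 0" if "orth_family q U" "u \<in> U" for q u
    unfolding w_def g_diff_left using fourier_inner[OF that] by simp
  show ?case
  proof (cases "w p = 0")
    case True
    then have "X p = fourier p U (g p (X p))" by (simp add: w_def)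
    then have "X p \<in> span ((\<lambda>u. u p) ` U)" using fourier_in_span by metis
    moreover have "(\<lambda>X. X p) ` \<X> \<subseteq> span ((\<lambda>u. u p) ` U)"
      by (rule order_trans[OF span_superset U(4)])
    ultimately have "span ((\<lambda>X. X p) ` insert X \<X>) \<subseteq> span ((\<lambda>u. u p) ` U)"
      by (intro span_minimal) auto
    then show ?thesis
      using U0(1,2) subsetD[OF mono U(3)] by (intro exI[of _ U] conjI ballI allI) simp_all
  next
    case False
    show ?thesis
    proof (intro exI[of _ "insert w U"] conjI ballI allI)
      show "field_smooth_at A u p" if "u \<in> insert w U" for u using that U(1) sw by auto
      show "eventually (\<lambda>q. orth_family q (insert w U)) (nhds p)"
        using U(2) eventually_nonzero[OF sw False]
      proof eventually_elim
        case (elim q)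
        have o1: "g q (w q) (u q) = 0" if "u \<in> U" for u using orth[OF elim(1) that] .
        have o2: "g q (u q) (w q) = 0" if "u \<in> U" for u using o1[OF that] g_sym by metis
        from elim o1 o2 show ?case unfolding orth_family_def by simp
      qed
      show "u q \<in> span ((\<lambda>X. X q) ` insert X \<X>)" if "u \<in> insert w U" for u q
        using that subsetD[OF mono U(3)] w_span by (elim insertE) simp_all
      show "span ((\<lambda>X. X p) ` insert X \<X>) \<subseteq> span ((\<lambda>u. u p) ` insert w U)"
      proof (intro span_minimal subspace_span)
        have s: "span ((\<lambda>u. u p) ` U) \<subseteq> span ((\<lambda>u. u p) ` insert w U)" by (intro span_mono) auto
        have "w p \<in> span ((\<lambda>u. u p) ` insert w U)" by (intro span_base) auto
        then have "w p + fourier p U (g p (X p)) \<in> span ((\<lambda>u. u p) ` insert w U)"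
          using s fourier_in_span by (intro span_add) auto
        then have "X p \<in> span ((\<lambda>u. u p) ` insert w U)" by (simp add: w_def)
        then show "(\<lambda>X. X p) ` insert X \<X> \<subseteq> span ((\<lambda>u. u p) ` insert w U)"
          using order_trans[OF order_trans[OF span_superset U(4)] s] by simp
      qed
    qed
  qed
qed

text \<open>The inclusion of spans that Gram-Schmidt yields near \<open>p\<close> is an equality by the constant
  rank of the distribution.\<close>

lemma orthogonal_frame:
  assumes D: "smooth_distribution A D"
  obtains U where "\<And>u. u \<in> U \<Longrightarrow> field_smooth_at A u p"
    "eventually (\<lambda>q. orth_family q U \<and> span ((\<lambda>u. u q) ` U) = D q) (nhds p)"
proof -
  obtain W \<X> where W: "open W" "p \<in> W" "finite \<X>" "\<And>X. X \<in> \<X> \<Longrightarrow> smooth_field_on A W X"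
    "\<And>q. q \<in> W \<Longrightarrow> D q = span ((\<lambda>X. X q) ` \<X>)"
    using D unfolding smooth_distribution_def by meson
  obtain k where k: "\<And>p. dim (D p) = k" using D unfolding smooth_distribution_def by blast
  have "\<forall>X\<in>\<X>. field_smooth_at A X p" using W smooth_field_on_iff by blast
  from gram_schmidt[OF W(3) this] obtain U where U: "\<And>u. u \<in> U \<Longrightarrow> field_smooth_at A u p"
    "eventually (\<lambda>q. orth_family q U) (nhds p)"
    "\<And>q u. u \<in> U \<Longrightarrow> u q \<in> span ((\<lambda>X. X q) ` \<X>)" "span ((\<lambda>X. X p) ` \<X>) \<subseteq> span ((\<lambda>u. u p) ` U)"
    by blast
  have Up: "orth_family p U" using U(2) by (rule eventually_nhds_x_imp_x)
  have sub: "span ((\<lambda>u. u q) ` U) \<subseteq> span ((\<lambda>X. X q) ` \<X>)" for q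
    using U(3) by (intro span_minimal) auto
  have "span ((\<lambda>u. u p) ` U) = D p" using sub[of p] U(4) W by auto
  then have cU: "card U = k" using orth_family_card_dim[OF Up] k by metis
  have "eventually (\<lambda>q. q \<in> W) (nhds p)" using W by (intro eventually_nhds_in_open)
  with U(2) have "eventually (\<lambda>q. orth_family q U \<and> span ((\<lambda>u. u q) ` U) = D q) (nhds p)"
  proof eventually_elim
    case (elim q)
    have "span ((\<lambda>u. u q) ` U) = span ((\<lambda>X. X q) ` \<X>)"
      by (rule subspace_dim_equal[OF subspace_span subspace_span sub])
         (use orth_family_card_dim[OF elim(1)] cU k[of q] W(5)[OF elim(2)] in simp)
    then show ?case using elim W(5) by simp
  qed
  with U(1) show ?thesis using that by blast
qed

lemma orthogonal_frame_at:
  obtains U where "orth_family p U" "span ((\<lambda>u. u p) ` U) = UNIV"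
proof -
  obtain U where "\<And>u. u \<in> U \<Longrightarrow> field_smooth_at A u p"
    and U: "eventually (\<lambda>q. orth_family q U \<and> span ((\<lambda>u. u q) ` U) = UNIV) (nhds p)"
    by (rule orthogonal_frame[OF smooth_distribution_UNIV, where p = p]) (rule that)
  from eventually_nhds_x_imp_x[OF U] show ?thesis by (intro that[of U]) simp_all
qed

lemma riesz:
  assumes "linear l" obtains v where "\<And>w. g p v w = l w"
proof -
  obtain U where U: "orth_family p U" "span ((\<lambda>u. u p) ` U) = UNIV" by (rule orthogonal_frame_at)
  show ?thesis by (rule that[of "fourier p U l"]) (use fourier_inner_span[OF U(1) assms] U(2)
    in auto)
qed

text \<open>The definite description in the definition of the gradient denotes the Riesz
  representative.\<close>

lemma gradient_inner:
  assumes "fun_smooth_at A h p" shows "g p (gradient A g h p) w = dfun A h p w"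
proof -
  obtain v where v: "\<And>w. g p v w = dfun A h p w" using riesz[OF dfun_linear[OF assms]] by metis
  have "gradient A g h p = v" unfolding gradient_def
  proof (rule the_equality)
    fix v' assume "\<forall>w. g p v' w = dfun A h p w"
    then have "g p (v' - v) w = 0" for w using v by (simp add: g_diff_left)
    then have "v' - v = 0" by (rule g_nondegenerate)
    then show "v' = v" by simp
  qed (use v in simp)
  then show ?thesis using v by simp
qed

subsection \<open>Orthogonal projections\<close>

definition proj :: "('m \<Rightarrow> 'e set) \<Rightarrow> 'm \<Rightarrow> 'e \<Rightarrow> 'e" where
  "proj D p = component (D p) (orth_in (g p) UNIV (D p))"

lemma proj_fourier:
  assumes U: "orth_family q U" "span ((\<lambda>u. u q) ` U) = D q"
  shows "proj D q v = fourier q U (g q v)"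
  unfolding proj_def
proof (rule component_eqI)
  show "subspace (D q)" using U(2) subspace_span by metis
  show "subspace (orth_in (g q) UNIV (D q))" by (intro subspace_orth_in) auto
  show "x = 0" if "x \<in> D q" "x \<in> orth_in (g q) UNIV (D q)" for x using that
    by (rule orth_in_disjoint)
  show "fourier q U (g q v) \<in> D q" using fourier_in_span U(2) by auto
  show "v - fourier q U (g q v) \<in> orth_in (g q) UNIV (D q)"
    using fourier_inner_span[OF U(1) g_linear_right] U(2) by (auto simp: orth_in_def g_diff_left)
qed

lemma
  assumes "smooth_distribution A D"
  shows proj_in: "proj D p v \<in> D p"
    and proj_orth: "w \<in> D p \<Longrightarrow> g p (v - proj D p v) w = 0"
proof -
  obtain U where "\<And>u. u \<in> U \<Longrightarrow> field_smooth_at A u p"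
    and U: "eventually (\<lambda>q. orth_family q U \<and> span ((\<lambda>u. u q) ` U) = D q) (nhds p)"
    by (rule orthogonal_frame[OF assms, where p = p]) (rule that)
  from eventually_nhds_x_imp_x[OF U]
  have U: "orth_family p U" "span ((\<lambda>u. u p) ` U) = D p" by simp_all
  show "proj D p v \<in> D p" using proj_fourier[of p U D] U fourier_in_span by metis
  show "g p (v - proj D p v) w = 0" if "w \<in> D p"
    using fourier_inner_span[OF U(1) g_linear_right] U that
    by (simp add: proj_fourier[of p U D] g_diff_left)
qed

lemma field_smooth_at_proj:
  assumes D: "smooth_distribution A D" and X: "field_smooth_at A X p"
  shows "field_smooth_at A (\<lambda>q. proj D q (X q)) p"
proof -
  obtain U where U: "\<And>u. u \<in> U \<Longrightarrow> field_smooth_at A u p"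
    "eventually (\<lambda>q. orth_family q U \<and> span ((\<lambda>u. u q) ` U) = D q) (nhds p)"
    by (rule orthogonal_frame[OF D, where p = p]) (rule that)
  from eventually_nhds_x_imp_x[OF U(2)] have Up: "orth_family p U" by simp
  have "field_smooth_at A (\<lambda>q. fourier q U (g q (X q))) p"
    using Up U(1) X by (intro field_smooth_at_fourier fun_smooth_at_metric)
      (auto simp: orth_family_def)
  then show ?thesis
  proof (rule field_smooth_at_transform)
    show "eventually (\<lambda>q. proj D q (X q) = fourier q U (g q (X q))) (nhds p)"
      using U(2) by (rule eventually_mono) (use proj_fourier in blast)
  qed
qed

end

section \<open>Horizontally conformal submersions\<close>

locale conformal_submersion =
  submersion_data A gM nablaM B gN nablaF F lam + M: riemannian A gM + N: riemannian B gN
  for A :: "('m::{t2_space, second_countable_topology}, 'e::euclidean_space) atlas"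
    and gM :: "'m \<Rightarrow> 'e \<Rightarrow> 'e \<Rightarrow> real"
    and nablaM :: "('m \<Rightarrow> 'e) \<Rightarrow> ('m \<Rightarrow> 'e) \<Rightarrow> 'm \<Rightarrow> 'e"
    and B :: "('n::{t2_space, second_countable_topology}, 'f::euclidean_space) atlas"
    and gN :: "'n \<Rightarrow> 'f \<Rightarrow> 'f \<Rightarrow> real"
    and nablaF :: "('m \<Rightarrow> 'e) \<Rightarrow> ('m \<Rightarrow> 'f) \<Rightarrow> 'm \<Rightarrow> 'f"
    and F :: "'m \<Rightarrow> 'n"
    and lam :: "'m \<Rightarrow> real" +
  assumes conformal: horizontally_conformal_submersion
begin

lemma F_smooth: "smooth_map A B F"
  and dF_surj: "surj (dF p)"
  and lam_smooth: "fun_smooth_at A lam p"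
  and lam_pos: "lam p > 0"
  and conformal_metric: "u \<in> horizontal p \<Longrightarrow> v \<in> horizontal p \<Longrightarrow>
    gN (F p) (dF p u) (dF p v) = (lam p)\<^sup>2 * gM p u v"
  using conformal unfolding horizontally_conformal_submersion_def M.smooth_fun_iff by blast+

lemma F_tendsto: "(F \<longlongrightarrow> F p) (nhds p)"
  by (rule tendsto_nhds_of_continuous_on[of UNIV]) (use F_smooth in \<open>auto simp: smooth_map_def\<close>)

lemma eventually_F: "eventually P (nhds (F p)) \<Longrightarrow> eventually (\<lambda>q. P (F q)) (nhds p)"
  using eventually_compose_filterlim F_tendsto by blast

lemma fun_smooth_at_chart_F:
  assumes d: "d \<in> B" "F p \<in> fst d" shows "fun_smooth_at A (\<lambda>q. snd d (F q)) p"
proof -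
  define c where "c = chart_at A p"
  have c: "c \<in> A" "p \<in> fst c" unfolding c_def using M.chart_at by auto
  have "open (F -` fst d)"
    using F_smooth N.open_dom[OF d(1)] by (auto simp: smooth_map_def continuous_on_open_vimage)
  then have "open (snd c ` (fst c \<inter> F -` fst d))" by (rule M.open_chart_image[OF c(1)])
  moreover have "smooth_on (\<lambda>x. snd d (F (inv_chart c x))) (snd c ` (fst c \<inter> F -` fst d))"
    using F_smooth c d by (auto simp: smooth_map_def)
  ultimately show ?thesis
    unfolding M.fun_smooth_at_chart[OF c] using c d by (intro smooth_on_imp_smooth_at) auto
qed

lemma fun_smooth_at_comp_chart_F:
  assumes d: "d \<in> B" "F p \<in> fst d" and h: "smooth_at h (snd d (F p))"
  shows "fun_smooth_at A (\<lambda>q. h (snd d (F q))) p"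
  by (rule M.fun_smooth_at_compose) (use h fun_smooth_at_chart_F[OF d] in auto)

lemma
  fixes f :: "'n \<Rightarrow> 'b::real_normed_vector"
  assumes f: "fun_smooth_at B f (F p)"
  shows fun_smooth_at_pullback: "fun_smooth_at A (\<lambda>q. f (F q)) p"
    and dfun_pullback: "dfun A (\<lambda>q. f (F q)) p v = dfun B f (F p) (dF p v)"
proof -
  define d where "d = chart_at B (F p)"
  have d: "d \<in> B" "F p \<in> fst d" unfolding d_def using N.chart_at by auto
  have ev: "eventually (\<lambda>q. f (F q) = f (inv_chart d (snd d (F q)))) (nhds p)"
    using eventually_F[OF N.eventually_dom[OF d]] by (rule eventually_mono) (simp add: d)
  have sm: "smooth_at (\<lambda>y. f (inv_chart d y)) (snd d (F p))"
    using f N.fun_smooth_at_chart[OF d] by blast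
  show "fun_smooth_at A (\<lambda>q. f (F q)) p"
    by (rule M.fun_smooth_at_transform[OF fun_smooth_at_comp_chart_F[OF d sm] ev])
  have "dfun A (\<lambda>q. f (F q)) p v = dfun A (\<lambda>q. f (inv_chart d (snd d (F q)))) p v"
    using M.dfun_cong[OF ev] by simp
  also have "\<dots> = fderiv (\<lambda>y. f (inv_chart d y)) (snd d (F p)) (dfun A (\<lambda>q. snd d (F q)) p v)"
    by (rule M.dfun_compose[OF sm fun_smooth_at_chart_F[OF d]])
  also have "\<dots> = dfun B f (F p) (dF p v)"
    by (simp add: dfun_def tangent_map_def d_def)
  finally show "dfun A (\<lambda>q. f (F q)) p v = dfun B f (F p) (dF p v)" .
qed

lemma dF_linear: "linear (dF p)"
  unfolding tangent_map_def
  by (intro M.dfun_linear fun_smooth_at_chart_F N.chart_at)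

subsection \<open>Smooth fields along the submersion\<close>

definition along_smooth_at :: "('m \<Rightarrow> 'f) \<Rightarrow> 'm \<Rightarrow> bool" where
  "along_smooth_at \<sigma> p \<longleftrightarrow>
     (\<forall>d\<in>B. F p \<in> fst d \<longrightarrow> fun_smooth_at A (\<lambda>q. dfun B (snd d) (F q) (\<sigma> q)) p)"

lemma along_smooth_atI:
  assumes c: "c \<in> B" "F p \<in> fst c" and X: "fun_smooth_at A (\<lambda>q. dfun B (snd c) (F q) (\<sigma> q)) p"
  shows "along_smooth_at \<sigma> p"
  unfolding along_smooth_at_def
proof (intro ballI impI)
  fix d assume d: "d \<in> B" "F p \<in> fst d"
  let ?L = "\<lambda>q. fderiv (\<lambda>x. snd d (inv_chart c x)) (snd c (F q))"
  have sm: "smooth_at (\<lambda>x. snd d (inv_chart c x)) (snd c (F p))"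
    using c d by (intro N.transition_smooth_at)
  show "fun_smooth_at A (\<lambda>q. dfun B (snd d) (F q) (\<sigma> q)) p"
  proof (rule M.fun_smooth_at_transform)
    show "fun_smooth_at A (\<lambda>q. ?L q (dfun B (snd c) (F q) (\<sigma> q))) p"
    proof (rule M.fun_smooth_at_apply_linear[OF _ _ X])
      have "eventually (\<lambda>q. smooth_at (\<lambda>x. snd d (inv_chart c x)) (snd c (F q))) (nhds p)"
        using smooth_at_eventually[OF sm] filterlim_compose[OF N.chart_tendsto[OF c] F_tendsto]
        by (rule eventually_compose_filterlim)
      then show "eventually (\<lambda>q. linear (?L q)) (nhds p)"
        by (rule eventually_mono) (rule smooth_at_linear)
      show "fun_smooth_at A (\<lambda>q. ?L q b) p" for b
        by (rule fun_smooth_at_comp_chart_F[OF c smooth_at_derivative[OF sm]])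
    qed
    show "eventually (\<lambda>q. dfun B (snd d) (F q) (\<sigma> q) = ?L q (dfun B (snd c) (F q) (\<sigma> q))) (nhds p)"
      using eventually_F[OF N.eventually_dom[OF c]] eventually_F[OF N.eventually_dom[OF d]]
      by eventually_elim (intro N.dfun_chart N.fun_smooth_at_chart_map c d)
  qed
qed

lemma along_smooth_at_chart:
  "c \<in> B \<Longrightarrow> F p \<in> fst c \<Longrightarrow>
    along_smooth_at \<sigma> p \<longleftrightarrow> fun_smooth_at A (\<lambda>q. dfun B (snd c) (F q) (\<sigma> q)) p"
  by (rule iffI) (simp add: along_smooth_at_def, rule along_smooth_atI)

lemma smooth_along_iff: "smooth_along A B F \<sigma> \<longleftrightarrow> (\<forall>p. along_smooth_at \<sigma> p)"
proof -
  have o: "open (snd c ` (fst c \<inter> F -` fst d))" if "c \<in> A" "d \<in> B" for c d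
    using F_smooth N.open_dom[OF that(2)] M.open_chart_image[OF that(1), of "F -` fst d"]
    by (auto simp: smooth_map_def continuous_on_open_vimage)
  have "smooth_along A B F \<sigma> \<longleftrightarrow> (\<forall>c\<in>A. \<forall>d\<in>B. \<forall>p\<in>fst c \<inter> F -` fst d.
     smooth_at (\<lambda>x. dfun B (snd d) (F (inv_chart c x)) (\<sigma> (inv_chart c x))) (snd c p))"
    unfolding smooth_along_def by (simp add: smooth_on_iff_smooth_at o)
  also have "\<dots> \<longleftrightarrow> (\<forall>c\<in>A. \<forall>d\<in>B. \<forall>p\<in>fst c \<inter> F -` fst d.
     fun_smooth_at A (\<lambda>q. dfun B (snd d) (F q) (\<sigma> q)) p)"
    by (intro ball_cong refl) (simp add: M.fun_smooth_at_chart)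
  also have "\<dots> \<longleftrightarrow> (\<forall>p. along_smooth_at \<sigma> p)"
    unfolding along_smooth_at_def using M.chart_at by (meson IntD1 IntD2 IntI vimageD vimageI)
  finally show ?thesis .
qed

lemma eventually_linear_chart_F:
  "eventually (\<lambda>q. linear (dfun B (snd (chart_at B (F p))) (F q))) (nhds p)"
  using eventually_F[OF N.eventually_dom[OF N.chart_at]]
  by (rule eventually_mono) (rule N.dfun_chart_map_linear[OF N.chart_at(1)])

lemma along_smooth_at_add:
  assumes "along_smooth_at \<sigma> p" "along_smooth_at \<tau> p"
  shows "along_smooth_at (\<lambda>q. \<sigma> q + \<tau> q) p"
proof (rule along_smooth_atI[OF N.chart_at], rule M.fun_smooth_at_transform)
  let ?c = "chart_at B (F p)"
  show "fun_smooth_at A (\<lambda>q. dfun B (snd ?c) (F q) (\<sigma> q) + dfun B (snd ?c) (F q) (\<tau> q)) p"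
    using assms by (intro M.fun_smooth_at_add) (simp_all add: along_smooth_at_chart[OF N.chart_at])
  show "eventually (\<lambda>q. dfun B (snd ?c) (F q) (\<sigma> q + \<tau> q) =
      dfun B (snd ?c) (F q) (\<sigma> q) + dfun B (snd ?c) (F q) (\<tau> q)) (nhds p)"
    using eventually_linear_chart_F by (rule eventually_mono) (rule linear_add)
qed

lemma along_smooth_at_scaleR:
  assumes "fun_smooth_at A r p" "along_smooth_at \<tau> p"
  shows "along_smooth_at (\<lambda>q. r q *\<^sub>R \<tau> q) p"
proof (rule along_smooth_atI[OF N.chart_at], rule M.fun_smooth_at_transform)
  let ?c = "chart_at B (F p)"
  show "fun_smooth_at A (\<lambda>q. r q *\<^sub>R dfun B (snd ?c) (F q) (\<tau> q)) p"
    using assms by (intro M.fun_smooth_at_scaleR)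
      (simp_all add: along_smooth_at_chart[OF N.chart_at])
  show "eventually (\<lambda>q. dfun B (snd ?c) (F q) (r q *\<^sub>R \<tau> q) = r q *\<^sub>R dfun B (snd ?c) (F q) (\<tau> q))
      (nhds p)"
    using eventually_linear_chart_F by (rule eventually_mono) (rule linear_cmul)
qed

lemma along_smooth_at_0: "along_smooth_at (\<lambda>q. 0) p"
proof (rule along_smooth_atI[OF N.chart_at],
  rule M.fun_smooth_at_transform[OF M.fun_smooth_at_const[of 0]])
  show "eventually (\<lambda>q. dfun B (snd (chart_at B (F p))) (F q) 0 = 0) (nhds p)"
    using eventually_linear_chart_F by (rule eventually_mono) (rule linear_0)
qed

lemma along_smooth_at_sum:
  "(\<And>i. i \<in> I \<Longrightarrow> along_smooth_at (\<sigma> i) p) \<Longrightarrow> along_smooth_at (\<lambda>q. \<Sum>i\<in>I. \<sigma> i q) p"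
  by (induction I rule: infinite_finite_induct) (auto intro: along_smooth_at_add along_smooth_at_0)

lemma along_smooth_at_pullback:
  assumes "field_smooth_at B W (F p)" shows "along_smooth_at (\<lambda>q. W (F q)) p"
  by (rule along_smooth_atI[OF N.chart_at], rule fun_smooth_at_pullback)
     (use assms N.field_smooth_at_chart[OF N.chart_at] in blast)

lemma along_smooth_at_dF:
  assumes "field_smooth_at A X p" shows "along_smooth_at (\<lambda>q. dF q (X q)) p"
proof (rule along_smooth_atI[OF N.chart_at], rule M.fun_smooth_at_transform)
  let ?d = "chart_at B (F p)"
  show "fun_smooth_at A (\<lambda>q. dfun A (\<lambda>q. snd ?d (F q)) q (X q)) p"
    by (intro M.fun_smooth_at_dfun fun_smooth_at_chart_F N.chart_at assms)
  show "eventually (\<lambda>q. dfun B (snd ?d) (F q) (dF q (X q)) = dfun A (\<lambda>q. snd ?d (F q)) q (X q))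
      (nhds p)"
    using eventually_F[OF N.eventually_dom[OF N.chart_at]]
    by (rule eventually_mono)
      (rule dfun_pullback[symmetric], rule N.fun_smooth_at_chart_map[OF N.chart_at(1)])
qed

lemma fun_smooth_at_metric_along:
  assumes "along_smooth_at \<sigma> p" "along_smooth_at \<tau> p"
  shows "fun_smooth_at A (\<lambda>q. gN (F q) (\<sigma> q) (\<tau> q)) p"
proof -
  define c where "c = chart_at B (F p)"
  have c: "c \<in> B" "F p \<in> fst c" unfolding c_def using N.chart_at by auto
  define L where "L q a b = gN (F q) (coord_vec B c (F q) a) (coord_vec B c (F q) b)" for q a b
  have ev: "eventually (\<lambda>q. F q \<in> fst c) (nhds p)" by (rule eventually_F[OF N.eventually_dom[OF c]])
  have "fun_smooth_at A (\<lambda>q. L q (dfun B (snd c) (F q) (\<sigma> q)) (dfun B (snd c) (F q) (\<tau> q))) p"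
  proof (rule M.fun_smooth_at_bilinear[where L = L])
    show "eventually (\<lambda>q. bilinear (L q)) (nhds p)"
      using ev
    proof (rule eventually_mono)
      fix q assume "F q \<in> fst c"
      note l = N.coord_vec_linear[OF c(1) this]
      show "bilinear (L q)" unfolding bilinear_def L_def
        by (auto intro!: linearI simp: linear_add[OF l] linear_cmul[OF l] N.g_simps)
    qed
    show "fun_smooth_at A (\<lambda>q. L q a b) p" for a b
      unfolding L_def
      by (intro fun_smooth_at_pullback N.fun_smooth_at_metric N.field_smooth_at_coord_vec c
        N.fun_smooth_at_const)
  qed (use assms along_smooth_at_chart[OF c] in auto)
  then show ?thesis
  proof (rule M.fun_smooth_at_transform)
    show "eventually (\<lambda>q. gN (F q) (\<sigma> q) (\<tau> q) = L q (dfun B (snd c) (F q) (\<sigma> q))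
        (dfun B (snd c) (F q) (\<tau> q))) (nhds p)"
      using ev by (rule eventually_mono) (simp add: L_def N.coord_vec_dfun[OF c(1)])
  qed
qed

subsection \<open>Horizontal lifts\<close>

lemma subspace_vertical: "subspace (vertical p)"
  unfolding vertical_def subspace_def using dF_linear
  by (auto simp: linear_0 linear_add linear_cmul)

lemma subspace_horizontal: "subspace (horizontal p)"
  unfolding horizontal_def by (intro M.subspace_orth_in) auto

lemma horizontal_vertical_orth: "v \<in> horizontal p \<Longrightarrow> w \<in> vertical p \<Longrightarrow> gM p v w = 0"
  by (auto simp: horizontal_def orth_in_def)

lemma vertical_horizontal_orth: "v \<in> vertical p \<Longrightarrow> w \<in> horizontal p \<Longrightarrow> gM p v w = 0"
  using horizontal_vertical_orth M.g_sym by metis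

lemma horizontal_vertical_0: "v \<in> horizontal p \<Longrightarrow> v \<in> vertical p \<Longrightarrow> v = 0"
  using horizontal_vertical_orth M.g_eq_0_iff by blast

text \<open>Conformality makes the rescaled adjoint of the tangent map a right inverse. Let \<open>x = F\<^sub>* w
  - u\<close> and let \<open>z\<close> be the adjoint vector of \<open>x\<close>. Conformality gives \<open>\<langle>F\<^sub>* w, F\<^sub>* z\<rangle> = \<langle>u, F\<^sub>*
  z\<rangle>\<close>, that is \<open>\<langle>z, z\<rangle> = 0\<close>; so \<open>x\<close> is orthogonal to the image of the tangent map and therefore
  zero.\<close>

lemma adjoint_is_lift:
  assumes w: "\<And>v. gM p w v = inverse ((lam p)\<^sup>2) * gN (F p) u (dF p v)"
  shows "w \<in> horizontal p" "dF p w = u"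
proof -
  \<comment> \<open>Every vector \<open>x\<close> has an adjoint vector, which is horizontal.\<close>
  have adj: "\<exists>w. \<forall>v. gM p w v = inverse ((lam p)\<^sup>2) * gN (F p) x (dF p v)" for x
  proof -
    have "linear (\<lambda>v. inverse ((lam p)\<^sup>2) * gN (F p) x (dF p v))"
      using dF_linear[of p] by (intro linearI) (auto simp: linear_add linear_cmul N.g_simps
        algebra_simps)
    then show ?thesis using M.riesz by metis
  qed
  have hor: "w \<in> horizontal p" if "\<And>v. gM p w v = inverse ((lam p)\<^sup>2) * gN (F p) x (dF p v)" for w x
    using that by (auto simp: horizontal_def orth_in_def vertical_def N.g_simps)
  show wh: "w \<in> horizontal p" by (rule hor[OF w])
  define x where "x = dF p w - u"
  obtain z where z: "\<And>v. gM p z v = inverse ((lam p)\<^sup>2) * gN (F p) x (dF p v)" using adj by metis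
  have zh: "z \<in> horizontal p" by (rule hor[OF z])
  have "gN (F p) (dF p w) (dF p z) = gN (F p) u (dF p z)"
    using conformal_metric[OF wh zh] w[of z] lam_pos[of p] by (simp add: field_simps)
  then have "gM p z z = 0" using z[of z] by (simp add: x_def N.g_simps)
  then have "z = 0" by (simp add: M.g_eq_0_iff)
  then have "gN (F p) x (dF p v) = 0" for v
    using z[of v] lam_pos[of p] by (simp add: M.g_simps)
  moreover obtain v where "x = dF p v" using dF_surj by (metis surjD)
  ultimately have "x = 0" using N.g_eq_0_iff by metis
  then show "dF p w = u" by (simp add: x_def)
qed

definition lift :: "'m \<Rightarrow> 'f \<Rightarrow> 'e" where
  "lift p u = (THE w. w \<in> horizontal p \<and> dF p w = u)"

lemma lift_eqI: "w \<in> horizontal p \<Longrightarrow> dF p w = u \<Longrightarrow> lift p u = w"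
  unfolding lift_def
proof (rule the_equality)
  fix w' assume w: "w \<in> horizontal p" "dF p w = u" and w': "w' \<in> horizontal p \<and> dF p w' = u"
  have "w' - w \<in> horizontal p" using w w' subspace_horizontal subspace_diff by blast
  moreover have "w' - w \<in> vertical p" using w w' dF_linear by (simp add: vertical_def linear_diff)
  ultimately have "w' - w = 0" by (rule horizontal_vertical_0)
  then show "w' = w" by simp
qed auto

text \<open>An explicit formula in an orthogonal frame: it shows that lifts of smooth fields are
  smooth, and with them the horizontal and vertical projections.\<close>

lemma lift_fourier:
  assumes U: "M.orth_family p U" "span ((\<lambda>u. u p) ` U) = UNIV"
  shows "lift p u = M.fourier p U (\<lambda>v. inverse ((lam p)\<^sup>2) * gN (F p) u (dF p v))" (is "_ = ?w")
proof -
  have "linear (\<lambda>v. inverse ((lam p)\<^sup>2) * gN (F p) u (dF p v))"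
    using dF_linear[of p] by (intro linearI) (auto simp: linear_add linear_cmul N.g_simps
      algebra_simps)
  from M.fourier_inner_span[OF U(1) this]
  have "gM p ?w v = inverse ((lam p)\<^sup>2) * gN (F p) u (dF p v)" for v using U(2) by simp
  from adjoint_is_lift[OF this] show ?thesis by (intro lift_eqI)
qed

lemma lift_horizontal: "lift p u \<in> horizontal p"
  and dF_lift: "dF p (lift p u) = u"
proof -
  have "linear (\<lambda>v. inverse ((lam p)\<^sup>2) * gN (F p) u (dF p v))"
    using dF_linear[of p] by (intro linearI) (auto simp: linear_add linear_cmul N.g_simps
      algebra_simps)
  then obtain w where "\<And>v. gM p w v = inverse ((lam p)\<^sup>2) * gN (F p) u (dF p v)"
    using M.riesz by metis
  from adjoint_is_lift[OF this] lift_eqI[OF adjoint_is_lift[OF this]]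
  show "lift p u \<in> horizontal p" "dF p (lift p u) = u" by auto
qed

lemma lift_linear: "linear (lift p)"
proof (rule linearI)
  show "lift p (u + v) = lift p u + lift p v" for u v
    by (intro lift_eqI subspace_add[OF subspace_horizontal] lift_horizontal)
       (simp add: linear_add[OF dF_linear] dF_lift)
  show "lift p (r *\<^sub>R u) = r *\<^sub>R lift p u" for u r
    by (intro lift_eqI subspace_scale[OF subspace_horizontal] lift_horizontal)
       (simp add: linear_cmul[OF dF_linear] dF_lift)
qed

lemma field_smooth_at_lift:
  assumes \<sigma>: "along_smooth_at \<sigma> p" shows "field_smooth_at A (\<lambda>q. lift q (\<sigma> q)) p"
proof -
  obtain U where U: "\<And>u. u \<in> U \<Longrightarrow> field_smooth_at A u p"
    "eventually (\<lambda>q. M.orth_family q U \<and> span ((\<lambda>u. u q) ` U) = UNIV) (nhds p)"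
    by (rule M.orthogonal_frame[OF M.smooth_distribution_UNIV, where p = p]) (rule that)
  from eventually_nhds_x_imp_x[OF U(2)] have Up: "M.orth_family p U" by simp
  have "field_smooth_at A (\<lambda>q. M.fourier q U (\<lambda>v. inverse ((lam q)\<^sup>2) * gN (F q) (\<sigma> q) (dF q v))) p"
  proof (rule M.field_smooth_at_fourier)
    show "fun_smooth_at A (\<lambda>q. inverse ((lam q)\<^sup>2) * gN (F q) (\<sigma> q) (dF q (u q))) p"
      if "u \<in> U" for u
      using lam_pos[of p] unfolding power2_eq_square
      by (intro M.fun_smooth_at_mult M.fun_smooth_at_inverse lam_smooth fun_smooth_at_metric_along
          \<sigma> along_smooth_at_dF U(1) that) auto
  qed (use Up U(1) in \<open>auto simp: M.orth_family_def\<close>)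
  then show ?thesis
  proof (rule M.field_smooth_at_transform)
    show "eventually (\<lambda>q. lift q (\<sigma> q) =
        M.fourier q U (\<lambda>v. inverse ((lam q)\<^sup>2) * gN (F q) (\<sigma> q) (dF q v))) (nhds p)"
      using U(2) by (rule eventually_mono) (rule lift_fourier, simp_all)
  qed
qed

lemma hor_eq_lift: "hor p v = lift p (dF p v)"
  unfolding hor_def
proof (rule component_eqI[OF subspace_horizontal subspace_vertical horizontal_vertical_0
  lift_horizontal])
  show "v - lift p (dF p v) \<in> vertical p"
    by (simp add: vertical_def linear_diff[OF dF_linear] dF_lift)
qed

lemma hor_in: "hor p v \<in> horizontal p"
  by (simp add: hor_eq_lift lift_horizontal)

lemma diff_hor_in: "v - hor p v \<in> vertical p"
  by (simp add: hor_eq_lift vertical_def linear_diff[OF dF_linear] dF_lift)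

lemma vert_eq: "vert p v = v - hor p v"
  unfolding vert_def
  by (rule component_eqI[OF subspace_vertical subspace_horizontal])
     (use horizontal_vertical_0 diff_hor_in hor_in in auto)

lemma vert_in: "vert p v \<in> vertical p"
  by (simp add: vert_eq diff_hor_in)

lemma hor_plus_vert: "hor p v + vert p v = v"
  by (simp add: vert_eq)

lemma hor_horizontal: "v \<in> horizontal p \<Longrightarrow> hor p v = v"
  unfolding hor_eq_lift by (intro lift_eqI) auto

lemma vert_horizontal: "v \<in> horizontal p \<Longrightarrow> vert p v = 0"
  by (simp add: vert_eq hor_horizontal)

lemma hor_vertical: "v \<in> vertical p \<Longrightarrow> hor p v = 0"
  unfolding hor_eq_lift by (simp add: vertical_def linear_0[OF lift_linear])

lemma vert_vertical: "v \<in> vertical p \<Longrightarrow> vert p v = v"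
  by (simp add: vert_eq hor_vertical)

lemma hor_inner: "w \<in> horizontal p \<Longrightarrow> gM p (hor p v) w = gM p v w"
  using vertical_horizontal_orth[OF diff_hor_in[of v p]] by (simp add: M.g_simps)

lemma vert_inner: "w \<in> vertical p \<Longrightarrow> gM p (vert p v) w = gM p v w"
  using horizontal_vertical_orth[OF hor_in[of p v]] by (simp add: M.g_simps vert_eq)

lemma vert_diff: "vert p (u - v) = vert p u - vert p v"
  by (simp add: vert_eq hor_eq_lift linear_diff[OF dF_linear] linear_diff[OF lift_linear])

lemma dF_hor: "dF p (hor p v) = dF p v"
  by (simp add: hor_eq_lift dF_lift)

lemma horizontalI_vert: "vert p v = 0 \<Longrightarrow> v \<in> horizontal p"
  using hor_in[of p v] by (simp add: vert_eq)

lemma field_smooth_at_hor: "field_smooth_at A X p \<Longrightarrow> field_smooth_at A (\<lambda>q. hor q (X q)) p"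
  unfolding hor_eq_lift by (intro field_smooth_at_lift along_smooth_at_dF)

lemma field_smooth_at_vert: "field_smooth_at A X p \<Longrightarrow> field_smooth_at A (\<lambda>q. vert q (X q)) p"
  unfolding vert_eq by (intro M.field_smooth_at_diff field_smooth_at_hor)

end

section \<open>The pullback connection and the second fundamental form\<close>

context manifold
begin

lemma extend_fun:
  assumes "fun_smooth_at A f p"
  obtains h where "smooth_fun A h" "eventually (\<lambda>q. h q = f q) (nhds p)"
proof -
  obtain W where W: "open W" "p \<in> W" "\<And>q. q \<in> W \<Longrightarrow> fun_smooth_at A f q"
    using fun_smooth_at_eventually[OF assms] unfolding eventually_nhds by blast
  obtain \<beta> :: "'m \<Rightarrow> real" where b: "\<And>q. fun_smooth_at A \<beta> q" "eventually (\<lambda>q. \<beta> q = 1) (nhds p)"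
    "\<And>q. q \<notin> W \<Longrightarrow> eventually (\<lambda>q. \<beta> q = 0) (nhds q)"
    using manifold_bump[OF W(1,2)] by blast
  show ?thesis
    by (rule that[OF bump_fun[of \<beta> W f, OF b(1,3) W(3)]])
       (use b(2) in \<open>auto elim!: eventually_mono\<close>)
qed

lemma extend_vector:
  obtains X where "smooth_field A X" "X p = v"
proof -
  have "field_smooth_at A (\<lambda>q. coord_vec A (chart_at A p) q (dfun A (snd (chart_at A p)) p v)) p"
    by (intro field_smooth_at_coord_vec chart_at fun_smooth_at_const)
  then obtain \<beta> where b:
    "smooth_field A (\<lambda>q. \<beta> q *\<^sub>R coord_vec A (chart_at A p) q (dfun A (snd (chart_at A p)) p v))"
     "eventually (\<lambda>q. \<beta> q = 1) (nhds p)" by (rule extend_field)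
  show ?thesis
    by (rule that[OF b(1)]) (use eventually_nhds_x_imp_x[OF b(2)] coord_vec_dfun[OF chart_at]
      in simp)
qed

text \<open>The fields have constant components in the chart in which the bracket is computed.\<close>

lemma lie_bracket_coordinate_fields:
  fixes V W :: "'m \<Rightarrow> 'e"
  assumes c: "c = chart_at A p"
    and V: "eventually (\<lambda>q. V q = coord_vec A c q v) (nhds p)"
    and W: "eventually (\<lambda>q. W q = coord_vec A c q w) (nhds p)"
  shows "lie_bracket A V W p = 0"
proof -
  have *: "dfun A (\<lambda>q. dfun A (snd c) q (Z q)) p u = 0"
    if Z: "eventually (\<lambda>q. Z q = coord_vec A c q z) (nhds p)" for Z z u
  proof -
    have cc: "c \<in> A" "p \<in> fst c" unfolding c using chart_at by auto
    have "eventually (\<lambda>q. dfun A (snd c) q (Z q) = z) (nhds p)"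
      using Z eventually_dom[OF cc] by eventually_elim (simp add: dfun_coord_vec[OF cc(1)])
    from dfun_cong[OF this] show ?thesis by simp
  qed
  show ?thesis unfolding lie_bracket_def Let_def using *[OF V] *[OF W] unfolding c by simp
qed

end

lemma
  assumes "affine_connection A nabla"
  shows affine_connection_smooth: "smooth_field A X \<Longrightarrow> smooth_field A Y \<Longrightarrow> smooth_field A (nabla X Y)"
    and affine_connection_add_left: "smooth_field A X \<Longrightarrow> smooth_field A X' \<Longrightarrow> smooth_field A Y \<Longrightarrow>
        nabla (\<lambda>p. X p + X' p) Y = (\<lambda>p. nabla X Y p + nabla X' Y p)"
    and affine_connection_scaleR_left: "smooth_fun A h \<Longrightarrow> smooth_field A X \<Longrightarrow> smooth_field A Y \<Longrightarrow>
        nabla (\<lambda>p. h p *\<^sub>R X p) Y = (\<lambda>p. h p *\<^sub>R nabla X Y p)"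
    and affine_connection_add_right: "smooth_field A X \<Longrightarrow> smooth_field A Y \<Longrightarrow> smooth_field A Y' \<Longrightarrow>
        nabla X (\<lambda>p. Y p + Y' p) = (\<lambda>p. nabla X Y p + nabla X Y' p)"
    and affine_connection_scaleR_right: "smooth_fun A h \<Longrightarrow> smooth_field A X \<Longrightarrow> smooth_field A Y \<Longrightarrow>
        nabla X (\<lambda>p. h p *\<^sub>R Y p) = (\<lambda>p. dfun A h p (X p) *\<^sub>R Y p + h p *\<^sub>R nabla X Y p)"
  using assms unfolding affine_connection_def by blast+

context manifold
begin

lemma smooth_fun_const [simp]: "smooth_fun A (\<lambda>p. r)"
  by (simp add: smooth_fun_iff)

lemma affine_connection_sum_left:
  assumes nabla: "affine_connection A nabla" and I: "finite I"
    and sm: "\<And>i. i \<in> I \<Longrightarrow> smooth_field A (W i)" "smooth_field A Y"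
  shows "nabla (\<lambda>p. \<Sum>i\<in>I. r i *\<^sub>R W i p) Y = (\<lambda>p. \<Sum>i\<in>I. r i *\<^sub>R nabla (W i) Y p)"
  using I sm(1)
proof (induction I rule: finite_induct)
  case empty
  show ?case using affine_connection_scaleR_left[OF nabla smooth_fun_const[of 0] sm(2,2)] by simp
next
  case (insert i I)
  have "smooth_field A (\<lambda>p. \<Sum>i\<in>I. r i *\<^sub>R W i p)" "smooth_field A (\<lambda>p. r i *\<^sub>R W i p)"
    using insert.prems unfolding smooth_field_iff
    by (auto intro!: field_smooth_at_sum field_smooth_at_scaleR)
  then show ?case using insert affine_connection_add_left[OF nabla _ _ sm(2)]
      affine_connection_scaleR_left[OF nabla smooth_fun_const _ sm(2), of "W i" "r i"] by simp
qed

end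

locale conformal_submersion_connections =
  conformal_submersion A gM nablaM B gN nablaF F lam
  for A :: "('m::{t2_space, second_countable_topology}, 'e::euclidean_space) atlas" and gM nablaM
    and B :: "('n::{t2_space, second_countable_topology}, 'f::euclidean_space) atlas"
      and gN nablaF F lam +
  fixes nablaN :: "('n \<Rightarrow> 'f) \<Rightarrow> ('n \<Rightarrow> 'f) \<Rightarrow> 'n \<Rightarrow> 'f"
  assumes levi_civita_M: "levi_civita A gM nablaM"
    and levi_civita_N: "levi_civita B gN nablaN"
    and pullback: "pullback_connection A B F nablaN nablaF"
begin

lemma connection_M: "affine_connection A nablaM"
  and torsion_M: "smooth_field A X \<Longrightarrow> smooth_field A Y \<Longrightarrow>
    nablaM X Y p - nablaM Y X p = lie_bracket A X Y p"
  and metric_M: "smooth_field A X \<Longrightarrow> smooth_field A Y \<Longrightarrow> smooth_field A Z \<Longrightarrow>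
    dfun A (\<lambda>q. gM q (Y q) (Z q)) p (X p) = gM p (nablaM X Y p) (Z p) + gM p (Y p) (nablaM X Z p)"
  using levi_civita_M unfolding levi_civita_def by blast+

lemma connection_N: "affine_connection B nablaN"
  and torsion_N: "smooth_field B V \<Longrightarrow> smooth_field B W \<Longrightarrow>
    nablaN V W r - nablaN W V r = lie_bracket B V W r"
  and metric_N: "smooth_field B U \<Longrightarrow> smooth_field B V \<Longrightarrow> smooth_field B W \<Longrightarrow>
    dfun B (\<lambda>q. gN q (V q) (W q)) r (U r) = gN r (nablaN U V r) (W r) + gN r (V r) (nablaN U W r)"
  using levi_civita_N unfolding levi_civita_def by blast+

lemma
  shows nablaF_add: "smooth_field A X \<Longrightarrow> smooth_along A B F \<sigma> \<Longrightarrow> smooth_along A B F \<tau> \<Longrightarrow>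
        nablaF X (\<lambda>p. \<sigma> p + \<tau> p) = (\<lambda>p. nablaF X \<sigma> p + nablaF X \<tau> p)"
    and nablaF_scaleR: "smooth_fun A h \<Longrightarrow> smooth_field A X \<Longrightarrow> smooth_along A B F \<sigma> \<Longrightarrow>
        nablaF X (\<lambda>p. h p *\<^sub>R \<sigma> p) = (\<lambda>p. dfun A h p (X p) *\<^sub>R \<sigma> p + h p *\<^sub>R nablaF X \<sigma> p)"
    and nablaF_pullback: "smooth_field A X \<Longrightarrow> smooth_field B V \<Longrightarrow> smooth_field B W \<Longrightarrow>
        V (F p) = dF p (X p) \<Longrightarrow> nablaF X (\<lambda>q. W (F q)) p = nablaN V W (F p)"
  using pullback unfolding pullback_connection_def by blast+

lemma smooth_along_add: "smooth_along A B F \<sigma> \<Longrightarrow> smooth_along A B F \<tau> \<Longrightarrow>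
    smooth_along A B F (\<lambda>q. \<sigma> q + \<tau> q)"
  and smooth_along_scaleR: "smooth_fun A h \<Longrightarrow> smooth_along A B F \<sigma> \<Longrightarrow>
      smooth_along A B F (\<lambda>q. h q *\<^sub>R \<sigma> q)"
  and smooth_along_0: "smooth_along A B F (\<lambda>q. 0)"
  and smooth_along_pullback: "smooth_field B W \<Longrightarrow> smooth_along A B F (\<lambda>q. W (F q))"
  and smooth_along_dF: "smooth_field A X \<Longrightarrow> smooth_along A B F (\<lambda>q. dF q (X q))"
  unfolding smooth_along_iff M.smooth_fun_iff M.smooth_field_iff N.smooth_field_iff
  by (auto intro: along_smooth_at_add along_smooth_at_scaleR along_smooth_at_0
    along_smooth_at_pullback along_smooth_at_dF)

lemma smooth_along_sum:
  "(\<And>i. i \<in> I \<Longrightarrow> smooth_along A B F (\<sigma> i)) \<Longrightarrow> smooth_along A B F (\<lambda>q. \<Sum>i\<in>I. \<sigma> i q)"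
  unfolding smooth_along_iff by (auto intro: along_smooth_at_sum)

lemma nablaF_0:
  assumes X: "smooth_field A X" shows "nablaF X (\<lambda>q. 0) p = 0"
  using nablaF_scaleR[OF M.smooth_fun_const[of 0] X smooth_along_0] by simp

text \<open>The Leibniz rule makes the connection local: \<open>\<beta> \<sigma> = 0\<close> for a bump function \<open>\<beta>\<close> supported
  where \<open>\<sigma>\<close> vanishes.\<close>

lemma nablaF_vanishing:
  assumes X: "smooth_field A X" and \<sigma>: "smooth_along A B F \<sigma>"
    and ev: "eventually (\<lambda>q. \<sigma> q = 0) (nhds p)"
  shows "nablaF X \<sigma> p = 0"
proof -
  obtain W where W: "open W" "p \<in> W" "\<And>q. q \<in> W \<Longrightarrow> \<sigma> q = 0"
    using ev unfolding eventually_nhds by blast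
  obtain \<beta> :: "'m \<Rightarrow> real" where b: "\<And>q. fun_smooth_at A \<beta> q" "eventually (\<lambda>q. \<beta> q = 1) (nhds p)"
    "\<And>q. q \<notin> W \<Longrightarrow> eventually (\<lambda>q. \<beta> q = 0) (nhds q)"
    using M.manifold_bump[OF W(1,2)] by blast
  have "\<beta> q *\<^sub>R \<sigma> q = 0" for q
    using W(3)[of q] eventually_nhds_x_imp_x[OF b(3)[of q]] by (cases "q \<in> W") auto
  then have "(\<lambda>q. \<beta> q *\<^sub>R \<sigma> q) = (\<lambda>q. 0)" by (rule ext)
  then have "nablaF X (\<lambda>q. \<beta> q *\<^sub>R \<sigma> q) p = 0" by (simp only: nablaF_0[OF X])
  moreover have "smooth_fun A \<beta>" using b(1) by (simp add: M.smooth_fun_iff)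
  ultimately show ?thesis
    using nablaF_scaleR[of \<beta>, OF _ X \<sigma>] W(2,3) eventually_nhds_x_imp_x[OF b(2)] by simp
qed

lemma nablaF_cong:
  assumes X: "smooth_field A X" and \<sigma>: "smooth_along A B F \<sigma>" "smooth_along A B F \<tau>"
    and ev: "eventually (\<lambda>q. \<sigma> q = \<tau> q) (nhds p)"
  shows "nablaF X \<sigma> p = nablaF X \<tau> p"
proof -
  have m: "smooth_along A B F (\<lambda>q. (-1) *\<^sub>R \<tau> q)"
    by (intro smooth_along_scaleR \<sigma> M.smooth_fun_const)
  have "nablaF X (\<lambda>q. \<sigma> q + (-1) *\<^sub>R \<tau> q) p = 0"
    by (rule nablaF_vanishing[OF X smooth_along_add[OF \<sigma>(1) m]])
      (use ev in \<open>auto elim!: eventually_mono\<close>)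
  moreover have "nablaF X (\<lambda>q. \<sigma> q + (-1) *\<^sub>R \<tau> q) p = nablaF X \<sigma> p + (-1) *\<^sub>R nablaF X \<tau> p"
    using nablaF_add[OF X \<sigma>(1) m] nablaF_scaleR[OF M.smooth_fun_const[of "-1"] X \<sigma>(2)] by simp
  ultimately show ?thesis by simp
qed

lemma nablaF_sum:
  assumes X: "smooth_field A X" and I: "finite I"
    and sm: "\<And>i. i \<in> I \<Longrightarrow> smooth_along A B F (\<sigma> i)"
  shows "nablaF X (\<lambda>q. \<Sum>i\<in>I. \<sigma> i q) p = (\<Sum>i\<in>I. nablaF X (\<sigma> i) p)"
  using I sm
proof (induction I rule: finite_induct)
  case empty then show ?case using nablaF_0[OF X] by simp
next
  case (insert i I)
  then show ?case using nablaF_add[OF X, of "\<sigma> i" "\<lambda>q. \<Sum>i\<in>I. \<sigma> i q"] smooth_along_sum[of I \<sigma>]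
    by simp
qed

subsection \<open>Local frames of the pullback bundle\<close>

text \<open>Global fields on \<open>N\<close> that agree with the coordinate fields near \<open>F p\<close>. The axioms give the
  pullback connection explicitly on fields of the form \<open>W \<circ> F\<close>, and these span locally.\<close>

definition coordinate_frame :: "'m \<Rightarrow> ('f \<Rightarrow> 'n \<Rightarrow> 'f) \<Rightarrow> bool" where
  "coordinate_frame p W \<longleftrightarrow> (\<forall>b\<in>Basis. smooth_field B (W b) \<and>
     eventually (\<lambda>r. W b r = coord_vec B (chart_at B (F p)) r b) (nhds (F p)))"

lemma coordinate_frame_exists: obtains W where "coordinate_frame p W"
proof -
  have "\<forall>b. \<exists>W. smooth_field B W \<and> eventually (\<lambda>r. W r = coord_vec B (chart_at B (F p)) r b)
      (nhds (F p))"
  proof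
    fix b
    have "field_smooth_at B (\<lambda>r. coord_vec B (chart_at B (F p)) r b) (F p)"
      by (intro N.field_smooth_at_coord_vec N.chart_at N.fun_smooth_at_const)
    then obtain \<beta> where "smooth_field B (\<lambda>r. \<beta> r *\<^sub>R coord_vec B (chart_at B (F p)) r b)"
      "eventually (\<lambda>r. \<beta> r = 1) (nhds (F p))" by (rule N.extend_field)
    then show "\<exists>W. smooth_field B W \<and> eventually (\<lambda>r. W r = coord_vec B (chart_at B (F p)) r b)
        (nhds (F p))"
      by (intro exI[of _ "\<lambda>r. \<beta> r *\<^sub>R coord_vec B (chart_at B (F p)) r b"])
        (auto elim!: eventually_mono)
  qed
  then obtain W where "\<forall>b. smooth_field B (W b) \<and>
      eventually (\<lambda>r. W b r = coord_vec B (chart_at B (F p)) r b) (nhds (F p))"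
    by metis
  then show ?thesis using that unfolding coordinate_frame_def by blast
qed

lemma coordinate_frame_repr:
  assumes W: "coordinate_frame p W"
  shows "eventually (\<lambda>q. \<sigma> q = (\<Sum>b\<in>Basis. (dfun B (snd (chart_at B (F p))) (F q) (\<sigma> q) \<bullet> b) *\<^sub>R W b
      (F q))) (nhds p)"
proof -
  let ?d = "chart_at B (F p)"
  have "eventually (\<lambda>r. \<forall>b\<in>Basis. W b r = coord_vec B ?d r b) (nhds (F p))"
    using W by (intro eventually_ball_finite) (auto simp: coordinate_frame_def)
  from eventually_F[OF this] eventually_F[OF N.eventually_dom[OF N.chart_at]] show ?thesis
  proof eventually_elim
    case (elim q)
    have "\<sigma> q = coord_vec B ?d (F q) (dfun B (snd ?d) (F q) (\<sigma> q))"
      using N.coord_vec_dfun[OF N.chart_at(1) elim(2)] by simp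
    also have "\<dots> = (\<Sum>b\<in>Basis. (dfun B (snd ?d) (F q) (\<sigma> q) \<bullet> b) *\<^sub>R coord_vec B ?d (F q) b)"
      by (rule linear_euclidean_sum[OF N.coord_vec_linear[OF N.chart_at(1) elim(2)]])
    finally show ?case using elim(1) by simp
  qed
qed

lemma coordinate_frame_expand:
  assumes W: "coordinate_frame p W" and \<sigma>: "smooth_along A B F \<sigma>"
  obtains h where "\<And>b. b \<in> Basis \<Longrightarrow> smooth_fun A (h b)"
    "\<And>b. b \<in> Basis \<Longrightarrow> eventually (\<lambda>q. h b q = dfun B (snd (chart_at B (F p))) (F q) (\<sigma> q) \<bullet> b)
        (nhds p)"
    "eventually (\<lambda>q. \<sigma> q = (\<Sum>b\<in>Basis. h b q *\<^sub>R W b (F q))) (nhds p)"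
proof -
  let ?s = "\<lambda>b q. dfun B (snd (chart_at B (F p))) (F q) (\<sigma> q) \<bullet> b"
  have "\<forall>b. \<exists>h. smooth_fun A h \<and> eventually (\<lambda>q. h q = ?s b q) (nhds p)"
  proof
    fix b
    have "fun_smooth_at A (?s b) p"
      using \<sigma> by (intro M.fun_smooth_at_inner M.fun_smooth_at_const)
        (simp add: smooth_along_iff along_smooth_at_chart[OF N.chart_at])
    then obtain h where "smooth_fun A h" "eventually (\<lambda>q. h q = ?s b q) (nhds p)"
      by (rule M.extend_fun)
    then show "\<exists>h. smooth_fun A h \<and> eventually (\<lambda>q. h q = ?s b q) (nhds p)" by blast
  qed
  then obtain h where h: "\<forall>b. smooth_fun A (h b) \<and> eventually (\<lambda>q. h b q = ?s b q) (nhds p)"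
    by metis
  have "eventually (\<lambda>q. \<forall>b\<in>Basis. h b q = ?s b q) (nhds p)"
    using h by (intro eventually_ball_finite) auto
  with coordinate_frame_repr[OF W] have "eventually (\<lambda>q. \<sigma> q = (\<Sum>b\<in>Basis. h b q *\<^sub>R W b (F q)))
      (nhds p)"
    by eventually_elim simp
  then show ?thesis by (intro that[of h]) (use h in auto)
qed

subsection \<open>Compatibility of the pullback connection with the metric\<close>

definition metric_at :: "('m \<Rightarrow> 'e) \<Rightarrow> 'm \<Rightarrow> ('m \<Rightarrow> 'f) \<Rightarrow> ('m \<Rightarrow> 'f) \<Rightarrow> bool" where
  "metric_at X p \<sigma> \<tau> \<longleftrightarrow>
    dfun A (\<lambda>q. gN (F q) (\<sigma> q) (\<tau> q)) p (X p) =
      gN (F p) (nablaF X \<sigma> p) (\<tau> p) + gN (F p) (\<sigma> p) (nablaF X \<tau> p)"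

lemma metric_at_sym: "metric_at X p \<sigma> \<tau> \<Longrightarrow> metric_at X p \<tau> \<sigma>"
proof -
  assume m: "metric_at X p \<sigma> \<tau>"
  have "(\<lambda>q. gN (F q) (\<tau> q) (\<sigma> q)) = (\<lambda>q. gN (F q) (\<sigma> q) (\<tau> q))" by (rule ext) (rule N.g_sym)
  then show ?thesis
    using m N.g_sym[of "F p" "nablaF X \<tau> p" "\<sigma> p"] N.g_sym[of "F p" "\<tau> p" "nablaF X \<sigma> p"]
    unfolding metric_at_def by simp
qed

lemma smooth_along_at: "smooth_along A B F \<sigma> \<Longrightarrow> along_smooth_at \<sigma> p"
  by (simp add: smooth_along_iff)

lemma smooth_field_at: "smooth_field A X \<Longrightarrow> field_smooth_at A X p"
  by (simp add: M.smooth_field_iff)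

lemma smooth_fun_at: "smooth_fun A f \<Longrightarrow> fun_smooth_at A f p"
  by (simp add: M.smooth_fun_iff)

text \<open>The defect of metric compatibility is linear over functions in \<open>\<sigma>\<close>: the derivatives of the
  coefficients cancel.\<close>

lemma metric_at_expansion:
  assumes X: "smooth_field A X" and sm: "smooth_along A B F \<sigma>" "smooth_along A B F \<tau>"
    and I: "finite I" and h: "\<And>i. i \<in> I \<Longrightarrow> smooth_fun A (h i)"
    and \<rho>: "\<And>i. i \<in> I \<Longrightarrow> smooth_along A B F (\<rho> i)"
    and ev: "eventually (\<lambda>q. \<sigma> q = (\<Sum>i\<in>I. h i q *\<^sub>R \<rho> i q)) (nhds p)"
    and m: "\<And>i. i \<in> I \<Longrightarrow> metric_at X p (\<rho> i) \<tau>"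
  shows "metric_at X p \<sigma> \<tau>"
proof -
  have sp: "\<sigma> p = (\<Sum>i\<in>I. h i p *\<^sub>R \<rho> i p)" using eventually_nhds_x_imp_x[OF ev] .
  have "nablaF X \<sigma> p = nablaF X (\<lambda>q. \<Sum>i\<in>I. h i q *\<^sub>R \<rho> i q) p"
    by (intro nablaF_cong X sm smooth_along_sum smooth_along_scaleR h \<rho> ev)
  also have "\<dots> = (\<Sum>i\<in>I. nablaF X (\<lambda>q. h i q *\<^sub>R \<rho> i q) p)"
    by (intro nablaF_sum X I smooth_along_scaleR h \<rho>)
  also have "\<dots> = (\<Sum>i\<in>I. dfun A (h i) p (X p) *\<^sub>R \<rho> i p + h i p *\<^sub>R nablaF X (\<rho> i) p)"
    by (intro sum.cong refl) (simp add: nablaF_scaleR[OF h X \<rho>])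
  finally have n: "nablaF X \<sigma> p = \<dots>" .
  have "eventually (\<lambda>q. gN (F q) (\<sigma> q) (\<tau> q) = (\<Sum>i\<in>I. h i q * gN (F q) (\<rho> i q) (\<tau> q))) (nhds p)"
    using ev by (rule eventually_mono) (simp add: N.g_sum_left N.g_scaleR_left)
  then have "dfun A (\<lambda>q. gN (F q) (\<sigma> q) (\<tau> q)) p (X p) =
      dfun A (\<lambda>q. \<Sum>i\<in>I. h i q * gN (F q) (\<rho> i q) (\<tau> q)) p (X p)"
    by (rule fun_cong[OF M.dfun_cong])
  also have "\<dots> = (\<Sum>i\<in>I. dfun A (\<lambda>q. h i q * gN (F q) (\<rho> i q) (\<tau> q)) p (X p))"
    by (intro M.dfun_sum M.fun_smooth_at_mult fun_smooth_at_metric_along smooth_along_at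
      smooth_fun_at h \<rho> sm)
  also have "\<dots> = (\<Sum>i\<in>I. h i p * (gN (F p) (nablaF X (\<rho> i) p) (\<tau> p) +
      gN (F p) (\<rho> i p) (nablaF X \<tau> p)) +
      dfun A (h i) p (X p) * gN (F p) (\<rho> i p) (\<tau> p))"
  proof (rule sum.cong[OF refl])
    fix i assume i: "i \<in> I"
    have "fun_smooth_at A (\<lambda>q. gN (F q) (\<rho> i q) (\<tau> q)) p"
      by (intro fun_smooth_at_metric_along smooth_along_at \<rho> sm i)
    from M.dfun_mult[OF smooth_fun_at[OF h[OF i]] this] m[OF i]
    show "dfun A (\<lambda>q. h i q * gN (F q) (\<rho> i q) (\<tau> q)) p (X p) =
      h i p * (gN (F p) (nablaF X (\<rho> i) p) (\<tau> p) + gN (F p) (\<rho> i p) (nablaF X \<tau> p)) +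
      dfun A (h i) p (X p) * gN (F p) (\<rho> i p) (\<tau> p)"
      by (simp add: metric_at_def)
  qed
  also have "\<dots> = gN (F p) (nablaF X \<sigma> p) (\<tau> p) + gN (F p) (\<sigma> p) (nablaF X \<tau> p)"
    unfolding n sp N.g_sum_left sum.distrib[symmetric]
    by (intro sum.cong refl) (simp add: N.g_simps algebra_simps)
  finally show ?thesis unfolding metric_at_def .
qed

text \<open>On pairs of frame fields this is the metric axiom on \<open>N\<close>; it extends to general fields in
  one argument after the other.\<close>

lemma metric_F:
  assumes X: "smooth_field A X" and \<sigma>: "smooth_along A B F \<sigma>" and \<tau>: "smooth_along A B F \<tau>"
  shows "dfun A (\<lambda>q. gN (F q) (\<sigma> q) (\<tau> q)) p (X p) =
      gN (F p) (nablaF X \<sigma> p) (\<tau> p) + gN (F p) (\<sigma> p) (nablaF X \<tau> p)"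
proof -
  obtain W where W: "coordinate_frame p W" by (rule coordinate_frame_exists)
  have Ws: "smooth_field B (W b)" if "b \<in> Basis" for b using W that
    by (simp add: coordinate_frame_def)
  note Wa = smooth_along_pullback[OF Ws]
  obtain Y where Y: "smooth_field B Y" "Y (F p) = dF p (X p)" by (rule N.extend_vector)
  have base: "metric_at X p (\<lambda>q. W b (F q)) (\<lambda>q. W c (F q))" if bc: "b \<in> Basis" "c \<in> Basis" for b c
  proof -
    have "fun_smooth_at B (\<lambda>r. gN r (W b r) (W c r)) (F p)"
      using Ws bc by (intro N.fun_smooth_at_metric) (simp_all add: N.smooth_field_iff)
    from dfun_pullback[OF this, of "X p"] metric_N[OF Y(1) Ws[OF bc(1)] Ws[OF bc(2)], of "F p"]
    show ?thesis unfolding metric_at_def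
      using nablaF_pullback[OF X Y(1) Ws[OF bc(1)] Y(2)]
        nablaF_pullback[OF X Y(1) Ws[OF bc(2)] Y(2)] Y(2) by simp
  qed
  have step: "metric_at X p \<rho> (\<lambda>q. W c (F q))" if \<rho>: "smooth_along A B F \<rho>" and c: "c \<in> Basis" for \<rho>
    c
  proof -
    obtain h where h: "\<And>b. b \<in> Basis \<Longrightarrow> smooth_fun A (h b)"
      "\<And>b. b \<in> Basis \<Longrightarrow> eventually (\<lambda>q. h b q = dfun B (snd (chart_at B (F p))) (F q) (\<rho> q) \<bullet> b)
          (nhds p)"
      "eventually (\<lambda>q. \<rho> q = (\<Sum>b\<in>Basis. h b q *\<^sub>R W b (F q))) (nhds p)"
      using coordinate_frame_expand[OF W \<rho>] by blast
    show ?thesis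
      by (rule metric_at_expansion[OF X \<rho> Wa[OF c] finite_Basis h(1) Wa h(3) base]) (use c in auto)
  qed
  obtain h where h: "\<And>b. b \<in> Basis \<Longrightarrow> smooth_fun A (h b)"
    "\<And>b. b \<in> Basis \<Longrightarrow> eventually (\<lambda>q. h b q = dfun B (snd (chart_at B (F p))) (F q) (\<sigma> q) \<bullet> b)
        (nhds p)"
    "eventually (\<lambda>q. \<sigma> q = (\<Sum>b\<in>Basis. h b q *\<^sub>R W b (F q))) (nhds p)"
    using coordinate_frame_expand[OF W \<sigma>] by blast
  have "metric_at X p \<sigma> \<tau>"
    by (rule metric_at_expansion[OF X \<sigma> \<tau> finite_Basis h(1) Wa h(3) metric_at_sym[OF step[OF \<tau>]]])
      auto
  then show ?thesis unfolding metric_at_def .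
qed

subsection \<open>The pullback connection is torsion free on the image of the tangent map\<close>

text \<open>The coordinate formula: second derivatives of the components of \<open>F\<close> plus Christoffel terms
  of \<open>N\<close>.\<close>

lemma nablaF_dF:
  assumes W: "coordinate_frame p W" and X: "smooth_field A X" and Y: "smooth_field A Y"
  defines "f \<equiv> \<lambda>b q. snd (chart_at B (F p)) (F q) \<bullet> b"
  shows "nablaF X (\<lambda>q. dF q (Y q)) p =
    (\<Sum>b\<in>Basis. dfun A (\<lambda>q. dfun A (f b) q (Y q)) p (X p) *\<^sub>R W b (F p)) +
    (\<Sum>b\<in>Basis. \<Sum>c\<in>Basis. (dfun A (f b) p (Y p) * dfun A (f c) p (X p)) *\<^sub>R nablaN (W c) (W b)
      (F p))"
proof -
  let ?d = "chart_at B (F p)"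
  have Ws: "smooth_field B (W b)" if "b \<in> Basis" for b using W that
    by (simp add: coordinate_frame_def)
  have Wp: "W b (F p) = coord_vec B ?d (F p) b" if "b \<in> Basis" for b
    using W that eventually_nhds_x_imp_x by (auto simp: coordinate_frame_def)
  have fs: "fun_smooth_at A (f b) p" for b
    unfolding f_def by (intro M.fun_smooth_at_inner M.fun_smooth_at_const fun_smooth_at_chart_F
      N.chart_at)
  have df: "eventually (\<lambda>q. \<forall>v. dfun B (snd ?d) (F q) (dF q v) \<bullet> b = dfun A (f b) q v) (nhds p)"
    for b
    using eventually_F[OF N.eventually_dom[OF N.chart_at]]
  proof (rule eventually_mono)
    fix q assume q: "F q \<in> fst ?d"
    show "\<forall>v. dfun B (snd ?d) (F q) (dF q v) \<bullet> b = dfun A (f b) q v"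
      unfolding f_def dfun_pullback[OF N.fun_smooth_at_chart_map[OF N.chart_at(1) q], symmetric]
      using M.dfun_inner_left[OF fun_smooth_at_chart_F[OF N.chart_at(1) q]] by simp
  qed
  obtain h where h: "\<And>b. b \<in> Basis \<Longrightarrow> smooth_fun A (h b)"
    "\<And>b. b \<in> Basis \<Longrightarrow> eventually (\<lambda>q. h b q = dfun B (snd ?d) (F q) (dF q (Y q)) \<bullet> b) (nhds p)"
    "eventually (\<lambda>q. dF q (Y q) = (\<Sum>b\<in>Basis. h b q *\<^sub>R W b (F q))) (nhds p)"
    using coordinate_frame_expand[OF W smooth_along_dF[OF Y]] by blast
  have hf: "eventually (\<lambda>q. h b q = dfun A (f b) q (Y q)) (nhds p)" if "b \<in> Basis" for b
    using h(2)[OF that] df[of b] by eventually_elim simp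
  \<comment> \<open>A field on \<open>N\<close> with the value \<open>F\<^sub>* X\<close> at \<open>F p\<close>, with constant coefficients in the frame.\<close>
  define V where "V r = (\<Sum>c\<in>Basis. dfun A (f c) p (X p) *\<^sub>R W c r)" for r
  have V: "smooth_field B V" unfolding V_def N.smooth_field_iff
    using Ws by (intro allI N.field_smooth_at_sum N.field_smooth_at_scaleR N.fun_smooth_at_const)
      (simp add: N.smooth_field_iff)
  have VF: "V (F p) = dF p (X p)"
    using eventually_nhds_x_imp_x[OF coordinate_frame_repr[OF W, of "\<lambda>q. dF q (X q)"]]
      eventually_nhds_x_imp_x[OF df] by (simp add: V_def)
  have "nablaF X (\<lambda>q. dF q (Y q)) p = nablaF X (\<lambda>q. \<Sum>b\<in>Basis. h b q *\<^sub>R W b (F q)) p"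
    by (intro nablaF_cong X smooth_along_dF Y smooth_along_sum smooth_along_scaleR h
      smooth_along_pullback Ws)
  also have "\<dots> = (\<Sum>b\<in>Basis. nablaF X (\<lambda>q. h b q *\<^sub>R W b (F q)) p)"
    by (intro nablaF_sum X finite_Basis smooth_along_scaleR h smooth_along_pullback Ws)
  also have "\<dots> = (\<Sum>b\<in>Basis. dfun A (\<lambda>q. dfun A (f b) q (Y q)) p (X p) *\<^sub>R W b (F p) +
      (\<Sum>c\<in>Basis. (dfun A (f b) p (Y p) * dfun A (f c) p (X p)) *\<^sub>R nablaN (W c) (W b) (F p)))"
  proof (rule sum.cong[OF refl])
    fix b :: 'f assume b: "b \<in> Basis"
    have "nablaF X (\<lambda>q. h b q *\<^sub>R W b (F q)) p =
      dfun A (h b) p (X p) *\<^sub>R W b (F p) + h b p *\<^sub>R nablaN V (W b) (F p)"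
      using nablaF_scaleR[OF h(1)[OF b] X smooth_along_pullback[OF Ws[OF b]]]
        nablaF_pullback[OF X V Ws[OF b] VF] by simp
    moreover have "h b p = dfun A (f b) p (Y p)" using eventually_nhds_x_imp_x[OF hf[OF b]] .
    moreover have "dfun A (h b) p (X p) = dfun A (\<lambda>q. dfun A (f b) q (Y q)) p (X p)"
      using M.dfun_cong[OF hf[OF b]] by simp
    moreover have "nablaN V (W b) (F p) =
        (\<Sum>c\<in>Basis. dfun A (f c) p (X p) *\<^sub>R nablaN (W c) (W b) (F p))"
      unfolding V_def
      using N.affine_connection_sum_left[OF connection_N finite_Basis, of W "W b"
        "\<lambda>c. dfun A (f c) p (X p)"] Ws b
      by simp
    ultimately show "nablaF X (\<lambda>q. h b q *\<^sub>R W b (F q)) p =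
      dfun A (\<lambda>q. dfun A (f b) q (Y q)) p (X p) *\<^sub>R W b (F p) +
      (\<Sum>c\<in>Basis. (dfun A (f b) p (Y p) * dfun A (f c) p (X p)) *\<^sub>R nablaN (W c) (W b) (F p))"
      by (simp add: scaleR_sum_right)
  qed
  finally show ?thesis by (simp add: sum.distrib)
qed

text \<open>In the coordinate formula the Christoffel terms are symmetric in \<open>X\<close> and \<open>Y\<close>, since
  coordinate fields commute and the connection on \<open>N\<close> has no torsion; the second derivatives
  leave the bracket.\<close>

lemma torsion_F:
  assumes X: "smooth_field A X" and Y: "smooth_field A Y"
  shows "nablaF X (\<lambda>q. dF q (Y q)) p - nablaF Y (\<lambda>q. dF q (X q)) p = dF p (lie_bracket A X Y p)"
proof -
  let ?d = "chart_at B (F p)"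
  obtain W where W: "coordinate_frame p W" by (rule coordinate_frame_exists)
  have Ws: "smooth_field B (W b)" if "b \<in> Basis" for b using W that
    by (simp add: coordinate_frame_def)
  define f where "f = (\<lambda>b q. snd ?d (F q) \<bullet> b)"
  have fs: "fun_smooth_at A (f b) p" for b
    unfolding f_def by (intro M.fun_smooth_at_inner M.fun_smooth_at_const fun_smooth_at_chart_F
      N.chart_at)
  have sym: "nablaN (W c) (W b) (F p) = nablaN (W b) (W c) (F p)" if "b \<in> Basis" "c \<in> Basis" for b c
  proof -
    have "lie_bracket B (W c) (W b) (F p) = 0"
      by (rule N.lie_bracket_coordinate_fields[OF refl])
        (use W that in \<open>auto simp: coordinate_frame_def\<close>)
    then show ?thesis using torsion_N[OF Ws Ws, of c b "F p"] that by simp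
  qed
  define S where "S X Y = (\<Sum>b\<in>Basis. \<Sum>c\<in>Basis. (dfun A (f b) p (Y p) * dfun A (f c) p (X p)) *\<^sub>R
      nablaN (W c) (W b) (F p))" for X Y
  have "S X Y = S Y X"
    unfolding S_def by (subst sum.swap) (intro sum.cong refl, simp add: sym mult.commute)
  then have "nablaF X (\<lambda>q. dF q (Y q)) p - nablaF Y (\<lambda>q. dF q (X q)) p =
     (\<Sum>b\<in>Basis. dfun A (\<lambda>q. dfun A (f b) q (Y q)) p (X p) *\<^sub>R W b (F p)) -
     (\<Sum>b\<in>Basis. dfun A (\<lambda>q. dfun A (f b) q (X q)) p (Y p) *\<^sub>R W b (F p))"
    using nablaF_dF[OF W X Y] nablaF_dF[OF W Y X] by (simp add: S_def f_def)
  also have "\<dots> = (\<Sum>b\<in>Basis. dfun A (f b) p (lie_bracket A X Y p) *\<^sub>R W b (F p))"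
    unfolding M.dfun_lie_bracket[OF fs smooth_field_at[OF X] smooth_field_at[OF Y]]
    by (simp add: sum_subtractf scaleR_diff_left)
  also have "\<dots> = (\<Sum>b\<in>Basis. (dfun B (snd ?d) (F p) (dF p (lie_bracket A X Y p)) \<bullet> b) *\<^sub>R W b (F p))"
    unfolding f_def M.dfun_inner_left[OF fun_smooth_at_chart_F[OF N.chart_at]]
    using dfun_pullback[OF N.fun_smooth_at_chart_map[OF N.chart_at]] by simp
  also have "\<dots> = dF p (lie_bracket A X Y p)"
    using eventually_nhds_x_imp_x[OF
      coordinate_frame_repr[OF W, of "\<lambda>q. dF q (lie_bracket A X Y q)"]] by simp
  finally show ?thesis .
qed

subsection \<open>The second fundamental form of a horizontally conformal submersion\<close>

definition lnlam :: "'m \<Rightarrow> real" where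
  "lnlam p = ln (lam p)"

lemma lnlam_smooth: "fun_smooth_at A lnlam p"
  unfolding lnlam_def by (intro M.fun_smooth_at_ln lam_smooth lam_pos)

lemma dfun_lam_sq: "dfun A (\<lambda>q. (lam q)\<^sup>2) p v = 2 * (lam p)\<^sup>2 * dfun A lnlam p v"
proof -
  have "fderiv ln (lam p) = (\<lambda>h. h * inverse (lam p))"
    by (rule frechet_derivative_eqI)
      (use lam_pos[of p] in \<open>auto intro!: derivative_eq_intros simp: divide_inverse\<close>)
  then have "dfun A lnlam p v = dfun A lam p v * inverse (lam p)"
    unfolding lnlam_def using M.dfun_compose[OF smooth_at_ln_real[OF lam_pos] lam_smooth] by simp
  then show ?thesis
    unfolding power2_eq_square M.dfun_mult[OF lam_smooth lam_smooth]
    using lam_pos[of p] by (simp add: field_simps)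
qed

text \<open>Koszul's formula holds for \<open>\<nabla>\<close> on \<open>M\<close> and for \<open>\<nabla>\<^sup>F\<close> on the fields \<open>F\<^sub>* X\<close>. By conformality
  the two differ by the factor \<open>\<lambda>\<^sup>2\<close> and by its derivatives along \<open>X\<close>, \<open>Y\<close> and \<open>Z\<close>.\<close>

lemma second_fundamental_form:
  assumes X: "X \<in> sections A horizontal" and Y: "Y \<in> sections A horizontal"
    and Z: "Z \<in> sections A horizontal"
  shows "1 / (lam p)\<^sup>2 * gN (F p) (nablaF X (\<lambda>q. dF q (Y q)) p) (dF p (Z p)) =
    gM p (nablaM X Y p) (Z p) + dfun A lnlam p (X p) * gM p (Y p) (Z p) +
    dfun A lnlam p (Y p) * gM p (X p) (Z p) - dfun A lnlam p (Z p) * gM p (X p) (Y p)"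
proof -
  have s: "smooth_field A X" "smooth_field A Y" "smooth_field A Z"
    and h: "\<And>q. X q \<in> horizontal q" "\<And>q. Y q \<in> horizontal q" "\<And>q. Z q \<in> horizontal q"
    using X Y Z by (auto simp: sections_def)
  define a where "a X Y Z = gN (F p) (nablaF X (\<lambda>q. dF q (Y q)) p) (dF p (Z p))" for X Y Z
  define m where "m X Y Z = gM p (nablaM X Y p) (Z p)" for X Y Z
  define l where "l X = dfun A lnlam p (X p)" for X
  have met: "a X Y Z + a X Z Y = (lam p)\<^sup>2 * (m X Y Z + m X Z Y) + 2 * (lam p)\<^sup>2 * l X * gM p (Y p)
      (Z p)"
    if X: "smooth_field A X" and Y: "smooth_field A Y" "\<And>q. Y q \<in> horizontal q"
      and Z: "smooth_field A Z" "\<And>q. Z q \<in> horizontal q" for X Y Z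
  proof -
    have "(\<lambda>q. gN (F q) (dF q (Y q)) (dF q (Z q))) = (\<lambda>q. (lam q)\<^sup>2 * gM q (Y q) (Z q))"
      using conformal_metric Y Z by simp
    moreover have "dfun A (\<lambda>q. (lam q)\<^sup>2 * gM q (Y q) (Z q)) p (X p) =
      (lam p)\<^sup>2 * dfun A (\<lambda>q. gM q (Y q) (Z q)) p (X p) + dfun A (\<lambda>q. (lam q)\<^sup>2) p (X p) * gM p
        (Y p) (Z p)"
      unfolding power2_eq_square
      by (intro M.dfun_mult M.fun_smooth_at_mult lam_smooth M.fun_smooth_at_metric smooth_field_at Y
        Z)
    ultimately show ?thesis
      using metric_F[OF X smooth_along_dF[OF Y(1)] smooth_along_dF[OF Z(1)], of p]
        metric_M[OF X Y(1) Z(1), of p]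
      unfolding a_def m_def l_def dfun_lam_sq
      by (simp add: N.g_sym[of _ "dF p (Y p)"] M.g_sym[of _ "Y p" "nablaM X Z p"])
  qed
  \<comment> \<open>Only the horizontal part of the bracket survives the tangent map, and conformality applies
    to it.\<close>
  have tor: "a X Y Z - a Y X Z = (lam p)\<^sup>2 * (m X Y Z - m Y X Z)"
    if X: "smooth_field A X" and Y: "smooth_field A Y" and Z: "\<And>q. Z q \<in> horizontal q" for X Y Z
  proof -
    have "a X Y Z - a Y X Z = gN (F p) (dF p (lie_bracket A X Y p)) (dF p (Z p))"
      unfolding a_def using torsion_F[OF X Y, of p] by (simp add: N.g_diff_left[symmetric])
    also have "\<dots> = (lam p)\<^sup>2 * gM p (hor p (lie_bracket A X Y p)) (Z p)"
      using conformal_metric[OF hor_in[of p "lie_bracket A X Y p"] Z] by (simp add: dF_hor)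
    also have "gM p (hor p (lie_bracket A X Y p)) (Z p) = m X Y Z - m Y X Z"
      unfolding hor_inner[OF Z] m_def using torsion_M[OF X Y, of p]
        by (simp add: M.g_diff_left[symmetric])
    finally show ?thesis .
  qed
  have "2 * a X Y Z = 2 * (lam p)\<^sup>2 * (m X Y Z + l X * gM p (Y p) (Z p) + l Y * gM p (X p) (Z p) -
      l Z * gM p (X p) (Y p))"
    using met[OF s(1) s(2) h(2) s(3) h(3)] met[OF s(2) s(1) h(1) s(3) h(3)]
      met[OF s(3) s(1) h(1) s(2) h(2)]
      tor[OF s(1) s(2) h(3)] tor[OF s(1) s(3) h(2)] tor[OF s(2) s(3) h(1)]
    by (simp add: algebra_simps)
  then show ?thesis using lam_pos[of p] by (simp add: a_def m_def l_def)
qed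

end

section \<open>Total differential equations\<close>

lemma norm_linear_le:
  fixes f :: "'a::euclidean_space \<Rightarrow> 'b::real_normed_vector"
  assumes f: "linear f" and k: "\<And>b. b \<in> Basis \<Longrightarrow> norm (f b) \<le> k b"
  shows "norm (f u) \<le> (\<Sum>b\<in>Basis. k b) * norm u"
proof -
  have "norm (f u) = norm (\<Sum>b\<in>Basis. (u \<bullet> b) *\<^sub>R f b)" using linear_euclidean_sum[OF f] by metis
  also have "\<dots> \<le> (\<Sum>b\<in>Basis. norm u * k b)"
  proof (rule sum_norm_le)
    fix b :: 'a assume b: "b \<in> Basis"
    have "\<bar>u \<bullet> b\<bar> * norm (f b) \<le> norm u * k b"
      using k[OF b] Basis_le_norm[OF b] by (intro mult_mono) auto
    then show "norm ((u \<bullet> b) *\<^sub>R f b) \<le> norm u * k b" by simp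
  qed
  also have "\<dots> = (\<Sum>b\<in>Basis. k b) * norm u" by (simp add: sum_distrib_left mult.commute)
  finally show ?thesis .
qed

lemma vector_mean_value_bound:
  fixes f :: "real \<Rightarrow> 'a::real_normed_vector"
  assumes "\<And>t. t \<in> {0..1} \<Longrightarrow> (f has_vector_derivative f' t) (at t within {0..1})"
    and "\<And>t. t \<in> {0..1} \<Longrightarrow> norm (f' t) \<le> C" and "s \<in> {0..1}"
  shows "norm (f s - f 0) \<le> C"
proof -
  have "norm (f s - f 0) \<le> C * norm (s - 0)"
  proof (rule differentiable_bound[where S = "{0..1}" and f' = "\<lambda>t h. h *\<^sub>R f' t"])
    show "(f has_derivative (\<lambda>h. h *\<^sub>R f' t)) (at t within {0..1})" if "t \<in> {0..1}" for t
      using assms(1)[OF that] by (simp add: has_vector_derivative_def)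
    show "onorm (\<lambda>h. h *\<^sub>R f' t) \<le> C" if "t \<in> {0..1}" for t
      using assms(2)[OF that]
        by (intro onorm_le) (auto simp: mult.commute[of C] intro: mult_left_mono)
  qed (use assms(3) in auto)
  moreover have "0 \<le> C" using order_trans[OF norm_ge_zero assms(2)[of 0]] by simp
  then have "C * norm (s - 0) \<le> C * 1" using assms(3) by (intro mult_left_mono) auto
  ultimately show ?thesis by simp
qed

lemma smooth_derivative_bounded:
  fixes f :: "'a::euclidean_space \<Rightarrow> 'b::euclidean_space"
  assumes sm: "\<And>y. y \<in> cball a \<rho> \<Longrightarrow> smooth_at f y"
  shows "\<exists>K\<ge>0. \<forall>y\<in>cball a \<rho>. \<forall>h. norm (fderiv f y h) \<le> K * norm h"
proof -
  have "\<exists>k. \<forall>y\<in>cball a \<rho>. norm (fderiv f y b) \<le> k" for b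
  proof -
    have "continuous_on (cball a \<rho>) (\<lambda>y. fderiv f y b)"
      using smooth_at_isCont[OF smooth_at_derivative[OF sm]]
        by (intro continuous_at_imp_continuous_on) auto
    from compact_continuous_image[OF this compact_cball]
    have "bounded ((\<lambda>y. fderiv f y b) ` cball a \<rho>)" by (rule compact_imp_bounded)
    then show ?thesis by (auto simp: bounded_iff)
  qed
  then obtain k where k: "\<And>b y. y \<in> cball a \<rho> \<Longrightarrow> norm (fderiv f y b) \<le> k b" by metis
  show ?thesis
  proof (intro exI[of _ "\<bar>\<Sum>b\<in>Basis. k b\<bar>"] conjI ballI allI)
    fix y h assume y: "y \<in> cball a \<rho>"
    have "norm (fderiv f y h) \<le> (\<Sum>b\<in>Basis. k b) * norm h"
      by (rule norm_linear_le[OF smooth_at_linear[OF sm[OF y]] k[OF y]])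
    also have "\<dots> \<le> \<bar>\<Sum>b\<in>Basis. k b\<bar> * norm h" by (intro mult_right_mono) auto
    finally show "norm (fderiv f y h) \<le> \<bar>\<Sum>b\<in>Basis. k b\<bar> * norm h" .
  qed auto
qed

lemma smooth_lipschitz:
  fixes f :: "'a::euclidean_space \<Rightarrow> 'b::euclidean_space"
  assumes sm: "\<And>y. y \<in> cball a \<rho> \<Longrightarrow> smooth_at f y"
  shows "\<exists>K\<ge>0. \<forall>y\<in>cball a \<rho>. \<forall>z\<in>cball a \<rho>. norm (f y - f z) \<le> K * norm (y - z)"
proof -
  obtain K where K: "K \<ge> 0" "\<And>y h. y \<in> cball a \<rho> \<Longrightarrow> norm (fderiv f y h) \<le> K * norm h"
    using smooth_derivative_bounded[of a \<rho> f] sm by blast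
  show ?thesis
  proof (intro exI[of _ K] conjI ballI)
    fix y z assume "y \<in> cball a \<rho>" "z \<in> cball a \<rho>"
    then show "norm (f y - f z) \<le> K * norm (y - z)"
      by (intro differentiable_bound[where S = "cball a \<rho>" and f' = "\<lambda>y. fderiv f y"])
         (auto intro!: has_derivative_at_withinI smooth_at_has_derivative sm onorm_le K)
  qed (rule K)
qed

text \<open>The remainder is bounded by the mean value inequality for \<open>f\<close> minus its linearization at
  \<open>y\<close>, since the derivative of \<open>f\<close> is Lipschitz.\<close>

lemma smooth_taylor:
  fixes f :: "'a::euclidean_space \<Rightarrow> 'b::euclidean_space"
  assumes sm: "\<And>y. y \<in> cball a \<rho> \<Longrightarrow> smooth_at f y"
  shows "\<exists>Q\<ge>0. \<forall>y\<in>cball a \<rho>. \<forall>z\<in>cball a \<rho>.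
    norm (f z - f y - fderiv f y (z - y)) \<le> Q * (norm (z - y))\<^sup>2"
proof -
  have "\<exists>k\<ge>0. \<forall>y\<in>cball a \<rho>. \<forall>z\<in>cball a \<rho>.
      norm (fderiv f y b - fderiv f z b) \<le> k * norm (y - z)" for b
    by (rule smooth_lipschitz) (intro smooth_at_derivative sm)
  then obtain k where k: "\<And>b. k b \<ge> 0" "\<And>b y z. y \<in> cball a \<rho> \<Longrightarrow> z \<in> cball a \<rho> \<Longrightarrow>
      norm (fderiv f y b - fderiv f z b) \<le> k b * norm (y - z)" by metis
  define Q where "Q = (\<Sum>b\<in>Basis. k b)"
  have Q: "Q \<ge> 0" unfolding Q_def using k(1) by (intro sum_nonneg)
  show ?thesis
  proof (intro exI[of _ Q] conjI ballI Q)
    fix y z assume yz: "y \<in> cball a \<rho>" "z \<in> cball a \<rho>"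
    have seg: "closed_segment y z \<subseteq> cball a \<rho>" using yz
      by (intro closed_segment_subset convex_cball)
    note ly = smooth_at_linear[OF sm[OF yz(1)]]
    define g where "g x = f x - fderiv f y x" for x
    have bl: "bounded_linear (fderiv f y)" using ly by (simp add: linear_conv_bounded_linear)
    have "norm (g z - g y) \<le> (Q * norm (z - y)) * norm (z - y)"
    proof (rule differentiable_bound[where S = "closed_segment y z" and f' =
      "\<lambda>x h. fderiv f x h - fderiv f y h"])
      fix x assume x: "x \<in> closed_segment y z"
      then have xa: "x \<in> cball a \<rho>" using seg by auto
      show "(g has_derivative (\<lambda>h. fderiv f x h - fderiv f y h)) (at x within closed_segment y z)"
        unfolding g_def
        by (rule has_derivative_diff[OF
          has_derivative_at_withinI[OF smooth_at_has_derivative[OF sm[OF xa]]]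
              bounded_linear_imp_has_derivative[OF bl]])
      show "onorm (\<lambda>h. fderiv f x h - fderiv f y h) \<le> Q * norm (z - y)"
      proof (rule onorm_le)
        fix h
        have "norm (fderiv f x h - fderiv f y h) \<le> (\<Sum>b\<in>Basis. k b * norm (x - y)) * norm h"
          by (rule norm_linear_le[OF linear_compose_sub[OF smooth_at_linear[OF sm[OF xa]] ly]])
            (rule k(2)[OF xa yz(1)])
        also have "\<dots> = Q * norm (x - y) * norm h" by (simp add: Q_def sum_distrib_right)
        also have "\<dots> \<le> Q * norm (z - y) * norm h"
          using segment_bound1[OF x] Q by (intro mult_right_mono mult_left_mono) auto
        finally show "norm (fderiv f x h - fderiv f y h) \<le> Q * norm (z - y) * norm h" .
      qed
    qed auto
    then show "norm (f z - f y - fderiv f y (z - y)) \<le> Q * (norm (z - y))\<^sup>2"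
      by (simp add: g_def linear_diff[OF ly] power2_eq_square algebra_simps)
  qed
qed

text \<open>The integral operator is a contraction of the bounded continuous curves with the constant
  \<open>k\<close>, as the time interval has length \<open>1\<close>. Curves live on the whole line, and times outside
  \<open>{0..1}\<close> are clamped by \<open>c\<close>.\<close>

lemma lipschitz_ode_solution:
  fixes G :: "'a::euclidean_space \<Rightarrow> 'a"
  assumes lip: "\<And>y z. norm (G y - G z) \<le> k * norm (y - z)" and k: "0 \<le> k" "k < 1"
  obtains \<zeta> where "\<zeta> 0 = a" "\<And>s. s \<in> {0..1} \<Longrightarrow> (\<zeta> has_vector_derivative G (\<zeta> s))
      (at s within {0..1})"
proof -
  have "k-lipschitz_on UNIV G" using lip k by (auto simp: lipschitz_on_def dist_norm)
  then have cG: "continuous_on UNIV G" by (rule lipschitz_on_continuous_on)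
  define c :: "real \<Rightarrow> real" where "c s = max 0 (min 1 s)" for s
  have c01: "c s \<in> {0..1}" for s by (auto simp: c_def)
  have c_id: "c s = s" if "s \<in> {0..1}" for s using that by (auto simp: c_def)
  define T where "T z s = a + integral {0..c s} (\<lambda>\<tau>. G (z \<tau>))" for z :: "real \<Rightarrow> 'a" and s
  have cont: "continuous_on S (\<lambda>\<tau>. G (apply_bcontfun z \<tau>))" for z :: "real \<Rightarrow>\<^sub>C 'a" and S
    by (rule continuous_on_compose2[OF cG]) auto
  have int: "(\<lambda>\<tau>. G (apply_bcontfun z \<tau>)) integrable_on {p..q}" for z :: "real \<Rightarrow>\<^sub>C 'a" and p q
    by (intro integrable_continuous_interval cont)
  have T_cont: "continuous_on UNIV (T (apply_bcontfun z))" for z :: "real \<Rightarrow>\<^sub>C 'a"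
  proof -
    have "continuous_on {0..1} (\<lambda>s. integral {0..s} (\<lambda>\<tau>. G (apply_bcontfun z \<tau>)))"
      by (rule indefinite_integral_continuous_1[OF int])
    moreover have "continuous_on UNIV c" unfolding c_def by (intro continuous_intros)
    ultimately have "continuous_on UNIV (\<lambda>s. integral {0..c s} (\<lambda>\<tau>. G (apply_bcontfun z \<tau>)))"
      by (rule continuous_on_compose2) (use c01 in auto)
    then show ?thesis unfolding T_def by (intro continuous_intros)
  qed
  have T_b: "T (apply_bcontfun z) \<in> bcontfun" for z :: "real \<Rightarrow>\<^sub>C 'a"
  proof -
    have "compact (T (apply_bcontfun z) ` {0..1})"
      by (intro compact_continuous_image continuous_on_subset[OF T_cont]) auto
    moreover have "range (T (apply_bcontfun z)) \<subseteq> T (apply_bcontfun z) ` {0..1}"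
    proof
      fix y assume "y \<in> range (T (apply_bcontfun z))"
      then obtain s where "y = T (apply_bcontfun z) s" by auto
      then have "y = T (apply_bcontfun z) (c s)" using c_id[OF c01] by (simp add: T_def)
      then show "y \<in> T (apply_bcontfun z) ` {0..1}" using c01 by blast
    qed
    ultimately have "bounded (range (T (apply_bcontfun z)))"
      using compact_imp_bounded bounded_subset by blast
    then show ?thesis using T_cont by (simp add: bcontfun_def)
  qed
  define \<Phi> where "\<Phi> z = Bcontfun (T (apply_bcontfun z))" for z
  have \<Phi>: "apply_bcontfun (\<Phi> z) = T (apply_bcontfun z)" for z
    unfolding \<Phi>_def by (rule Bcontfun_inverse[OF T_b])
  have contraction: "dist (\<Phi> z) (\<Phi> w) \<le> k * dist z w" for z w
  proof (rule dist_bound)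
    fix s
    have "dist (\<Phi> z s) (\<Phi> w s) =
        norm (integral {0..c s} (\<lambda>\<tau>. G (z \<tau>)) - integral {0..c s} (\<lambda>\<tau>. G (w \<tau>)))"
      by (simp add: \<Phi> T_def dist_norm)
    also have "\<dots> = norm (integral {0..c s} (\<lambda>\<tau>. G (z \<tau>) - G (w \<tau>)))"
      by (simp add: Henstock_Kurzweil_Integration.integral_diff[OF int int])
    also have "\<dots> \<le> (k * dist z w) * (c s - 0)"
    proof (rule integral_bound)
      show "0 \<le> c s" by (simp add: c_def)
      show "continuous_on {0..c s} (\<lambda>\<tau>. G (z \<tau>) - G (w \<tau>))" by (intro continuous_on_diff cont)
      fix \<tau>
      have "norm (G (z \<tau>) - G (w \<tau>)) \<le> k * norm (z \<tau> - w \<tau>)" by (rule lip)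
      also have "\<dots> \<le> k * dist z w" using dist_bounded[of z \<tau> w] k by (intro mult_left_mono)
        (auto simp: dist_norm)
      finally show "norm (G (z \<tau>) - G (w \<tau>)) \<le> k * dist z w" .
    qed
    also have "\<dots> \<le> (k * dist z w) * 1" using c01[of s] k by (intro mult_left_mono) auto
    finally show "dist (\<Phi> z s) (\<Phi> w s) \<le> k * dist z w" by simp
  qed
  from banach_fix_type[OF k, of \<Phi>] contraction obtain z where z: "\<Phi> z = z" by blast
  have fix_eq: "z s = a + integral {0..c s} (\<lambda>\<tau>. G (z \<tau>))" for s
    using \<Phi>[of z] z by (metis T_def)
  show ?thesis
  proof (rule that[of "apply_bcontfun z"])
    show "z 0 = a" using fix_eq[of 0] by (simp add: c_def)
    fix s :: real assume s: "s \<in> {0..1}"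
    have "((\<lambda>s. a + integral {0..s} (\<lambda>\<tau>. G (z \<tau>))) has_vector_derivative G (z s))
        (at s within {0..1})"
      using integral_has_vector_derivative[OF cont s, of z] by (auto intro!: derivative_eq_intros)
    then show "(apply_bcontfun z has_vector_derivative G (z s)) (at s within {0..1})"
      by (rule has_vector_derivative_transform[OF s, rotated]) (subst fix_eq, simp add: c_id)
  qed
qed

text \<open>Linearity in \<open>u\<close> reduces bounds for these derivatives to basis vectors.\<close>

lemma frechet_derivative_parameter_linear:
  fixes L :: "'a::euclidean_space \<Rightarrow> 'b::real_vector \<Rightarrow> 'c::euclidean_space"
  assumes lin: "eventually (\<lambda>y. linear (L y)) (nhds x)" and sm: "\<And>u. smooth_at (\<lambda>y. L y u) x"
  shows "linear (\<lambda>u. fderiv (\<lambda>y. L y u) x w)"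
proof (rule linearI)
  fix u v
  have d: "((\<lambda>y. L y u + L y v) has_derivative (\<lambda>w. fderiv (\<lambda>y. L y u) x w +
      fderiv (\<lambda>y. L y v) x w)) (at x)"
    by (intro has_derivative_add smooth_at_has_derivative sm)
  have "eventually (\<lambda>y. L y (u + v) = L y u + L y v) (nhds x)"
    using lin by (rule eventually_mono) (rule linear_add)
  from frechet_derivative_eventually_cong[OF this] show "fderiv (\<lambda>y. L y (u + v)) x w =
      fderiv (\<lambda>y. L y u) x w + fderiv (\<lambda>y. L y v) x w"
    by (simp add: frechet_derivative_eqI[OF d])
next
  fix r u
  have d: "((\<lambda>y. r *\<^sub>R L y u) has_derivative (\<lambda>w. r *\<^sub>R fderiv (\<lambda>y. L y u) x w)) (at x)"
    by (intro has_derivative_scaleR_right smooth_at_has_derivative sm)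
  have "eventually (\<lambda>y. L y (r *\<^sub>R u) = r *\<^sub>R L y u) (nhds x)"
    using lin by (rule eventually_mono) (rule linear_cmul)
  from frechet_derivative_eventually_cong[OF this] show "fderiv (\<lambda>y. L y (r *\<^sub>R u)) x w =
      r *\<^sub>R fderiv (\<lambda>y. L y u) x w"
    by (simp add: frechet_derivative_eqI[OF d])
qed

lemma smooth_at_vector_chain:
  fixes f :: "'a::euclidean_space \<Rightarrow> 'b::real_normed_vector"
  assumes "smooth_at f (z t)" "(z has_vector_derivative z') (at t within S)"
  shows "((\<lambda>t. f (z t)) has_vector_derivative fderiv f (z t) z') (at t within S)"
proof -
  have "((\<lambda>t. f (z t)) has_derivative (\<lambda>h. fderiv f (z t) (h *\<^sub>R z'))) (at t within S)"
    using has_derivative_compose[OF assms(2)[unfolded has_vector_derivative_def]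
      smooth_at_has_derivative[OF assms(1)]] .
  then show ?thesis
    by (simp add: has_vector_derivative_def linear_cmul[OF smooth_at_linear[OF assms(1)]])
qed

text \<open>The equation is solved along rays: \<open>\<eta> x = \<zeta>\<^sub>x 1\<close>, where \<open>\<zeta>\<^sub>x' = L(\<zeta>\<^sub>x) x\<close> and \<open>\<zeta>\<^sub>x 0 = a\<close>.
  To see that \<open>\<eta>\<close> has the derivative \<open>L (\<eta> x)\<close>, the solution for \<open>x + h\<close> is compared with the
  curve \<open>t \<mapsto> \<zeta>\<^sub>x t + t L(\<zeta>\<^sub>x t) h\<close>. By the compatibility condition this curve satisfies the
  equation for \<open>x + h\<close> up to an error of order \<open>|h|\<^sup>2\<close>, so it has the distance \<open>O(|h|\<^sup>2)\<close> from
  the solution.\<close>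

theorem total_differential_equation:
  fixes L :: "'e::euclidean_space \<Rightarrow> 'f::euclidean_space \<Rightarrow> 'e"
  assumes S: "open S" "a \<in> S"
    and lin: "\<And>y. y \<in> S \<Longrightarrow> linear (L y)"
    and sm: "\<And>y u. y \<in> S \<Longrightarrow> smooth_at (\<lambda>y. L y u) y"
    and integrability: "\<And>y u v. y \<in> S \<Longrightarrow>
      fderiv (\<lambda>y. L y u) y (L y v) = fderiv (\<lambda>y. L y v) y (L y u)"
  obtains r \<eta> where "r > 0" "\<eta> 0 = a" "\<And>x. x \<in> ball 0 r \<Longrightarrow> \<eta> x \<in> S"
    "\<And>x. x \<in> ball 0 r \<Longrightarrow> (\<eta> has_derivative L (\<eta> x)) (at x)"
proof -
  obtain \<rho> where \<rho>: "\<rho> > 0" "cball a \<rho> \<subseteq> S" using S open_contains_cball by blast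
  let ?D = "cball a \<rho>"
  define DL where "DL y w u = fderiv (\<lambda>y. L y u) y w" for y w u
  have smD: "smooth_at (\<lambda>y. L y u) y" if "y \<in> ?D" for y u using sm \<rho> that by auto
  have linD: "linear (L y)" if "y \<in> ?D" for y using lin \<rho> that by auto
  have DL_lin: "linear (DL y w)" if "y \<in> ?D" for y w
    unfolding DL_def
  proof (rule frechet_derivative_parameter_linear)
    show "eventually (\<lambda>y. linear (L y)) (nhds y)"
      using S(1) that \<rho>(2) lin unfolding eventually_nhds by (intro exI[of _ S]) auto
  qed (use smD that in auto)
  have "\<exists>c. \<forall>y\<in>?D. norm (L y b) \<le> c" for b
  proof -
    have "continuous_on ?D (\<lambda>y. L y b)"
      using smooth_at_isCont[OF smD] by (intro continuous_at_imp_continuous_on) auto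
    from compact_imp_bounded[OF compact_continuous_image[OF this compact_cball]]
    show ?thesis by (auto simp: bounded_iff)
  qed
  then obtain c where c: "\<And>b y. y \<in> ?D \<Longrightarrow> norm (L y b) \<le> c b" by metis
  define C where "C = \<bar>\<Sum>b\<in>Basis. c b\<bar> + 1"
  have C0: "C > 0" by (simp add: C_def)
  have C: "norm (L y u) \<le> C * norm u" if "y \<in> ?D" for y u
  proof -
    have "norm (L y u) \<le> (\<Sum>b\<in>Basis. c b) * norm u"
      by (rule norm_linear_le[OF linD[OF that] c[OF that]])
    also have "\<dots> \<le> C * norm u" by (intro mult_right_mono) (auto simp: C_def)
    finally show ?thesis .
  qed
  have "\<exists>k\<ge>0. \<forall>y\<in>?D. \<forall>z\<in>?D. norm (L y b - L z b) \<le> k * norm (y - z)" for b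
    by (rule smooth_lipschitz) (rule smD)
  then obtain k where k: "\<And>b. k b \<ge> 0" "\<And>b y z. y \<in> ?D \<Longrightarrow> z \<in> ?D \<Longrightarrow> norm (L y b - L z b) \<le>
      k b * norm (y - z)"
    by metis
  define K where "K = (\<Sum>b\<in>Basis. k b)"
  have K0: "K \<ge> 0" unfolding K_def using k(1) by (intro sum_nonneg)
  have K: "norm (L y u - L z u) \<le> K * norm (y - z) * norm u" if "y \<in> ?D" "z \<in> ?D" for y z u
    using norm_linear_le[OF linear_compose_sub[OF linD[OF that(1)] linD[OF that(2)]],
      of "\<lambda>b. k b * norm (y - z)" u]
      k(2)[OF that] by (simp add: K_def sum_distrib_right)
  have "\<exists>m\<ge>0. \<forall>y\<in>?D. \<forall>w. norm (DL y w b) \<le> m * norm w" for b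
    unfolding DL_def by (rule smooth_derivative_bounded) (rule smD)
  then obtain m where m: "\<And>b. m b \<ge> 0" "\<And>b y w. y \<in> ?D \<Longrightarrow> norm (DL y w b) \<le> m b * norm w" by metis
  define M where "M = (\<Sum>b\<in>Basis. m b)"
  have M0: "M \<ge> 0" unfolding M_def using m(1) by (intro sum_nonneg)
  have M: "norm (DL y w u) \<le> M * norm w * norm u" if "y \<in> ?D" for y w u
    using norm_linear_le[OF DL_lin[OF that], of w "\<lambda>b. m b * norm w" u] m(2)[OF that]
    by (simp add: M_def sum_distrib_right)
  have "\<exists>q\<ge>0. \<forall>y\<in>?D. \<forall>z\<in>?D. norm (L z b - L y b - DL y (z - y) b) \<le> q * (norm (z - y))\<^sup>2" for b
    unfolding DL_def by (rule smooth_taylor) (rule smD)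
  then obtain q where q: "\<And>b. q b \<ge> 0"
    "\<And>b y z. y \<in> ?D \<Longrightarrow> z \<in> ?D \<Longrightarrow> norm (L z b - L y b - DL y (z - y) b) \<le> q b * (norm (z - y))\<^sup>2"
      by metis
  define Q where "Q = (\<Sum>b\<in>Basis. q b)"
  have Q0: "Q \<ge> 0" unfolding Q_def using q(1) by (intro sum_nonneg)
  have Q: "norm (L z u - L y u - DL y (z - y) u) \<le> Q * (norm (z - y))\<^sup>2 * norm u"
    if "y \<in> ?D" "z \<in> ?D" for y z u
    using norm_linear_le[OF
      linear_compose_sub[OF linear_compose_sub[OF linD[OF that(2)] linD[OF that(1)]]
        DL_lin[OF that(1)]],
        of "z - y" "\<lambda>b. q b * (norm (z - y))\<^sup>2" u] q(2)[OF that]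
          by (simp add: Q_def sum_distrib_right)
  \<comment> \<open>The first bound keeps solutions in the half ball, the second makes the Lipschitz constant at
    most \<open>1/2\<close>.\<close>
  define r where "r = min (\<rho> / (2 * C)) (1 / (2 * (K + 1)))"
  have r0: "r > 0" using \<rho>(1) C0 K0 by (simp add: r_def)
  have rC: "C * r \<le> \<rho> / 2"
  proof -
    have "C * r \<le> C * (\<rho> / (2 * C))" using C0 by (intro mult_left_mono) (auto simp: r_def)
    then show ?thesis using C0 by (simp add: field_simps)
  qed
  have rK: "K * r \<le> 1 / 2"
  proof -
    have "K * r \<le> K * (1 / (2 * (K + 1)))" using K0 by (intro mult_left_mono) (auto simp: r_def)
    also have "\<dots> \<le> 1 / 2" using K0 by (simp add: field_simps)
    finally show ?thesis .
  qed
  \<comment> \<open>The nearest-point projection makes the right-hand side globally Lipschitz; it is the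
    identity on the solutions, which stay in the ball.\<close>
  define \<pi> where "\<pi> = closest_point ?D"
  have \<pi>: "\<pi> y \<in> ?D" for y unfolding \<pi>_def using \<rho>(1) by (intro closest_point_in_set) auto
  have \<pi>_id: "\<pi> y = y" if "y \<in> ?D" for y unfolding \<pi>_def using that by (rule closest_point_self)
  have \<pi>_lip: "norm (\<pi> y - \<pi> z) \<le> norm (y - z)" for y z
    using closest_point_lipschitz[of ?D y z] \<rho>(1) by (simp add: \<pi>_def dist_norm)
  have "\<exists>z. z 0 = a \<and> (\<forall>s\<in>{0..1}. z s \<in> cball a (\<rho> / 2) \<and> (z has_vector_derivative L (z s) x)
      (at s within {0..1}))"
    if x: "norm x < r" for x
  proof -
    have "norm (L (\<pi> y) x - L (\<pi> z) x) \<le> (1 / 2) * norm (y - z)" for y z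
    proof -
      have "norm (L (\<pi> y) x - L (\<pi> z) x) \<le> K * norm (\<pi> y - \<pi> z) * norm x" by (rule K[OF \<pi> \<pi>])
      also have "\<dots> \<le> K * norm (y - z) * r"
        using K0 x \<pi>_lip by (intro mult_mono mult_left_mono) auto
      also have "\<dots> = (K * r) * norm (y - z)" by simp
      also have "\<dots> \<le> (1 / 2) * norm (y - z)" using rK by (intro mult_right_mono) auto
      finally show ?thesis .
    qed
    then obtain z where z: "z 0 = a"
      "\<And>s. s \<in> {0..1} \<Longrightarrow> (z has_vector_derivative L (\<pi> (z s)) x) (at s within {0..1})"
      using lipschitz_ode_solution[of "\<lambda>y. L (\<pi> y) x" "1/2" a] by auto
    have bound: "norm (L (\<pi> y) x) \<le> \<rho> / 2" for y
    proof -
      have "norm (L (\<pi> y) x) \<le> C * norm x" by (rule C[OF \<pi>])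
      also have "\<dots> \<le> C * r" using C0 x by (intro mult_left_mono) auto
      finally show ?thesis using rC by simp
    qed
    have in_half: "z s \<in> cball a (\<rho> / 2)" if "s \<in> {0..1}" for s
      using vector_mean_value_bound[OF z(2) bound that] z(1)
        by (simp add: dist_norm norm_minus_commute)
    moreover have "\<pi> (z s) = z s" if "s \<in> {0..1}" for s
      using in_half[OF that] \<rho>(1) by (intro \<pi>_id) auto
    ultimately show ?thesis using z by (intro exI[of _ z]) auto
  qed
  then obtain \<zeta> where \<zeta>: "\<And>x. norm x < r \<Longrightarrow> \<zeta> x 0 = a"
    "\<And>x s. norm x < r \<Longrightarrow> s \<in> {0..1} \<Longrightarrow> \<zeta> x s \<in> cball a (\<rho> / 2)"
    "\<And>x s. norm x < r \<Longrightarrow> s \<in> {0..1} \<Longrightarrow> (\<zeta> x has_vector_derivative L (\<zeta> x s) x) (at s within {0..1})"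
    by metis
  have half: "cball a (\<rho> / 2) \<subseteq> ?D" using \<rho>(1) by auto
  define E where "E = M * C + Q * C\<^sup>2 * r"
  have E0: "E \<ge> 0" using M0 C0 Q0 r0 by (simp add: E_def)
  define \<eta> where "\<eta> x = \<zeta> x 1" for x
  have main: "norm (\<eta> (x + h) - \<eta> x - L (\<eta> x) h) \<le> 2 * E * (norm h)\<^sup>2"
    if x: "norm x < r" and xh: "norm (x + h) < r" and h: "norm h < r" for x h
  proof -
    let ?z = "\<zeta> x" and ?w = "\<zeta> (x + h)"
    let ?L = "\<lambda>t. L (?z t) h"
    \<comment> \<open>The approximate solution for \<open>x + h\<close> and its derivative.\<close>
    define zt where "zt t = ?z t + t *\<^sub>R ?L t" for t
    define zt' where "zt' t = L (?z t) x + (t *\<^sub>R DL (?z t) (L (?z t) x) h + L (?z t) h)" for t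
    have zD: "?z t \<in> ?D" "?w t \<in> ?D" if "t \<in> {0..1}" for t using \<zeta>(2) x xh half that by blast+
    have Lh: "norm (?L t) \<le> C * norm h" if "t \<in> {0..1}" for t by (rule C[OF zD(1)[OF that]])
    have ztD: "zt t \<in> ?D" if t: "t \<in> {0..1}" for t
    proof -
      have "norm (t *\<^sub>R ?L t) \<le> 1 * (C * norm h)" using Lh[OF t] t by (simp only: norm_scaleR)
        (intro mult_mono, auto)
      also have "\<dots> \<le> C * r" using C0 h by simp
      also have "\<dots> \<le> \<rho> / 2" by (rule rC)
      finally have "norm (t *\<^sub>R ?L t) \<le> \<rho> / 2" .
      moreover have "norm (?z t - a) \<le> \<rho> / 2" using \<zeta>(2)[OF x t]
        by (simp add: dist_norm norm_minus_commute)
      ultimately have "norm ((?z t - a) + t *\<^sub>R ?L t) \<le> \<rho>" using norm_triangle_mono by fastforce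
      then show ?thesis by (simp add: zt_def dist_norm norm_minus_commute algebra_simps)
    qed
    have zt_d: "(zt has_vector_derivative zt' t) (at t within {0..1})" if t: "t \<in> {0..1}" for t
    proof -
      have "((\<lambda>t. L (?z t) h) has_vector_derivative DL (?z t) (L (?z t) x) h) (at t within {0..1})"
        unfolding DL_def by (rule smooth_at_vector_chain[OF smD[OF zD(1)[OF t]] \<zeta>(3)[OF x t]])
      then have "((\<lambda>t. t *\<^sub>R L (?z t) h) has_vector_derivative t *\<^sub>R DL (?z t) (L (?z t) x) h +
          1 *\<^sub>R L (?z t) h) (at t within {0..1})"
        by (rule has_vector_derivative_scaleR[OF DERIV_ident])
      from has_vector_derivative_add[OF \<zeta>(3)[OF x t] this] show ?thesis
        unfolding zt_def zt'_def by simp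
    qed
    have err: "norm (zt' t - L (zt t) (x + h)) \<le> E * (norm h)\<^sup>2" if t: "t \<in> {0..1}" for t
    proof -
      let ?y = "?z t"
      have y: "?y \<in> ?D" "?y \<in> S" using zD(1)[OF t] \<rho>(2) by auto
      define Rem where "Rem = L (zt t) (x + h) - L ?y (x + h) - DL ?y (zt t - ?y) (x + h)"
      have d: "zt t - ?y = t *\<^sub>R L ?y h" by (simp add: zt_def)
      have Dw: "DL ?y (t *\<^sub>R L ?y h) u = t *\<^sub>R DL ?y (L ?y h) u" for u
        unfolding DL_def by (rule linear_cmul[OF smooth_at_linear[OF smD[OF y(1)]]])
      \<comment> \<open>Compatibility cancels the two terms that are of first order in \<open>h\<close>.\<close>
      have "zt' t - L (zt t) (x + h) = - (t *\<^sub>R DL ?y (L ?y h) h) - Rem"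
        unfolding Rem_def d Dw zt'_def
        using integrability[OF y(2), of h x]
          by (simp add: DL_def[symmetric] linear_add[OF linD[OF y(1)]]
            linear_add[OF DL_lin[OF y(1)]] algebra_simps)
      then have "norm (zt' t - L (zt t) (x + h)) \<le> norm (t *\<^sub>R DL ?y (L ?y h) h) + norm Rem"
        using norm_triangle_ineq4[of "- (t *\<^sub>R DL ?y (L ?y h) h)" Rem] by simp
      also have "norm (t *\<^sub>R DL ?y (L ?y h) h) \<le> M * C * (norm h)\<^sup>2"
      proof -
        have "norm (DL ?y (L ?y h) h) \<le> M * norm (L ?y h) * norm h" by (rule M[OF y(1)])
        also have "\<dots> \<le> M * (C * norm h) * norm h"
          using Lh[OF t] M0 by (intro mult_right_mono mult_left_mono) auto
        finally have b: "norm (DL ?y (L ?y h) h) \<le> M * C * (norm h)\<^sup>2"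
          by (simp add: power2_eq_square mult.assoc)
        have "norm (t *\<^sub>R DL ?y (L ?y h) h) \<le> 1 * norm (DL ?y (L ?y h) h)"
          using t by (simp only: norm_scaleR) (intro mult_right_mono, auto)
        with b show ?thesis by simp
      qed
      also have "norm Rem \<le> Q * C\<^sup>2 * r * (norm h)\<^sup>2"
      proof -
        have "norm Rem \<le> Q * (norm (zt t - ?y))\<^sup>2 * norm (x + h)"
          unfolding Rem_def by (rule Q[OF y(1) ztD[OF t]])
        also have "\<dots> \<le> Q * (C * norm h)\<^sup>2 * r"
        proof (intro mult_mono mult_left_mono power_mono)
          have "norm (t *\<^sub>R L ?y h) \<le> 1 * (C * norm h)" using Lh[OF t] t by (simp only: norm_scaleR)
            (intro mult_mono, auto)
          then show "norm (zt t - ?y) \<le> C * norm h" by (simp add: d)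
        qed (use Q0 xh in auto)
        finally show ?thesis by (simp add: power_mult_distrib mult_ac)
      qed
      finally show ?thesis by (simp add: E_def algebra_simps)
    qed
    define \<delta> where "\<delta> t = ?w t - zt t" for t
    have \<delta>_d: "(\<delta> has_vector_derivative L (?w t) (x + h) - zt' t) (at t within {0..1})"
      if "t \<in> {0..1}" for t
      unfolding \<delta>_def by (intro has_vector_derivative_diff \<zeta>(3) xh zt_d that)
    have \<delta>0: "\<delta> 0 = 0" using \<zeta>(1) x xh by (simp add: \<delta>_def zt_def)
    have "continuous_on {0..1} \<delta>"
      using \<delta>_d has_vector_derivative_continuous continuous_on_eq_continuous_within by blast
    then have "continuous_on {0..1} (\<lambda>t. norm (\<delta> t))" by (intro continuous_intros)
    then obtain T where T: "T \<in> {0..1}" "\<And>t. t \<in> {0..1} \<Longrightarrow> norm (\<delta> t) \<le> norm (\<delta> T)"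
      using continuous_attains_sup[of "{0..1::real}" "\<lambda>t. norm (\<delta> t)"] by auto
    \<comment> \<open>At a maximum of the distance the mean value inequality bounds it by half of itself plus
      the error.\<close>
    have "norm (\<delta> T - \<delta> 0) \<le> (1 / 2) * norm (\<delta> T) + E * (norm h)\<^sup>2"
    proof (rule vector_mean_value_bound[OF \<delta>_d _ T(1)])
      fix t :: real assume t: "t \<in> {0..1}"
      have "norm (L (?w t) (x + h) - zt' t) \<le> norm (L (?w t) (x + h) - L (zt t) (x + h)) +
          norm (zt' t - L (zt t) (x + h))"
        by (metis dist_norm dist_triangle2)
      also have "norm (L (?w t) (x + h) - L (zt t) (x + h)) \<le> K * norm (\<delta> t) * norm (x + h)"
        unfolding \<delta>_def by (rule K[OF zD(2)[OF t] ztD[OF t]])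
      also have "\<dots> \<le> K * norm (\<delta> T) * r"
        using K0 T(2)[OF t] xh by (intro mult_mono mult_left_mono) auto
      also have "\<dots> = (K * r) * norm (\<delta> T)" by simp
      also have "\<dots> \<le> (1 / 2) * norm (\<delta> T)" using rK by (intro mult_right_mono) auto
      finally show "norm (L (?w t) (x + h) - zt' t) \<le> (1 / 2) * norm (\<delta> T) + E * (norm h)\<^sup>2"
        using err[OF t] by simp
    qed
    then have "norm (\<delta> T) \<le> 2 * E * (norm h)\<^sup>2" by (simp add: \<delta>0)
    with T(2)[of 1] have "norm (\<delta> 1) \<le> 2 * E * (norm h)\<^sup>2" by simp
    then show ?thesis by (simp add: \<delta>_def zt_def \<eta>_def algebra_simps)
  qed
  show ?thesis
  proof (rule that[OF r0])
    show "\<eta> 0 = a"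
    proof -
      have "norm (\<zeta> 0 1 - \<zeta> 0 0) \<le> 0"
      proof (rule vector_mean_value_bound[where f = "\<zeta> 0"])
        fix t :: real assume t: "t \<in> {0..1}"
        show "(\<zeta> 0 has_vector_derivative L (\<zeta> 0 t) 0) (at t within {0..1})" using \<zeta>(3) r0 t by simp
        have "\<zeta> 0 t \<in> ?D" using \<zeta>(2)[of 0 t] r0 t half by auto
        then show "norm (L (\<zeta> 0 t) 0) \<le> 0" using linear_0[OF linD] by simp
      qed auto
      then show ?thesis using \<zeta>(1)[of 0] r0 by (simp add: \<eta>_def)
    qed
  next
    fix x :: 'f assume "x \<in> ball 0 r"
    then have x: "norm x < r" by simp
    have xD: "\<eta> x \<in> ?D" unfolding \<eta>_def using \<zeta>(2)[OF x, of 1] half by auto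
    then show "\<eta> x \<in> S" using \<rho>(2) by auto
    show "(\<eta> has_derivative L (\<eta> x)) (at x)"
      unfolding has_derivative_at
    proof
      show "bounded_linear (L (\<eta> x))" using linD[OF xD] by (simp add: linear_conv_bounded_linear)
      show "(\<lambda>h. norm (\<eta> (x + h) - \<eta> x - L (\<eta> x) h) / norm h) \<midarrow>0\<rightarrow> 0"
      proof (rule Lim_null_comparison)
        have "eventually (\<lambda>h. norm h < r \<and> norm (x + h) < r) (at 0)"
        proof -
          have "eventually (\<lambda>h. h \<in> ball 0 (min r (r - norm x))) (nhds (0::'f))"
            using r0 x by (intro eventually_nhds_in_open) auto
          then show ?thesis unfolding eventually_at_filter
          proof (rule eventually_mono)
            fix h :: 'f assume "h \<in> ball 0 (min r (r - norm x))"
            then have "norm h < r - norm x" by auto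
            with norm_triangle_ineq[of x h] norm_ge_zero[of x]
            show "h \<noteq> 0 \<longrightarrow> h \<in> UNIV \<longrightarrow> norm h < r \<and> norm (x + h) < r" by linarith
          qed
        qed
        then show "eventually (\<lambda>h. norm (norm (\<eta> (x + h) - \<eta> x - L (\<eta> x) h) / norm h) \<le>
            2 * E * norm h) (at 0)"
        proof (rule eventually_mono)
          fix h assume h: "norm h < r \<and> norm (x + h) < r"
          show "norm (norm (\<eta> (x + h) - \<eta> x - L (\<eta> x) h) / norm h) \<le> 2 * E * norm h"
            using main[of x h] x h E0 by (cases "h = 0") (auto simp: field_simps power2_eq_square)
        qed
        show "((\<lambda>h. 2 * E * norm h) \<longlongrightarrow> 0) (at (0::'f))"
          by (auto intro!: tendsto_eq_intros)
      qed
    qed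
  qed
qed

text \<open>The right-hand side of the equation is as regular as its solution.\<close>

lemma total_differential_solution_smooth:
  fixes L :: "'e::euclidean_space \<Rightarrow> 'f::euclidean_space \<Rightarrow> 'e"
  assumes S: "open S" and U: "open U" "x \<in> U"
    and sm: "\<And>y u. y \<in> S \<Longrightarrow> smooth_at (\<lambda>y. L y u) y"
    and \<eta>: "\<And>x. x \<in> U \<Longrightarrow> \<eta> x \<in> S" "\<And>x. x \<in> U \<Longrightarrow> (\<eta> has_derivative L (\<eta> x)) (at x)"
  shows "smooth_at \<eta> x"
proof (rule smooth_atI_derivative[OF U])
  show "\<eta> differentiable (at y)" if "y \<in> U" for y using \<eta>(2)[OF that]
    by (auto simp: differentiable_def)
  fix v k assume k: "Ck_on k \<eta> U"
  have "smooth_on (\<lambda>y. L y v) S" using sm S by (simp add: smooth_on_iff_smooth_at)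
  then have "Ck_on k (\<lambda>y. L (\<eta> y) v) U"
    by (intro Ck_on_compose[OF U(1) _ _ k, of S]) (use \<eta>(1) in \<open>auto simp: smooth_on_def\<close>)
  then show "Ck_on k (\<lambda>y. fderiv \<eta> y v) U"
    by (subst Ck_on_cong[OF U(1)]) (auto simp: frechet_derivative_eqI[OF \<eta>(2)])
qed

section \<open>Integrability of the horizontal distribution\<close>

context conformal_submersion
begin

definition involutive :: bool where
  "involutive \<longleftrightarrow> (\<forall>X\<in>sections A horizontal. \<forall>Y\<in>sections A horizontal. \<forall>p.
     lie_bracket A X Y p \<in> horizontal p)"

text \<open>In the coordinates at \<open>p\<close>, let \<open>P\<close> be the vertical projection and \<open>\<eta>\<close> an integral patch.
  From \<open>P(\<eta>) D\<eta> = 0\<close> one gets that \<open>(D\<^sub>w P) v\<close> is symmetric in horizontal \<open>v\<close> and \<open>w\<close> at \<open>p\<close>, and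
  from \<open>P X = 0\<close> and \<open>P Y = 0\<close> that \<open>P [X,Y]\<close> is the antisymmetric part of this expression.\<close>

lemma integrable_imp_involutive:
  assumes "integrable_distribution TYPE('f) A horizontal"
  shows involutive
  unfolding involutive_def
proof (intro ballI allI)
  fix X Y p assume X: "X \<in> sections A horizontal" and Y: "Y \<in> sections A horizontal"
  obtain U :: "'f set" and f where f: "integral_patch A horizontal U f" and pU: "p \<in> f ` U"
    using assms unfolding integrable_distribution_def by blast
  obtain a where a: "a \<in> U" "f a = p" using pU by blast
  define c where "c = chart_at A p"
  have c: "c \<in> A" "p \<in> fst c" unfolding c_def using M.chart_at by auto
  define \<eta> where "\<eta> u = snd c (f u)" for u
  let ?x = "snd c p"
  have U: "open U" "continuous_on U f" "smooth_on \<eta> (U \<inter> f -` fst c)"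
    using f c(1) by (auto simp: integral_patch_def \<eta>_def[abs_def])
  have U': "open (U \<inter> f -` fst c)" "a \<in> U \<inter> f -` fst c"
    using U M.open_dom[OF c(1)] a c by (auto intro: continuous_open_preimage)
  have sm\<eta>: "smooth_at \<eta> u" if "u \<in> U \<inter> f -` fst c" for u
    using U(3) U'(1) that by (rule smooth_on_imp_smooth_at)
  note smA = sm\<eta>[OF U'(2)]
  have \<eta>a: "\<eta> a = ?x" using a by (simp add: \<eta>_def)
  have evU: "eventually (\<lambda>u. u \<in> U \<inter> f -` fst c) (nhds a)" using U'
    by (rule eventually_nhds_in_open)
  define df where "df u = fderiv (\<lambda>w. snd (chart_at A (f u)) (f w)) u" for u
  have df: "range (df u) = horizontal (f u)" if "u \<in> U" for u
    using f that unfolding integral_patch_def df_def Let_def by blast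
  have D\<eta>: "fderiv \<eta> u v = dfun A (snd c) (f u) (df u v)" if u: "u \<in> U \<inter> f -` fst c" for u v
  proof -
    let ?e = "chart_at A (f u)"
    have o: "open (U \<inter> f -` fst ?e)" using U M.open_dom[OF M.chart_at(1)]
      by (intro continuous_open_preimage) auto
    have "smooth_on (\<lambda>w. snd ?e (f w)) (U \<inter> f -` fst ?e)"
      using f M.chart_at(1) unfolding integral_patch_def by blast
    then have sm: "smooth_at (\<lambda>w. snd ?e (f w)) u"
      using o by (rule smooth_on_imp_smooth_at) (use u M.chart_at in auto)
    have "eventually (\<lambda>w. w \<in> U \<inter> f -` fst ?e) (nhds u)"
      using o by (rule eventually_nhds_in_open) (use u M.chart_at in auto)
    then have ev: "eventually (\<lambda>w. \<eta> w = snd c (inv_chart ?e (snd ?e (f w)))) (nhds u)"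
      by (rule eventually_mono) (use M.chart_at in \<open>auto simp: \<eta>_def\<close>)
    have "((\<lambda>w. snd c (inv_chart ?e (snd ?e (f w)))) has_derivative
       (\<lambda>v. fderiv (\<lambda>x. snd c (inv_chart ?e x)) (snd ?e (f u)) (df u v))) (at u)"
      unfolding df_def
      by (rule has_derivative_compose[OF smooth_at_has_derivative[OF sm]
            smooth_at_has_derivative[OF M.transition_smooth_at]]) (use u c M.chart_at in auto)
    from frechet_derivative_eqI[OF this] show ?thesis
      unfolding frechet_derivative_eventually_cong[OF ev] dfun_def by simp
  qed
  define P where "P x w = dfun A (snd c) (inv_chart c x)
      (vert (inv_chart c x) (coord_vec A c (inv_chart c x) w))" for x w
  have P_lin: "linear (P x)" if "x \<in> snd c ` fst c" for x
  proof -
    have q: "inv_chart c x \<in> fst c" using that c by (intro M.inv_chart_dom)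
    note l1 = M.coord_vec_linear[OF c(1) q] and l2 = M.dfun_chart_map_linear[OF c(1) q]
    have "linear (vert (inv_chart c x))"
      unfolding vert_eq[abs_def] hor_eq_lift
      by (intro linear_compose_sub linear_id[unfolded id_def]
        linear_compose[OF dF_linear lift_linear, unfolded o_def])
    from linear_compose[OF linear_compose[OF l1 this] l2] show ?thesis
      by (simp add: P_def[abs_def] o_def)
  qed
  have P_sm: "smooth_at (\<lambda>x. P x w) ?x" for w
  proof -
    have "field_smooth_at A (\<lambda>q. vert q (coord_vec A c q w)) p"
      by (intro field_smooth_at_vert M.field_smooth_at_coord_vec c M.fun_smooth_at_const)
    then show ?thesis
      unfolding M.field_smooth_at_chart[OF c] M.fun_smooth_at_chart[OF c] P_def .
  qed
  have P_lin_ev: "eventually (\<lambda>x. linear (P x)) (nhds ?x)"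
    using M.eventually_range[OF c] by (rule eventually_mono) (rule P_lin)
  have P_hor: "P (snd c q) (dfun A (snd c) q w) = 0" if "q \<in> fst c" "w \<in> horizontal q" for q w
    using that c by (simp add: P_def M.coord_vec_dfun vert_horizontal
      linear_0[OF M.dfun_chart_map_linear])
  \<comment> \<open>The derivative of \<open>P (\<eta> u) (D\<eta> u v) = 0\<close> in the direction \<open>w\<close>.\<close>
  have sym: "fderiv (\<lambda>x. P x (df a v)) ?x (df a w) =
      - P ?x (fderiv (\<lambda>u. fderiv \<eta> u v) a w)" for v w
  proof -
    let ?Z = "\<lambda>u. fderiv \<eta> u v"
    have dfa: "fderiv \<eta> a v = df a v" for v
      using D\<eta>[OF U'(2)] a by (simp add: c_def)
    have "eventually (\<lambda>u. P (\<eta> u) (?Z u) = 0) (nhds a)"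
      using evU
    proof (rule eventually_mono)
      fix u assume u: "u \<in> U \<inter> f -` fst c"
      then have "df u v \<in> horizontal (f u)" using df by blast
      then show "P (\<eta> u) (?Z u) = 0" using P_hor[of "f u" "df u v"] D\<eta>[OF u] u by (simp add: \<eta>_def)
    qed
    from frechet_derivative_eventually_cong[OF this]
    have "0 = fderiv (\<lambda>u. P (\<eta> u) (?Z u)) a w" by simp
    also have "\<dots> = fderiv (\<lambda>u. P (\<eta> u) (?Z a)) a w + P (\<eta> a) (fderiv ?Z a w)"
    proof (rule frechet_derivative_apply_linear)
      have "(\<eta> \<longlongrightarrow> ?x) (nhds a)"
        using smooth_at_isCont[OF smA] tendsto_at_iff_tendsto_nhds[of \<eta> a] \<eta>a
          by (simp add: isCont_def)
      with P_lin_ev show "eventually (\<lambda>u. linear (P (\<eta> u))) (nhds a)"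
        by (rule eventually_compose_filterlim)
      show "smooth_at (\<lambda>u. P (\<eta> u) b) a" for b
        by (rule smooth_at_compose[where g = "\<lambda>x. P x b"]) (use P_sm smA \<eta>a in auto)
    qed (rule smooth_at_derivative[OF smA])
    also have "fderiv (\<lambda>u. P (\<eta> u) (?Z a)) a w = fderiv (\<lambda>x. P x (?Z a)) ?x (df a w)"
    proof -
      have "((\<lambda>u. P (\<eta> u) (?Z a)) has_derivative
          (\<lambda>w. fderiv (\<lambda>x. P x (?Z a)) (\<eta> a) (fderiv \<eta> a w))) (at a)"
        by (rule has_derivative_compose[OF smooth_at_has_derivative[OF smA], where g =
          "\<lambda>x. P x (?Z a)"])
           (use smooth_at_has_derivative[OF P_sm] \<eta>a in simp)
      from frechet_derivative_eqI[OF this] show ?thesis by (simp add: \<eta>a dfa)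
    qed
    finally show ?thesis by (simp add: \<eta>a dfa eq_neg_iff_add_eq_0)
  qed
  have sym': "fderiv (\<lambda>x. P x (df a v)) ?x (df a w) =
      fderiv (\<lambda>x. P x (df a w)) ?x (df a v)" for v w
    unfolding sym second_derivative_symmetric[OF smA, of v w] ..
  define co where "co Z x = dfun A (snd c) (inv_chart c x) (Z (inv_chart c x))" for Z x
  have co: "fderiv (\<lambda>x. P x (Z p)) ?x u + P ?x (fderiv (co Z) ?x u) = 0"
    if Z: "Z \<in> sections A horizontal" for Z u
  proof -
    have Z': "field_smooth_at A Z p" "\<And>q. Z q \<in> horizontal q"
      using Z by (auto simp: sections_def M.smooth_field_iff)
    have smZ: "smooth_at (co Z) ?x"
      using Z'(1) by (simp add: M.field_smooth_at_chart[OF c] M.fun_smooth_at_chart[OF c]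
        co_def[abs_def])
    have "eventually (\<lambda>x. P x (co Z x) = 0) (nhds ?x)"
      using M.eventually_range[OF c]
    proof (rule eventually_mono)
      fix x assume x: "x \<in> snd c ` fst c"
      then have q: "inv_chart c x \<in> fst c" using c by (intro M.inv_chart_dom)
      from P_hor[OF q Z'(2)] show "P x (co Z x) = 0"
        using M.snd_inv_chart[OF c(1) x] by (simp add: co_def)
    qed
    from frechet_derivative_eventually_cong[OF this]
    have "0 = fderiv (\<lambda>x. P x (co Z x)) ?x u" by simp
    also have "\<dots> = fderiv (\<lambda>x. P x (co Z ?x)) ?x u + P ?x (fderiv (co Z) ?x u)"
      by (rule frechet_derivative_apply_linear[OF P_lin_ev P_sm smZ])
    also have "co Z ?x = Z p" using c by (simp add: co_def) (simp add: c_def)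
    finally show ?thesis by simp
  qed
  obtain v w where vw: "X p = df a v" "Y p = df a w"
    using df[OF a(1)] X Y a(2) unfolding sections_def by blast
  have lb: "lie_bracket A X Y p = fderiv (co Y) ?x (X p) - fderiv (co X) ?x (Y p)"
    unfolding lie_bracket_def Let_def dfun_def[of A _ p] co_def[abs_def] c_def by simp
  have Px: "linear (P ?x)" using P_lin c by blast
  have "P ?x (lie_bracket A X Y p) = P ?x (fderiv (co Y) ?x (X p)) - P ?x (fderiv (co X) ?x (Y p))"
    unfolding lb by (rule linear_diff[OF Px])
  also have "\<dots> = fderiv (\<lambda>x. P x (X p)) ?x (Y p) - fderiv (\<lambda>x. P x (Y p)) ?x (X p)"
    using co[OF X, of "Y p"] co[OF Y, of "X p"] by (simp add: add_eq_0_iff)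
  also have "\<dots> = 0" unfolding vw using sym'[of v w] by simp
  finally have "vert p (lie_bracket A X Y p) = 0"
    using c M.coord_vec_dfun[OF c, of "lie_bracket A X Y p"] by (simp add: P_def) (simp add: c_def)
  then show "lie_bracket A X Y p \<in> horizontal p" by (rule horizontalI_vert)
qed

text \<open>The horizontal lifts \<open>\<Lambda> u\<close> of the coordinate fields of \<open>N\<close> commute, so the total
  differential equation for their components can be solved. The solution is injective because in
  coordinates its composition with \<open>F\<close> is a translation.\<close>

lemma involutive_imp_integrable:
  assumes involutive
  shows "integrable_distribution TYPE('f) A horizontal"
  unfolding integrable_distribution_def
proof
  fix p
  define c where "c = chart_at A p"
  have c: "c \<in> A" "p \<in> fst c" unfolding c_def using M.chart_at by auto
  define d where "d = chart_at B (F p)"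
  have d: "d \<in> B" "F p \<in> fst d" unfolding d_def using N.chart_at by auto
  define W where "W = fst c \<inter> F -` fst d"
  have "open (F -` fst d)"
    using F_smooth N.open_dom[OF d(1)] by (auto simp: smooth_map_def continuous_on_open_vimage)
  then have W: "open W" "p \<in> W" using M.open_dom[OF c(1)] c d by (auto simp: W_def)
  define S where "S = snd c ` W"
  have S: "open S" unfolding S_def W_def using \<open>open (F -` fst d)\<close>
    by (rule M.open_chart_image[OF c(1)])
  have inS: "inv_chart c x \<in> W" "snd c (inv_chart c x) = x" if "x \<in> S" for x
    using that c by (auto simp: S_def W_def)
  define \<Lambda> where "\<Lambda> u q = lift q (coord_vec B d (F q) u)" for u q
  have \<Lambda>_hor: "\<Lambda> u q \<in> horizontal q" for u q by (simp add: \<Lambda>_def lift_horizontal)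
  have \<Lambda>_sm: "field_smooth_at A (\<Lambda> u) q" if "q \<in> W" for u q
    unfolding \<Lambda>_def using that d
    by (intro field_smooth_at_lift along_smooth_at_pullback N.field_smooth_at_coord_vec
      N.fun_smooth_at_const)
       (auto simp: W_def)
  have \<Lambda>_lin: "linear (\<lambda>u. \<Lambda> u q)" if "q \<in> W" for q
    using linear_compose[OF N.coord_vec_linear[OF d(1), of "F q"] lift_linear[of q]] that
    by (simp add: \<Lambda>_def o_def W_def)
  have dF_\<Lambda>: "dF q (\<Lambda> u q) = coord_vec B d (F q) u" for u q by (simp add: \<Lambda>_def dF_lift)
  let ?G = "\<lambda>q. snd d (F q)"
  have G_sm: "fun_smooth_at A ?G q" if "q \<in> W" for q
    using that d by (intro fun_smooth_at_chart_F) (auto simp: W_def)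
  have dG: "dfun A ?G q v = dfun B (snd d) (F q) (dF q v)" if "q \<in> W" for q v
    using that d by (intro dfun_pullback N.fun_smooth_at_chart_map) (auto simp: W_def)
  have dG_\<Lambda>: "dfun A ?G q (\<Lambda> u q) = u" if "q \<in> W" for q u
    using that d by (simp add: dG dF_\<Lambda> N.dfun_coord_vec W_def)
  define L where "L x u = dfun A (snd c) (inv_chart c x) (\<Lambda> u (inv_chart c x))" for x u
  have L_lin: "linear (L x)" if "x \<in> S" for x
    using linear_compose[OF \<Lambda>_lin[OF inS(1)[OF that]] M.dfun_chart_map_linear[OF c(1)]]
      inS(1)[OF that]
    by (simp add: L_def[abs_def] o_def W_def)
  have L_sm: "smooth_at (\<lambda>x. L x u) x" if x: "x \<in> S" for x u
  proof -
    have q: "inv_chart c x \<in> fst c" using inS(1)[OF x] by (simp add: W_def)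
    show ?thesis
      using \<Lambda>_sm[OF inS(1)[OF x], of u] inS(2)[OF x]
      unfolding M.field_smooth_at_chart[OF c(1) q] M.fun_smooth_at_chart[OF c(1) q] L_def by simp
  qed
  have L_int: "fderiv (\<lambda>x. L x u) x (L x v) = fderiv (\<lambda>x. L x v) x (L x u)"
    if x: "x \<in> S" for x u v
  proof -
    define q where "q = inv_chart c x"
    have q: "q \<in> W" "snd c q = x" "q \<in> fst c" using inS[OF x] by (auto simp: q_def W_def)
    have ext: "\<exists>X. X \<in> sections A horizontal \<and> eventually (\<lambda>q'. X q' = \<Lambda> w q') (nhds q)" for w
    proof -
      obtain \<beta> where b: "smooth_field A (\<lambda>q. \<beta> q *\<^sub>R \<Lambda> w q)" "eventually (\<lambda>q. \<beta> q = 1) (nhds q)"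
        by (rule M.extend_field[OF \<Lambda>_sm[OF q(1), of w]]) (rule that)
      show ?thesis
        by (rule exI[of _ "\<lambda>q. \<beta> q *\<^sub>R \<Lambda> w q"])
           (use b \<Lambda>_hor in \<open>auto simp: sections_def intro: subspace_scale[OF subspace_horizontal]
             elim!: eventually_mono\<close>)
    qed
    obtain X where X: "X \<in> sections A horizontal" and Xe: "eventually (\<lambda>q'. X q' = \<Lambda> u q') (nhds q)"
      using ext by blast
    obtain Y where Y: "Y \<in> sections A horizontal" and Ye: "eventually (\<lambda>q'. Y q' = \<Lambda> v q') (nhds q)"
      using ext by blast
    have Xs: "field_smooth_at A X q" "field_smooth_at A Y q"
      using X Y by (auto simp: sections_def M.smooth_field_iff)
    note XYq = eventually_nhds_x_imp_x[OF Xe] eventually_nhds_x_imp_x[OF Ye]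
    have evW: "eventually (\<lambda>q. q \<in> W) (nhds q)" using W(1) q(1) by (rule eventually_nhds_in_open)
    \<comment> \<open>The lifts have constant components after projection to \<open>N\<close>.\<close>
    have const: "dfun A (\<lambda>q. dfun A ?G q (Z q)) q z = 0"
      if "eventually (\<lambda>q'. Z q' = \<Lambda> w q') (nhds q)" for Z w z
    proof -
      have "eventually (\<lambda>q. dfun A ?G q (Z q) = w) (nhds q)"
        using that evW by eventually_elim (simp add: dG_\<Lambda>)
      from M.dfun_cong[OF this] show ?thesis by simp
    qed
    have "dfun A ?G q (lie_bracket A X Y q) = 0"
      unfolding M.dfun_lie_bracket[OF G_sm[OF q(1)] Xs] const[OF Xe] const[OF Ye] by simp
    then have "dfun B (snd d) (F q) (dF q (lie_bracket A X Y q)) = 0" by (simp add: dG[OF q(1)])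
    then have "dF q (lie_bracket A X Y q) = 0"
      using N.coord_vec_dfun[OF d(1), of "F q"] linear_0[OF N.coord_vec_linear[OF d(1)]] q(1)
      unfolding W_def by (metis IntD2 vimageD)
    then have "lie_bracket A X Y q \<in> vertical q" by (simp add: vertical_def)
    moreover have "lie_bracket A X Y q \<in> horizontal q" using assms X Y
      by (auto simp: involutive_def)
    ultimately have "lie_bracket A X Y q = 0" by (intro horizontal_vertical_0)
    then have "dfun A (\<lambda>q. dfun A (snd c) q (Y q)) q (X q) = dfun A (\<lambda>q. dfun A (snd c) q (X q)) q
        (Y q)"
      using M.dfun_lie_bracket[OF M.fun_smooth_at_chart_map[OF c(1) q(3)] Xs]
        linear_0[OF M.dfun_chart_map_linear[OF c(1) q(3)]] by simp
    moreover have "dfun A (\<lambda>q. dfun A (snd c) q (Z q)) q (\<Lambda> z q) = fderiv (\<lambda>x. L x w) x (L x z)"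
      if Z: "eventually (\<lambda>q'. Z q' = \<Lambda> w q') (nhds q)" for Z w z
    proof -
      have "eventually (\<lambda>q. dfun A (snd c) q (Z q) = dfun A (snd c) q (\<Lambda> w q)) (nhds q)"
        using Z by (rule eventually_mono) simp
      from M.dfun_cong[OF this]
      have "dfun A (\<lambda>q. dfun A (snd c) q (Z q)) q (\<Lambda> z q) = dfun A (\<lambda>q. dfun A (snd c) q (\<Lambda> w q)) q
          (\<Lambda> z q)" by simp
      also have "\<dots> = fderiv (\<lambda>x. dfun A (snd c) (inv_chart c x) (\<Lambda> w (inv_chart c x))) (snd c q)
          (dfun A (snd c) q (\<Lambda> z q))"
        using \<Lambda>_sm[OF q(1)] M.field_smooth_at_chart[OF c(1) q(3)] by (intro M.dfun_chart c q) blast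
      finally show ?thesis by (simp add: L_def q_def[symmetric] q(2))
    qed
    ultimately show ?thesis using Xe Ye XYq by simp
  qed
  obtain r \<eta> where r: "r > 0" and \<eta>0: "\<eta> 0 = snd c p" and \<eta>S: "\<And>x. x \<in> ball 0 r \<Longrightarrow> \<eta> x \<in> S"
    and D\<eta>: "\<And>x. x \<in> ball 0 r \<Longrightarrow> (\<eta> has_derivative L (\<eta> x)) (at x)"
  proof -
    have "snd c p \<in> S" using W(2) by (auto simp: S_def)
    show thesis
      by (rule total_differential_equation[of S "snd c p" L, OF S \<open>snd c p \<in> S\<close> L_lin L_sm L_int])
         (assumption, assumption, assumption, rule that)
  qed
  let ?U = "ball (0::'f) r"
  define f where "f x = inv_chart c (\<eta> x)" for x
  have fW: "f x \<in> W" "snd c (f x) = \<eta> x" if "x \<in> ?U" for x using inS[OF \<eta>S[OF that]]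
    by (simp_all add: f_def)
  have sm\<eta>: "smooth_at \<eta> x" if "x \<in> ?U" for x
    by (rule total_differential_solution_smooth[OF S open_ball that L_sm \<eta>S D\<eta>])
  have f_cont: "continuous_on ?U f"
    unfolding f_def
  proof (rule continuous_on_compose2[where g = "inv_chart c" and f = \<eta>])
    show "continuous_on (snd c ` fst c) (inv_chart c)"
      using M.chart_homeomorphism[OF c(1)] by (simp add: homeomorphism_def)
    show "continuous_on ?U \<eta>"
      using smooth_at_isCont[OF sm\<eta>] by (intro continuous_at_imp_continuous_on) auto
    have "S \<subseteq> snd c ` fst c" by (auto simp: S_def W_def)
    with \<eta>S show "\<eta> ` ?U \<subseteq> snd c ` fst c" by blast
  qed
  have f_inj: "inj_on f ?U"
  proof -
    \<comment> \<open>In the chart \<open>d\<close>, the map \<open>F \<circ> f\<close> is a translation.\<close>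
    have der: "((\<lambda>x. snd d (F (f x)) - x) has_derivative (\<lambda>h. 0)) (at x)" if x: "x \<in> ?U" for x
    proof -
      have q: "f x \<in> fst c" using fW(1)[OF x] by (simp add: W_def)
      have "smooth_at (\<lambda>y. snd d (F (inv_chart c y))) (\<eta> x)"
        using G_sm[OF fW(1)[OF x]] fW(2)[OF x] unfolding M.fun_smooth_at_chart[OF c(1) q] by simp
      from has_derivative_compose[OF D\<eta>[OF x] smooth_at_has_derivative[OF this]]
      have "((\<lambda>x. snd d (F (f x))) has_derivative
         (\<lambda>h. fderiv (\<lambda>y. snd d (F (inv_chart c y))) (\<eta> x) (L (\<eta> x) h))) (at x)"
        by (simp add: f_def)
      moreover have "fderiv (\<lambda>y. snd d (F (inv_chart c y))) (\<eta> x) (L (\<eta> x) h) = h" for h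
        using M.dfun_chart[OF c(1) q G_sm[OF fW(1)[OF x]], of "\<Lambda> h (f x)"]
          dG_\<Lambda>[OF fW(1)[OF x], of h] fW(2)[OF x]
        by (simp add: L_def f_def)
      ultimately have "((\<lambda>x. snd d (F (f x))) has_derivative (\<lambda>h. h)) (at x)" by simp
      from has_derivative_diff[OF this has_derivative_ident] show ?thesis by simp
    qed
    have "\<exists>k. \<forall>x\<in>?U. snd d (F (f x)) - x = k"
      by (rule has_derivative_zero_constant[OF convex_ball has_derivative_at_withinI[OF der]])
    then obtain k where k: "\<And>x. x \<in> ?U \<Longrightarrow> snd d (F (f x)) - x = k" by blast
    show ?thesis
    proof (rule inj_onI)
      fix x y assume "x \<in> ?U" "y \<in> ?U" "f x = f y"
      then show "x = y" using k[of x] k[of y] by (metis diff_eq_eq add_left_cancel)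
    qed
  qed
  have "integral_patch A horizontal ?U f"
    unfolding integral_patch_def Let_def
  proof (intro conjI ballI open_ball f_inj f_cont)
    fix e assume e: "e \<in> A"
    have o: "open (?U \<inter> f -` fst e)" using f_cont M.open_dom[OF e]
      by (intro continuous_open_preimage) auto
    show "smooth_on (\<lambda>u. snd e (f u)) (?U \<inter> f -` fst e)"
      unfolding smooth_on_iff_smooth_at[OF o]
    proof
      fix u assume u: "u \<in> ?U \<inter> f -` fst e"
      have uU: "u \<in> ?U" using u by simp
      have "smooth_at (\<lambda>x. snd e (inv_chart c x)) (\<eta> u)"
        using M.transition_smooth_at[OF c(1) e, of "f u"] fW[OF uU] u by (simp add: W_def)
      from smooth_at_compose[OF this sm\<eta>[OF uU]] show "smooth_at (\<lambda>u. snd e (f u)) u"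
        by (simp add: f_def)
    qed
  next
    fix u assume u: "u \<in> ?U"
    let ?q = "f u"
    have q: "?q \<in> fst c" "F ?q \<in> fst d" using fW(1)[OF u] by (auto simp: W_def)
    let ?df = "fderiv (\<lambda>w. snd (chart_at A ?q) (f w)) u"
    have "smooth_at (\<lambda>x. snd (chart_at A ?q) (inv_chart c x)) (\<eta> u)"
      using M.transition_smooth_at[OF c(1) M.chart_at(1) q(1), of ?q] M.chart_at fW(2)[OF u] by simp
    from has_derivative_compose[OF D\<eta>[OF u] smooth_at_has_derivative[OF this]]
    have "((\<lambda>w. snd (chart_at A ?q) (f w)) has_derivative (\<lambda>v. coord_vec A c ?q (L (\<eta> u) v)))
        (at u)"
      by (simp add: f_def[symmetric] coord_vec_def fW(2)[OF u])
    from frechet_derivative_eqI[OF this] have df: "?df = (\<lambda>v. lift ?q (coord_vec B d (F ?q) v))"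
      using M.coord_vec_dfun[OF c(1) q(1)] by (simp add: L_def f_def[symmetric] \<Lambda>_def)
    show "inj ?df" unfolding df
      by (rule injI) (metis dF_lift N.dfun_coord_vec[OF d(1) q(2)])
    show "range ?df = horizontal ?q" unfolding df
    proof
      show "range (\<lambda>v. lift ?q (coord_vec B d (F ?q) v)) \<subseteq> horizontal ?q" using lift_horizontal
        by auto
      show "horizontal ?q \<subseteq> range (\<lambda>v. lift ?q (coord_vec B d (F ?q) v))"
      proof
        fix w assume "w \<in> horizontal ?q"
        then have "w = lift ?q (dF ?q w)" using lift_eqI by metis
        then have "w = lift ?q (coord_vec B d (F ?q) (dfun B (snd d) (F ?q) (dF ?q w)))"
          using N.coord_vec_dfun[OF d(1) q(2)] by simp
        then show "w \<in> range (\<lambda>v. lift ?q (coord_vec B d (F ?q) v))" by blast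
      qed
    qed
  qed
  moreover have "p \<in> f ` ?U" using r \<eta>0 c by (intro image_eqI[of _ _ 0]) (auto simp: f_def)
  ultimately show "\<exists>(U::'f set) f. integral_patch A horizontal U f \<and> p \<in> f ` U" by blast
qed

theorem integrable_iff_involutive: "integrable_distribution TYPE('f) A horizontal \<longleftrightarrow> involutive"
  using integrable_imp_involutive involutive_imp_integrable by blast

end

section \<open>Semi-invariant submersions from Kaehler manifolds\<close>

locale kaehler_semi_invariant =
  conformal_submersion_connections A gM nablaM B gN nablaF F lam nablaN
  for A :: "('m::{t2_space, second_countable_topology}, 'e::euclidean_space) atlas" and gM nablaM
    and B :: "('n::{t2_space, second_countable_topology}, 'f::euclidean_space) atlas"
      and gN nablaF F lam nablaN +
  fixes R :: "'m \<Rightarrow> 'e \<Rightarrow> 'e" and D1 :: "'m \<Rightarrow> 'e set"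
  assumes R_smooth: "smooth_endo A R"
    and R_isometry: "gM p (R p u) (R p v) = gM p u v"
    and R_square: "R p (R p v) = - v"
    and R_parallel: "smooth_field A X \<Longrightarrow> smooth_field A Y \<Longrightarrow>
      nablaM X (\<lambda>p. R p (Y p)) = (\<lambda>p. R p (nablaM X Y p))"
    and semi_invariant: "semi_invariant R D1"
begin

lemma R_linear: "linear (R p)"
  using R_smooth by (simp add: smooth_endo_def)

lemma R_skew: "gM p (R p u) v = - gM p u (R p v)"
  using R_isometry[of p "R p u" v] by (simp add: R_square M.g_minus_left)

text \<open>Smoothness of an endomorphism is given for constant components only; linearity extends it
  to variable ones.\<close>

lemma field_smooth_at_R:
  assumes Y: "field_smooth_at A Y p" shows "field_smooth_at A (\<lambda>q. R q (Y q)) p"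
proof -
  define c where "c = chart_at A p"
  have c: "c \<in> A" "p \<in> fst c" unfolding c_def using M.chart_at by auto
  let ?L = "\<lambda>q v. dfun A (snd c) q (R q (coord_vec A c q v))"
  have "fun_smooth_at A (\<lambda>q. ?L q (dfun A (snd c) q (Y q))) p"
  proof (rule M.fun_smooth_at_apply_linear[where L = ?L])
    show "eventually (\<lambda>q. linear (?L q)) (nhds p)"
      using M.eventually_dom[OF c]
    proof (rule eventually_mono)
      fix q assume "q \<in> fst c"
      note l = M.coord_vec_linear[OF c(1) this] M.dfun_chart_map_linear[OF c(1) this]
      show "linear (?L q)"
        using linear_compose[OF linear_compose[OF l(1) R_linear] l(2)] by (simp add: o_def)
    qed
    show "fun_smooth_at A (\<lambda>q. ?L q b) p" for b
      by (rule M.fun_smooth_atI_smooth_on[OF c])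
         (use R_smooth c in \<open>simp add: smooth_endo_def Let_def\<close>)
  qed (use Y M.field_smooth_at_chart[OF c] in blast)
  then have "fun_smooth_at A (\<lambda>q. dfun A (snd c) q (R q (Y q))) p"
  proof (rule M.fun_smooth_at_transform)
    show "eventually (\<lambda>q. dfun A (snd c) q (R q (Y q)) = ?L q (dfun A (snd c) q (Y q))) (nhds p)"
      using M.eventually_dom[OF c] by (rule eventually_mono) (simp add: M.coord_vec_dfun[OF c(1)])
  qed
  then show ?thesis by (rule M.field_smooth_atI[OF c])
qed

subsection \<open>The pieces of the almost complex structure\<close>

lemma D1_smooth: "smooth_distribution A D1"
  and D1_vertical: "v \<in> D1 p \<Longrightarrow> v \<in> vertical p"
  and R_D1: "v \<in> D1 p \<Longrightarrow> R p v \<in> D1 p"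
  and R_D2: "v \<in> D2 D1 p \<Longrightarrow> R p v \<in> horizontal p"
  using semi_invariant unfolding semi_invariant_def by blast+

lemma subspace_D1: "subspace (D1 p)"
  using D1_smooth by (simp add: smooth_distribution_def)

lemma subspace_D2: "subspace (D2 D1 p)"
  unfolding D2_def by (intro M.subspace_orth_in subspace_vertical)

lemma D2_vertical: "v \<in> D2 D1 p \<Longrightarrow> v \<in> vertical p"
  by (simp add: D2_def orth_in_def)

lemma D2_orth: "v \<in> D2 D1 p \<Longrightarrow> w \<in> D1 p \<Longrightarrow> gM p v w = 0"
  by (simp add: D2_def orth_in_def)

lemma diff_proj_in_D2: "v \<in> vertical p \<Longrightarrow> v - M.proj D1 p v \<in> D2 D1 p"
  unfolding D2_def orth_in_def
  using subspace_diff[OF subspace_vertical _ D1_vertical[OF M.proj_in[OF D1_smooth]]]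
    M.proj_orth[OF D1_smooth] by simp

lemma proj_D2: "v \<in> D2 D1 p \<Longrightarrow> M.proj D1 p v = 0"
  using M.proj_orth[OF D1_smooth M.proj_in[OF D1_smooth], of p v v]
    D2_orth[OF _ M.proj_in[OF D1_smooth], of v p v]
  by (simp add: M.g_diff_left M.g_eq_0_iff)

text \<open>On vertical vectors the component defining \<open>\<phi>\<close> comes from the splitting \<open>D\<^sub>1 \<oplus> D\<^sub>2\<close>, which
  \<open>R\<close> maps to \<open>D\<^sub>1 \<oplus> R D\<^sub>2\<close>. Thus \<open>\<phi>\<close> is expressed by a smooth projection.\<close>

lemma phi_vertical:
  assumes "v \<in> vertical p" shows "phi R D1 p v = R p (M.proj D1 p v)"
  unfolding phi_def
proof (rule component_eqI[OF subspace_D1 linear_subspace_image[OF R_linear subspace_D2]])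
  show "x = 0" if "x \<in> D1 p" "x \<in> R p ` D2 D1 p" for x
    using that R_D2 D1_vertical horizontal_vertical_0 by blast
  show "R p (M.proj D1 p v) \<in> D1 p" by (intro R_D1 M.proj_in D1_smooth)
  show "R p v - R p (M.proj D1 p v) \<in> R p ` D2 D1 p"
    using diff_proj_in_D2[OF assms] by (simp add: linear_diff[OF R_linear, symmetric])
qed

lemma omega_D2:
  assumes "v \<in> D2 D1 p" shows "omega R D1 p v = R p v"
  unfolding omega_def
proof (rule component_eqI[OF linear_subspace_image[OF R_linear subspace_D2] subspace_D1])
  show "x = 0" if "x \<in> R p ` D2 D1 p" "x \<in> D1 p" for x
    using that R_D2 D1_vertical horizontal_vertical_0 by blast
qed (use assms subspace_0[OF subspace_D1] in auto)

lemma vert_R_in_D2: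
  assumes "z \<in> horizontal p" shows "vert p (R p z) \<in> D2 D1 p"
  unfolding D2_def orth_in_def
  using vert_in vert_inner[OF D1_vertical] horizontal_vertical_orth[OF assms D1_vertical[OF R_D1]]
  by (simp add: R_skew)

lemma hor_R_in_mu:
  assumes "z \<in> horizontal p" shows "hor p (R p z) \<in> mu R D1 p"
  unfolding mu_def orth_in_def
  using hor_in hor_inner[OF R_D2] horizontal_vertical_orth[OF assms D2_vertical]
  by (auto simp: R_isometry)

lemma D2_mu_disjoint: "x \<in> D2 D1 p \<Longrightarrow> x \<in> mu R D1 p \<Longrightarrow> x = 0"
  using horizontal_vertical_0 D2_vertical by (auto simp: mu_def orth_in_def)

lemma subspace_mu: "subspace (mu R D1 p)"
  unfolding mu_def by (intro M.subspace_orth_in subspace_horizontal)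

text \<open>For horizontal \<open>z\<close> the vector \<open>R z\<close> is orthogonal to \<open>D\<^sub>1\<close> and to \<open>R D\<^sub>2\<close>, so its
  components in \<open>D\<^sub>2\<close> and \<open>\<mu>\<close> are just its vertical and horizontal parts.\<close>

lemma BB_horizontal: "z \<in> horizontal p \<Longrightarrow> BB R D1 p z = vert p (R p z)"
  unfolding BB_def
  by (rule component_eqI[OF subspace_D2 subspace_mu D2_mu_disjoint vert_R_in_D2])
     (use hor_R_in_mu in \<open>simp_all add: vert_eq\<close>)

lemma CC_horizontal: "z \<in> horizontal p \<Longrightarrow> CC R D1 p z = hor p (R p z)"
  unfolding CC_def
  by (rule component_eqI[OF subspace_mu subspace_D2 D2_mu_disjoint hor_R_in_mu])
     (use vert_R_in_D2 in \<open>simp_all add: vert_eq[symmetric]\<close>)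

lemma hor_R_skew:
  assumes "x \<in> horizontal p" "y \<in> horizontal p"
  shows "gM p y (hor p (R p x)) = - gM p x (hor p (R p y))"
  using hor_inner[OF assms(1), of "R p y"] hor_inner[OF assms(2), of "R p x"]
  by (simp add: M.g_sym[of p y] M.g_sym[of p x] R_skew[of p x y] M.g_sym[of p x "R p y"])

subsection \<open>O'Neill's tensor\<close>

lemma nablaM_0: "smooth_field A X \<Longrightarrow> nablaM X (\<lambda>q. 0) p = 0"
  using affine_connection_scaleR_right[OF connection_M M.smooth_fun_const[of 0], of X "\<lambda>q. 0"]
  by (simp add: M.smooth_field_iff)

lemma sectionsD: "X \<in> sections A D \<Longrightarrow> smooth_field A X" "X \<in> sections A D \<Longrightarrow> X p \<in> D p"
  by (auto simp: sections_def)

lemma oneill_horizontal: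
  assumes Y: "Y \<in> sections A horizontal" and Z: "\<And>q. Z q \<in> horizontal q"
  shows "oneill_A Y Z p = vert p (nablaM Y Z p)"
proof -
  have "(\<lambda>q. hor q (Y q)) = Y" "(\<lambda>q. hor q (Z q)) = Z" "(\<lambda>q. vert q (Z q)) = (\<lambda>q. 0)"
    using sectionsD(2)[OF Y] Z by (simp_all add: hor_horizontal vert_horizontal)
  then show ?thesis
    using nablaM_0[OF sectionsD(1)[OF Y]]
      by (simp add: oneill_A_def hor_vertical subspace_0[OF subspace_vertical])
qed

lemma oneill_vertical:
  assumes Y: "Y \<in> sections A horizontal" and V: "\<And>q. V q \<in> vertical q"
  shows "oneill_A Y V p = hor p (nablaM Y V p)"
proof -
  have "(\<lambda>q. hor q (Y q)) = Y" "(\<lambda>q. vert q (V q)) = V" "(\<lambda>q. hor q (V q)) = (\<lambda>q. 0)"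
    using sectionsD(2)[OF Y] V by (simp_all add: hor_horizontal vert_vertical hor_vertical)
  then show ?thesis
    using nablaM_0[OF sectionsD(1)[OF Y]]
      by (simp add: oneill_A_def vert_horizontal subspace_0[OF subspace_horizontal])
qed

subsection \<open>The two components of the bracket of horizontal fields\<close>

text \<open>The fields \<open>B Z\<close> and \<open>C Z\<close> for horizontal \<open>Z\<close>, by \<open>BB_horizontal\<close> and \<open>CC_horizontal\<close>. In
  this form they are visibly smooth.\<close>

definition B_field :: "('m \<Rightarrow> 'e) \<Rightarrow> 'm \<Rightarrow> 'e" where "B_field Z q = vert q (R q (Z q))"
definition C_field :: "('m \<Rightarrow> 'e) \<Rightarrow> 'm \<Rightarrow> 'e" where "C_field Z q = hor q (R q (Z q))"

lemma smooth_parts: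
  assumes Z: "Z \<in> sections A horizontal"
  shows "smooth_field A (\<lambda>q. R q (Z q))" "smooth_field A (B_field Z)" "smooth_field A (C_field Z)"
    "smooth_field A (\<lambda>q. R q (B_field Z q))" "C_field Z \<in> sections A horizontal"
    "B_field Z q \<in> D2 D1 q" "B_field Z q \<in> vertical q" "R q (B_field Z q) \<in> horizontal q"
proof -
  note z = sectionsD[OF Z]
  show r: "smooth_field A (\<lambda>q. R q (Z q))" and b: "smooth_field A (B_field Z)"
    and c: "smooth_field A (C_field Z)"
    and "smooth_field A (\<lambda>q. R q (B_field Z q))"
    using z(1) unfolding M.smooth_field_iff B_field_def C_field_def
    by (auto intro!: field_smooth_at_R field_smooth_at_vert field_smooth_at_hor)
  show "C_field Z \<in> sections A horizontal" using c by (simp add: sections_def C_field_def hor_in)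
  show d: "B_field Z q \<in> D2 D1 q" unfolding B_field_def by (rule vert_R_in_D2[OF z(2)])
  show "B_field Z q \<in> vertical q" using d by (rule D2_vertical)
  show "R q (B_field Z q) \<in> horizontal q" using d by (rule R_D2)
qed

lemma R_nabla:
  assumes X: "X \<in> sections A horizontal" and Y: "Y \<in> sections A horizontal"
  shows "R p (nablaM X Y p) = nablaM X (B_field Y) p + nablaM X (C_field Y) p"
proof -
  have "(\<lambda>q. R q (Y q)) = (\<lambda>q. B_field Y q + C_field Y q)"
    by (simp add: B_field_def C_field_def add.commute[of "vert _ _"] hor_plus_vert)
  then show ?thesis
    using R_parallel[OF sectionsD(1)[OF X] sectionsD(1)[OF Y]]
      affine_connection_add_right[OF connection_M sectionsD(1)[OF X] smooth_parts(2,3)[OF Y]]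
    by (metis (no_types, lifting))
qed

lemma R_bracket:
  assumes X: "X \<in> sections A horizontal" and Y: "Y \<in> sections A horizontal"
  shows "R p (lie_bracket A X Y p) = nablaM X (B_field Y) p + nablaM X (C_field Y) p -
      nablaM Y (B_field X) p - nablaM Y (C_field X) p"
  unfolding torsion_M[OF sectionsD(1)[OF X] sectionsD(1)[OF Y], symmetric] linear_diff[OF R_linear]
    R_nabla[OF X Y] R_nabla[OF Y X] by simp

text \<open>The field in the first half of the condition, where \<open>\<omega>\<close> acts on \<open>D\<^sub>2\<close> as \<open>R\<close>.\<close>

definition D1_expression :: "('m \<Rightarrow> 'e) \<Rightarrow> ('m \<Rightarrow> 'e) \<Rightarrow> 'm \<Rightarrow> 'e" where
  "D1_expression X Y p =
     oneill_A Y (\<lambda>q. R q (B_field X q)) p - oneill_A X (\<lambda>q. R q (B_field Y q)) p +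
     phi R D1 p (oneill_A Y (C_field X) p - oneill_A X (C_field Y) p)"

lemma
  assumes X: "X \<in> sections A horizontal" and Y: "Y \<in> sections A horizontal"
  shows D1_expression_vertical: "D1_expression X Y p \<in> vertical p"
    and D1_expression_smooth: "smooth_field A (D1_expression X Y)"
    and D1_expression_inner: "w \<in> D1 p \<Longrightarrow> gM p (D1_expression X Y p) w = gM p (lie_bracket A X Y p)
        w"
proof -
  let ?N = "\<lambda>p. nablaM Y (C_field X) p - nablaM X (C_field Y) p"
  have e: "D1_expression X Y p = vert p (R p (nablaM Y (B_field X) p - nablaM X (B_field Y) p)) +
      R p (M.proj D1 p (vert p (?N p)))" for p
  proof -
    have par: "nablaM Y (\<lambda>q. R q (B_field X q)) p = R p (nablaM Y (B_field X) p)" 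
      "nablaM X (\<lambda>q. R q (B_field Y q)) p = R p (nablaM X (B_field Y) p)"
      using R_parallel sectionsD(1)[OF X] sectionsD(1)[OF Y] smooth_parts(2)[OF X]
        smooth_parts(2)[OF Y] by simp_all
    have o: "oneill_A Y (C_field X) p - oneill_A X (C_field Y) p = vert p (?N p)"
      using oneill_horizontal[OF Y sectionsD(2)[OF smooth_parts(5)[OF X]]]
        oneill_horizontal[OF X sectionsD(2)[OF smooth_parts(5)[OF Y]]] by (simp add: vert_diff)
    show ?thesis
      unfolding D1_expression_def oneill_horizontal[OF Y smooth_parts(8)[OF X]]
        oneill_horizontal[OF X smooth_parts(8)[OF Y]] o par phi_vertical[OF vert_in]
      by (simp add: vert_diff linear_diff[OF R_linear])
  qed
  show "D1_expression X Y p \<in> vertical p" unfolding e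
    by (intro subspace_add[OF subspace_vertical] vert_in D1_vertical R_D1 M.proj_in D1_smooth)
  have nab: "field_smooth_at A (nablaM Z (B_field Z')) p" "field_smooth_at A (nablaM Z (C_field Z'))
      p"
    if "Z \<in> sections A horizontal" "Z' \<in> sections A horizontal" for Z Z' p
    by (intro smooth_field_at affine_connection_smooth[OF connection_M] sectionsD(1)[OF that(1)]
        smooth_parts(2,3)[OF that(2)])+
  show "smooth_field A (D1_expression X Y)"
    unfolding M.smooth_field_iff e[abs_def]
    by (intro allI M.field_smooth_at_add M.field_smooth_at_diff field_smooth_at_vert
      field_smooth_at_R
        M.field_smooth_at_proj D1_smooth nab X Y)
  show "gM p (D1_expression X Y p) w = gM p (lie_bracket A X Y p) w" if w: "w \<in> D1 p"
  proof -
    have Rw: "R p w \<in> D1 p" by (rule R_D1[OF w])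
    have "gM p (M.proj D1 p (vert p (?N p))) (R p w) = gM p (?N p) (R p w)"
      using M.proj_orth[OF D1_smooth Rw, of "vert p (?N p)"]
        vert_inner[OF D1_vertical[OF Rw], of "?N p"]
      by (simp add: M.g_diff_left)
    then have "gM p (D1_expression X Y p) w =
        - gM p (nablaM Y (B_field X) p - nablaM X (B_field Y) p) (R p w) - gM p (?N p) (R p w)"
      unfolding e M.g_add_left vert_inner[OF D1_vertical[OF w]] R_skew by simp
    also have "\<dots> = gM p (R p (lie_bracket A X Y p)) (R p w)"
      unfolding R_bracket[OF X Y] by (simp add: M.g_simps)
    finally show ?thesis by (simp add: R_isometry)
  qed
qed

text \<open>The horizontal parts of \<open>\<nabla>\<^sub>X CY\<close> and \<open>\<nabla>\<^sub>Y CX\<close> are replaced through the second fundamental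
  form. The terms with \<open>X(ln \<lambda>)\<close> and \<open>Y(ln \<lambda>)\<close> drop out since \<open>C\<close> has values in \<open>\<mu>\<close>, orthogonal
  to \<open>RV\<close>, and the two gradient terms add up to a factor \<open>2\<close> since \<open>C\<close> is skew.\<close>

lemma D2_expression:
  assumes X: "X \<in> sections A horizontal" and Y: "Y \<in> sections A horizontal"
    and V: "V \<in> sections A (D2 D1)"
  shows "gM p (oneill_A X (B_field Y) p - oneill_A Y (B_field X) p - dfun A lnlam p (C_field Y p)
      *\<^sub>R X p +
        dfun A lnlam p (C_field X p) *\<^sub>R Y p + (2 * gM p (X p) (C_field Y p)) *\<^sub>R gradient A gM
          lnlam p) (R p (V p)) -
      1 / (lam p)\<^sup>2 * gN (F p) (nablaF Y (\<lambda>q. dF q (C_field X q)) p -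
        nablaF X (\<lambda>q. dF q (C_field Y q)) p) (dF p (R p (V p))) =
    gM p (lie_bracket A X Y p) (V p)"
proof -
  let ?Z = "\<lambda>q. R q (V q)"
  have Zh: "?Z q \<in> horizontal q" for q by (rule R_D2[OF sectionsD(2)[OF V]])
  have Z: "?Z \<in> sections A horizontal"
    using Zh sectionsD(1)[OF V]
      by (auto simp: sections_def M.smooth_field_iff intro: field_smooth_at_R)
  have mu: "gM p (C_field W p) (R p (V p)) = 0" if "W \<in> sections A horizontal" for W
    using hor_R_in_mu[OF sectionsD(2)[OF that]] sectionsD(2)[OF V]
      by (auto simp: C_field_def mu_def orth_in_def)
  note sff1 = second_fundamental_form[OF X smooth_parts(5)[OF Y] Z, of p]
  note sff2 = second_fundamental_form[OF Y smooth_parts(5)[OF X] Z, of p]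
  have o: "gM p (oneill_A X (B_field Y) p) (R p (V p)) = gM p (nablaM X (B_field Y) p) (R p (V p))"
    "gM p (oneill_A Y (B_field X) p) (R p (V p)) = gM p (nablaM Y (B_field X) p) (R p (V p))"
    unfolding oneill_vertical[OF X smooth_parts(7)[OF Y]]
      oneill_vertical[OF Y smooth_parts(7)[OF X]]
    by (simp_all add: hor_inner[OF Zh])
  have sk: "gM p (Y p) (C_field X p) = - gM p (X p) (C_field Y p)"
    unfolding C_field_def by (rule hor_R_skew[OF sectionsD(2)[OF X] sectionsD(2)[OF Y]])
  have "gM p (lie_bracket A X Y p) (V p) = gM p (R p (lie_bracket A X Y p)) (R p (V p))"
    by (simp add: R_isometry)
  then show ?thesis
    using sff1 sff2
    unfolding R_bracket[OF X Y] mu[OF X] mu[OF Y] sk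
    by (simp add: M.g_simps N.g_simps o M.gradient_inner[OF lnlam_smooth] right_diff_distrib)
qed

text \<open>For fixed \<open>X\<close>, \<open>Y\<close>, \<open>V\<close> each half of the condition is equivalent to a statement about
  \<open>[X,Y]\<close>.\<close>

lemma condition_P_iff:
  "condition_P R D1 \<longleftrightarrow> (\<forall>X\<in>sections A horizontal. \<forall>Y\<in>sections A horizontal. \<forall>V\<in>sections A (D2 D1).
     (\<forall>p. \<forall>w\<in>D1 p. gM p (lie_bracket A X Y p) w = 0) \<and> (\<forall>p. gM p (lie_bracket A X Y p) (V p) = 0))"
  unfolding condition_P_def Let_def
proof (intro ball_cong refl)
  fix X Y V assume X: "X \<in> sections A horizontal" and Y: "Y \<in> sections A horizontal"
    and V: "V \<in> sections A (D2 D1)"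
  have B: "(\<lambda>p. BB R D1 p (Z p)) = B_field Z" "(\<lambda>p. CC R D1 p (Z p)) = C_field Z"
    "(\<lambda>p. omega R D1 p (B_field Z p)) = (\<lambda>q. R q (B_field Z q))" if Z: "Z \<in> sections A horizontal"
      for Z
    using sectionsD(2)[OF Z] smooth_parts(6)[OF Z]
    by (simp_all add: BB_horizontal CC_horizontal B_field_def[abs_def] C_field_def[abs_def] omega_D2
      vert_R_in_D2)
  have B': "BB R D1 p (Z p) = B_field Z p" "CC R D1 p (Z p) = C_field Z p"
    if "Z \<in> sections A horizontal" for Z p
    using fun_cong[OF B(1)[OF that], of p] fun_cong[OF B(2)[OF that], of p] by auto
  have l: "(\<lambda>p. ln (lam p)) = lnlam" by (simp add: lnlam_def[abs_def])
  have eq: "(a = b) = (c = 0)" if "b - a = c" for a b c :: real using that by auto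
  have first: "(\<lambda>p. D1_expression X Y p) \<in> sections A (D2 D1) \<longleftrightarrow>
      (\<forall>p. \<forall>w\<in>D1 p. gM p (lie_bracket A X Y p) w = 0)"
    using D1_expression_smooth[OF X Y] D1_expression_vertical[OF X Y] D1_expression_inner[OF X Y]
    by (auto simp: sections_def D2_def orth_in_def)
  show "((\<lambda>p. oneill_A Y (\<lambda>p. omega R D1 p (BB R D1 p (X p))) p -
      oneill_A X (\<lambda>p. omega R D1 p (BB R D1 p (Y p))) p +
          phi R D1 p (oneill_A Y (\<lambda>p. CC R D1 p (X p)) p - oneill_A X (\<lambda>p. CC R D1 p (Y p)) p)) \<in>
            sections A (D2 D1) \<and>
     (\<forall>p. 1 / (lam p)\<^sup>2 * gN (F p) (nablaF Y (\<lambda>q. dF q (CC R D1 q (X q))) p -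
       nablaF X (\<lambda>q. dF q (CC R D1 q (Y q))) p) (dF p (R p (V p))) =
        gM p (oneill_A X (\<lambda>p. BB R D1 p (Y p)) p - oneill_A Y (\<lambda>p. BB R D1 p (X p)) p -
           dfun A (\<lambda>p. ln (lam p)) p (CC R D1 p (Y p)) *\<^sub>R X p + dfun A (\<lambda>p. ln (lam p)) p
             (CC R D1 p (X p)) *\<^sub>R Y p +
           (2 * gM p (X p) (CC R D1 p (Y p))) *\<^sub>R gradient A gM (\<lambda>p. ln (lam p)) p) (R p (V p)))) \<longleftrightarrow>
    (\<forall>p. \<forall>w\<in>D1 p. gM p (lie_bracket A X Y p) w = 0) \<and> (\<forall>p. gM p (lie_bracket A X Y p) (V p) = 0)"
    unfolding B[OF X] B[OF Y] B'[OF X] B'[OF Y] l D1_expression_def[symmetric] first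
    unfolding eq[OF D2_expression[OF X Y V]] ..
qed

text \<open>The second half of the condition speaks of sections, but has to be used for single vectors.\<close>

lemma D2_section_through:
  assumes "w \<in> D2 D1 p" obtains V where "V \<in> sections A (D2 D1)" "V p = w"
proof -
  obtain Z where Z: "smooth_field A Z" "Z p = w" by (rule M.extend_vector)
  let ?V = "\<lambda>q. vert q (Z q) - M.proj D1 q (vert q (Z q))"
  show ?thesis
  proof (rule that[of ?V])
    have "smooth_field A ?V" using Z(1) unfolding M.smooth_field_iff
      by (intro allI M.field_smooth_at_diff field_smooth_at_vert M.field_smooth_at_proj D1_smooth)
        blast+
    then show "?V \<in> sections A (D2 D1)" using diff_proj_in_D2[OF vert_in]
      by (simp add: sections_def)
    show "?V p = w" using Z(2) assms by (simp add: vert_vertical[OF D2_vertical] proj_D2)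
  qed
qed

theorem condition_P_iff_involutive: "condition_P R D1 \<longleftrightarrow> involutive"
proof
  assume P: "condition_P R D1"
  show involutive unfolding involutive_def
  proof (intro ballI allI)
    fix X Y p assume X: "X \<in> sections A horizontal" and Y: "Y \<in> sections A horizontal"
    let ?b = "lie_bracket A X Y p"
    note P' = P[unfolded condition_P_iff, rule_format, OF X Y]
    have two: "gM p ?b w = 0" if w: "w \<in> D2 D1 p" for w
    proof -
      obtain V where V: "V \<in> sections A (D2 D1)" "V p = w" by (rule D2_section_through[OF w])
      show ?thesis using P'[OF V(1)] V(2) by blast
    qed
    have one: "gM p ?b w = 0" if w: "w \<in> D1 p" for w
    proof -
      obtain V where V: "V \<in> sections A (D2 D1)" "V p = 0"
        by (rule D2_section_through[OF subspace_0[OF subspace_D2]])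
      show ?thesis using P'[OF V(1)] w by blast
    qed
    have "gM p ?b w = 0" if w: "w \<in> vertical p" for w
    proof -
      have "gM p ?b (M.proj D1 p w + (w - M.proj D1 p w)) = 0"
        unfolding M.g_add_right using one[OF M.proj_in[OF D1_smooth]] two[OF diff_proj_in_D2[OF w]]
          by simp
      then show ?thesis by simp
    qed
    then show "?b \<in> horizontal p" by (simp add: horizontal_def orth_in_def)
  qed
next
  assume inv: involutive
  show "condition_P R D1" unfolding condition_P_iff
  proof (intro ballI conjI allI)
    fix X Y V p w assume X: "X \<in> sections A horizontal" and Y: "Y \<in> sections A horizontal"
      and V: "V \<in> sections A (D2 D1)"
    have b: "lie_bracket A X Y p \<in> horizontal p" using inv X Y by (simp add: involutive_def)
    show "gM p (lie_bracket A X Y p) (V p) = 0"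
      by (rule horizontal_vertical_orth[OF b D2_vertical[OF sectionsD(2)[OF V]]])
    show "gM p (lie_bracket A X Y p) w = 0" if "w \<in> D1 p"
      by (rule horizontal_vertical_orth[OF b D1_vertical[OF that]])
  qed
qed

theorem integrable_iff_condition_P:
  "integrable_distribution TYPE('f) A horizontal \<longleftrightarrow> condition_P R D1"
  using integrable_iff_involutive condition_P_iff_involutive by simp

end

theorem theorem3p7:
  fixes A :: "('m::{t2_space, second_countable_topology}, 'e::euclidean_space) atlas"
    and gM :: "'m \<Rightarrow> 'e \<Rightarrow> 'e \<Rightarrow> real"
    and nablaM :: "('m \<Rightarrow> 'e) \<Rightarrow> ('m \<Rightarrow> 'e) \<Rightarrow> 'm \<Rightarrow> 'e"
    and I J K :: "'m \<Rightarrow> 'e \<Rightarrow> 'e"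
    and B :: "('n::{t2_space, second_countable_topology}, 'f::euclidean_space) atlas"
    and gN :: "'n \<Rightarrow> 'f \<Rightarrow> 'f \<Rightarrow> real"
    and nablaN :: "('n \<Rightarrow> 'f) \<Rightarrow> ('n \<Rightarrow> 'f) \<Rightarrow> 'n \<Rightarrow> 'f"
    and nablaF :: "('m \<Rightarrow> 'e) \<Rightarrow> ('m \<Rightarrow> 'f) \<Rightarrow> 'm \<Rightarrow> 'f"
    and F :: "'m \<Rightarrow> 'n"
    and lam :: "'m \<Rightarrow> real"
    and D1I D1J D1K :: "'m \<Rightarrow> 'e set"
  assumes "hyperkaehler_manifold A gM nablaM I J K"
    and "riemannian_manifold B gN"
    and "levi_civita B gN nablaN"
    and "pullback_connection A B F nablaN nablaF"
    and "submersion_data.horizontally_conformal_submersion A gM B gN F lam"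
    and "submersion_data.semi_invariant A gM B F I D1I"
    and "submersion_data.semi_invariant A gM B F J D1J"
    and "submersion_data.semi_invariant A gM B F K D1K"
  shows "(integrable_distribution TYPE('f) A (submersion_data.horizontal A gM B F) \<longleftrightarrow>
            submersion_data.condition_P A gM nablaM B gN nablaF F lam I D1I) \<and>
         (integrable_distribution TYPE('f) A (submersion_data.horizontal A gM B F) \<longleftrightarrow>
            submersion_data.condition_P A gM nablaM B gN nablaF F lam J D1J) \<and>
         (integrable_distribution TYPE('f) A (submersion_data.horizontal A gM B F) \<longleftrightarrow>
            submersion_data.condition_P A gM nablaM B gN nablaF F lam K D1K)"
proof -
  have conf: "conformal_submersion_connections A gM nablaM B gN nablaF F lam nablaN"
    using assms(1-5) by unfold_locales (auto simp: hyperkaehler_manifold_def)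
  have main: "integrable_distribution TYPE('f) A (submersion_data.horizontal A gM B F) \<longleftrightarrow>
      submersion_data.condition_P A gM nablaM B gN nablaF F lam R D"
    if R: "R \<in> {I, J, K}" and D: "submersion_data.semi_invariant A gM B F R D" for R D
  proof -
    interpret conformal_submersion_connections A gM nablaM B gN nablaF F lam nablaN by (rule conf)
    have "R p (R p v) = - v" for p v
      using R assms(1) unfolding hyperkaehler_manifold_def by auto
    then interpret kaehler_semi_invariant A gM nablaM B gN nablaF F lam nablaN R D
      using R D assms(1) unfolding hyperkaehler_manifold_def by unfold_locales blast+
    show ?thesis by (rule integrable_iff_condition_P)
  qed
  show ?thesis using main[OF _ assms(6)] main[OF _ assms(7)] main[OF _ assms(8)] by simp
qed

end
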